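(* For a given space of traces $M$, the space $\Sigma\times V$ admits an $M$-decomposition if and only if (a) $\mathrm{tr}(\Sigma\times V)\subset M$, (b) $\epsilon(V)\subset\Sigma$ and $\nabla\cdot\Sigma\subset V$, (c) $I_M(\Sigma\times V)=0$. In this case, $$M=\{\tau n|_{\partial K}:\tau\in\Sigma,\ \nabla\cdot\tau=0\}\oplus\{v|_{\partial K}:v\in V,\ \epsilon(v)=0\},$$ where the sum is orthogonal (in $L^2(\partial K)^n$).
   Context: $K\subset\mathbb R^n$ ($n=2,3$) is a polygonal/polyhedral element with outward unit normal (also denoted $n$) on $\partial K$; $\mathbb S$ is the space of real symmetric $n\times n$ matrices. $\Sigma$ is a finite-dimensional subspace of $\{\tau\in H(\mathrm{div},K;\mathbb S):\tau n|_{\partial K}\in L^2(\partial K)^n\}$, $V$ a finite-dimensional subspace of $H^1(K)^n$, $M$ a finite-dimensional subspace of $L^2(\partial K)^n$. $\epsilon(v)=\frac12(\nabla v+\nabla v^T)$ and $\nabla\cdot\tau$ is the row-wise divergence. Let $\mathrm{tr}(\tau,v)=(\tau n+v)|_{\partial K}$. $M$-decomposition: $\Sigma\times V$ admits an $M$-decomposition if $\mathrm{tr}(\Sigma\times V)\subset M$ and there exist subspaces $\widetilde\Sigma\subset\Sigma$, $\widetilde V\subset V$ with $\epsilon(V)\subset\widetilde\Sigma$, $\nabla\cdot\Sigma\subset\widetilde V$, such that $\mathrm{tr}:\widetilde\Sigma^\perp\times\widetilde V^\perp\to M$ is an isomorphism, where $\widetilde\Sigma^\perp$, $\widetilde V^\perp$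 are the $L^2(K)$-orthogonal complements of $\widetilde\Sigma$ in $\Sigma$ and of $\widetilde V$ in $V$. $M$-index: $I_M(\Sigma\times V)=\dim M-\dim\{\tau n|_{\partial K}:\tau\in\Sigma,\nabla\cdot\tau=0\}-\dim\{v|_{\partial K}:v\in V,\epsilon(v)=0\}$. *)

theory Defs
  imports "HOL-Analysis.Analysis"
begin

text \<open>
  Elements of an \<open>L\<^sup>2\<close> space are classes of functions modulo equality almost everywhere.  A subspace
  is rendered by the set of all representatives of its elements, i.e. by a linear set of
  square-integrable functions that is closed under a.e. equality; such sets correspond one-to-one to
  the subspaces of the quotient, and dimensions are taken in the quotient.
\<close>

definition L2 :: "'a measure \<Rightarrow> ('a \<Rightarrow> 'b::euclidean_space) set" where
  "L2 \<mu> = {f \<in> borel_measurable \<mu>. integrable \<mu> (\<lambda>x. (norm (f x))\<^sup>2)}"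

definition l2_inner :: "'a measure \<Rightarrow> ('a \<Rightarrow> 'b::euclidean_space) \<Rightarrow> ('a \<Rightarrow> 'b) \<Rightarrow> real" where
  "l2_inner \<mu> f g = (\<integral>x. f x \<bullet> g x \<partial>\<mu>)"

definition l2_subspace :: "'a measure \<Rightarrow> ('a \<Rightarrow> 'b::euclidean_space) set \<Rightarrow> bool" where
  "l2_subspace \<mu> S \<longleftrightarrow>
     S \<subseteq> L2 \<mu> \<and> (\<lambda>x. 0) \<in> S \<and>
     (\<forall>f\<in>S. \<forall>g\<in>S. (\<lambda>x. f x + g x) \<in> S) \<and>
     (\<forall>c. \<forall>f\<in>S. (\<lambda>x. c *\<^sub>R f x) \<in> S) \<and>
     (\<forall>f\<in>S. \<forall>g\<in>L2 \<mu>. (AE x in \<mu>. g x = f x) \<longrightarrow> g \<in> S)"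

definition l2_generates ::
    "'a measure \<Rightarrow> ('a \<Rightarrow> 'b::euclidean_space) set \<Rightarrow> ('a \<Rightarrow> 'b) set \<Rightarrow> bool" where
  "l2_generates \<mu> B S \<longleftrightarrow>
     finite B \<and> B \<subseteq> S \<and> (\<forall>f\<in>S. \<exists>c. AE x in \<mu>. f x = (\<Sum>b\<in>B. c b *\<^sub>R b x))"

definition l2_findim_subspace :: "'a measure \<Rightarrow> ('a \<Rightarrow> 'b::euclidean_space) set \<Rightarrow> bool" where
  "l2_findim_subspace \<mu> S \<longleftrightarrow> l2_subspace \<mu> S \<and> (\<exists>B. l2_generates \<mu> B S)"

definition l2_dim :: "'a measure \<Rightarrow> ('a \<Rightarrow> 'b::euclidean_space) set \<Rightarrow> nat" where
  "l2_dim \<mu> S = (LEAST k. \<exists>B. l2_generates \<mu> B S \<and> card B = k)"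

definition l2_orth_compl ::
    "'a measure \<Rightarrow> ('a \<Rightarrow> 'b::euclidean_space) set \<Rightarrow> ('a \<Rightarrow> 'b) set \<Rightarrow> ('a \<Rightarrow> 'b) set" where
  "l2_orth_compl \<mu> S T = {f \<in> S. \<forall>g\<in>T. l2_inner \<mu> f g = 0}"

definition l2_sum ::
    "'a measure \<Rightarrow> ('a \<Rightarrow> 'b::euclidean_space) set \<Rightarrow> ('a \<Rightarrow> 'b) set \<Rightarrow> ('a \<Rightarrow> 'b) set" where
  "l2_sum \<mu> A B = {h \<in> L2 \<mu>. \<exists>f\<in>A. \<exists>g\<in>B. AE x in \<mu>. h x = f x + g x}"

definition l2_orthogonal_direct_sum ::
    "'a measure \<Rightarrow> ('a \<Rightarrow> 'b::euclidean_space) set \<Rightarrow> ('a \<Rightarrow> 'b) set \<Rightarrow> ('a \<Rightarrow> 'b) set \<Rightarrow> bool" where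
  "l2_orthogonal_direct_sum \<mu> S A B \<longleftrightarrow>
     S = l2_sum \<mu> A B \<and>
     (\<forall>f\<in>A \<inter> B. AE x in \<mu>. f x = 0) \<and>
     (\<forall>f\<in>A. \<forall>g\<in>B. l2_inner \<mu> f g = 0)"


text \<open>
  Elements are open sets.  They need not be convex; being the interior of a closed set, they have no
  slits.
\<close>

definition polyhedral_element :: "(real^'n) set \<Rightarrow> bool" where
  "polyhedral_element K \<longleftrightarrow>
     K \<noteq> {} \<and> connected K \<and>
     (\<exists>\<T>. finite \<T> \<and> (\<forall>P\<in>\<T>. polytope P) \<and> K = interior (\<Union>\<T>))"

definition outward_normal_at :: "(real^'n) set \<Rightarrow> real^'n \<Rightarrow> real^'n \<Rightarrow> bool" where
  "outward_normal_at K x \<nu> \<longleftrightarrow>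
     norm \<nu> = 1 \<and> (\<exists>r>0. K \<inter> ball x r = {y \<in> ball x r. y \<bullet> \<nu> < x \<bullet> \<nu>})"

text \<open>
  The part of the boundary in the hyperplane \<open>y \<bullet> \<nu> = b\<close> whose outward normal is \<open>\<nu>\<close>.  These parts
  are pairwise disjoint, finitely many of them are nonempty, and together they exhaust the boundary
  up to the edges and vertices.
\<close>

definition facet :: "(real^'n) set \<Rightarrow> real^'n \<Rightarrow> real \<Rightarrow> (real^'n) set" where
  "facet K \<nu> b = {x. x \<bullet> \<nu> = b \<and> outward_normal_at K x \<nu>}"

text \<open>
  The \<open>(n-1)\<close>-dimensional Lebesgue measure of a subset of a hyperplane is the volume of the right
  prism of height one over it.
\<close>

definition surface_measure :: "(real^'n) set \<Rightarrow> (real^'n) measure" where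
  "surface_measure K = measure_of UNIV (sets borel)
     (\<lambda>A. \<Sum>(\<nu>, b) \<in> {(\<nu>, b). facet K \<nu> b \<noteq> {}}.
        emeasure lborel {y + t *\<^sub>R \<nu> | y t. y \<in> A \<inter> facet K \<nu> b \<and> t \<in> {0..1}})"


definition C1 :: "(real^'n \<Rightarrow> 'b::real_normed_vector) \<Rightarrow> bool" where
  "C1 \<phi> \<longleftrightarrow> (\<forall>x. \<phi> differentiable (at x)) \<and>
           (\<forall>h. continuous_on UNIV (\<lambda>x. frechet_derivative \<phi> (at x) h))"

definition partial_deriv :: "'n \<Rightarrow> (real^'n \<Rightarrow> real) \<Rightarrow> real^'n \<Rightarrow> real" where
  "partial_deriv j \<phi> x = frechet_derivative \<phi> (at x) (axis j 1)"

text \<open>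
  Weak derivatives are tested against \<open>C\<^sup>1\<close> functions with compact support in \<open>K\<close>; by mollification
  this gives the same notion as testing against smooth functions.
\<close>

definition test_function :: "(real^'n) set \<Rightarrow> (real^'n \<Rightarrow> real) \<Rightarrow> bool" where
  "test_function K \<phi> \<longleftrightarrow> C1 \<phi> \<and> (\<exists>C. compact C \<and> C \<subseteq> K \<and> (\<forall>x. x \<notin> C \<longrightarrow> \<phi> x = 0))"

text \<open>\<open>(\<nabla>v)\<^sub>i\<^sub>j = \<partial>\<^sub>j v\<^sub>i\<close>\<close>

definition weak_grad ::
    "(real^'n) set \<Rightarrow> (real^'n \<Rightarrow> real^'n) \<Rightarrow> (real^'n \<Rightarrow> real^'n^'n) \<Rightarrow> bool" where
  "weak_grad K v G \<longleftrightarrow>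
     v \<in> L2 (lebesgue_on K) \<and> G \<in> L2 (lebesgue_on K) \<and>
     (\<forall>\<phi> i j. test_function K \<phi> \<longrightarrow>
        (\<integral>x. v x $ i * partial_deriv j \<phi> x \<partial>lebesgue_on K) =
        - (\<integral>x. G x $ i $ j * \<phi> x \<partial>lebesgue_on K))"

definition H1 :: "(real^'n) set \<Rightarrow> (real^'n \<Rightarrow> real^'n) set" where
  "H1 K = {v. \<exists>G. weak_grad K v G}"

definition weak_sym_grad ::
    "(real^'n) set \<Rightarrow> (real^'n \<Rightarrow> real^'n) \<Rightarrow> (real^'n \<Rightarrow> real^'n^'n) \<Rightarrow> bool" where
  "weak_sym_grad K v e \<longleftrightarrow>
     e \<in> L2 (lebesgue_on K) \<and>
     (\<exists>G. weak_grad K v G \<and>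
          (AE x in lebesgue_on K. e x = (1/2) *\<^sub>R (G x + transpose (G x))))"

definition weak_div ::
    "(real^'n) set \<Rightarrow> (real^'n \<Rightarrow> real^'n^'n) \<Rightarrow> (real^'n \<Rightarrow> real^'n) \<Rightarrow> bool" where
  "weak_div K \<tau> d \<longleftrightarrow>
     \<tau> \<in> L2 (lebesgue_on K) \<and> d \<in> L2 (lebesgue_on K) \<and>
     (\<forall>\<phi> i. test_function K \<phi> \<longrightarrow>
        (\<integral>x. (\<Sum>j\<in>UNIV. \<tau> x $ i $ j * partial_deriv j \<phi> x) \<partial>lebesgue_on K) =
        - (\<integral>x. d x $ i * \<phi> x \<partial>lebesgue_on K))"

definition Hdiv_sym :: "(real^'n) set \<Rightarrow> (real^'n \<Rightarrow> real^'n^'n) set" where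
  "Hdiv_sym K = {\<tau>. (\<exists>d. weak_div K \<tau> d) \<and> (AE x in lebesgue_on K. transpose (\<tau> x) = \<tau> x)}"


text \<open>
  The trace operator is the bounded linear extension to \<open>H\<^sup>1\<close> of the restriction to the boundary of
  functions that are \<open>C\<^sup>1\<close> up to the boundary.  For polyhedral elements it exists, and it is unique
  because these functions are dense in \<open>H\<^sup>1\<close>.
\<close>

definition is_trace_operator ::
    "(real^'n) set \<Rightarrow> ((real^'n \<Rightarrow> real^'n) \<Rightarrow> (real^'n \<Rightarrow> real^'n)) \<Rightarrow> bool" where
  "is_trace_operator K \<gamma> \<longleftrightarrow>
     (\<forall>u\<in>H1 K. \<gamma> u \<in> L2 (surface_measure K)) \<and>
     (\<forall>u\<in>H1 K. \<forall>v\<in>H1 K. AE x in surface_measure K. \<gamma> (\<lambda>y. u y + v y) x = \<gamma> u x + \<gamma> v x) \<and>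
     (\<forall>c. \<forall>u\<in>H1 K. AE x in surface_measure K. \<gamma> (\<lambda>y. c *\<^sub>R u y) x = c *\<^sub>R \<gamma> u x) \<and>
     (\<exists>C. \<forall>u G. weak_grad K u G \<longrightarrow>
        l2_inner (surface_measure K) (\<gamma> u) (\<gamma> u) \<le>
          C * (l2_inner (lebesgue_on K) u u + l2_inner (lebesgue_on K) G G)) \<and>
     (\<forall>u. C1 u \<longrightarrow> (AE x in surface_measure K. \<gamma> u x = u x))"

definition bdry_trace :: "(real^'n) set \<Rightarrow> (real^'n \<Rightarrow> real^'n) \<Rightarrow> (real^'n \<Rightarrow> real^'n)" where
  "bdry_trace K = (SOME \<gamma>. is_trace_operator K \<gamma>)"

text \<open>
  For \<open>\<tau>\<close> in \<open>H(div)\<close>, \<open>\<tau> n\<close> on the boundary is by definition the functional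
  \<open>v \<mapsto> (\<tau>, \<nabla>v)\<^sub>K + (\<nabla>\<cdot>\<tau>, v)\<^sub>K\<close> on the traces of \<open>H\<^sup>1\<close> functions \<open>v\<close>.  It lies in
  \<open>L\<^sup>2\<close> of the boundary if it is represented by some \<open>g\<close> there.
\<close>

definition normal_trace ::
    "(real^'n) set \<Rightarrow> (real^'n \<Rightarrow> real^'n^'n) \<Rightarrow> (real^'n \<Rightarrow> real^'n) \<Rightarrow> bool" where
  "normal_trace K \<tau> g \<longleftrightarrow>
     g \<in> L2 (surface_measure K) \<and>
     (\<exists>d. weak_div K \<tau> d \<and>
       (\<forall>v G. weak_grad K v G \<longrightarrow>
          l2_inner (surface_measure K) g (bdry_trace K v) =
          l2_inner (lebesgue_on K) \<tau> G + l2_inner (lebesgue_on K) d v))"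

definition stress_space :: "(real^'n) set \<Rightarrow> (real^'n \<Rightarrow> real^'n^'n) set" where
  "stress_space K = {\<tau> \<in> Hdiv_sym K. \<exists>g. normal_trace K \<tau> g}"

text \<open>\<open>g\<close> represents \<open>tr (\<tau>, v)\<close>\<close>

definition tr ::
    "(real^'n) set \<Rightarrow> (real^'n \<Rightarrow> real^'n^'n) \<Rightarrow> (real^'n \<Rightarrow> real^'n) \<Rightarrow> (real^'n \<Rightarrow> real^'n) \<Rightarrow> bool"
  where
  "tr K \<tau> v g \<longleftrightarrow>
     g \<in> L2 (surface_measure K) \<and>
     (\<exists>h. normal_trace K \<tau> h \<and> (AE x in surface_measure K. g x = h x + bdry_trace K v x))"

definition tr_image ::
    "(real^'n) set \<Rightarrow> (real^'n \<Rightarrow> real^'n^'n) set \<Rightarrow> (real^'n \<Rightarrow> real^'n) set \<Rightarrow>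
     (real^'n \<Rightarrow> real^'n) set" where
  "tr_image K S V = {g. \<exists>\<tau>\<in>S. \<exists>v\<in>V. tr K \<tau> v g}"

definition sym_grad_image ::
    "(real^'n) set \<Rightarrow> (real^'n \<Rightarrow> real^'n) set \<Rightarrow> (real^'n \<Rightarrow> real^'n^'n) set" where
  "sym_grad_image K V = {e. \<exists>v\<in>V. weak_sym_grad K v e}"

definition div_image ::
    "(real^'n) set \<Rightarrow> (real^'n \<Rightarrow> real^'n^'n) set \<Rightarrow> (real^'n \<Rightarrow> real^'n) set" where
  "div_image K S = {d. \<exists>\<tau>\<in>S. weak_div K \<tau> d}"

text \<open>\<open>S\<close> stands for \<open>\<Sigma>\<close>.\<close>

definition admits_M_decomposition ::
    "(real^'n) set \<Rightarrow> (real^'n \<Rightarrow> real^'n^'n) set \<Rightarrow> (real^'n \<Rightarrow> real^'n) set \<Rightarrow>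
     (real^'n \<Rightarrow> real^'n) set \<Rightarrow> bool" where
  "admits_M_decomposition K S V M \<longleftrightarrow>
     tr_image K S V \<subseteq> M \<and>
     (\<exists>S' V'. l2_subspace (lebesgue_on K) S' \<and> S' \<subseteq> S \<and>
              l2_subspace (lebesgue_on K) V' \<and> V' \<subseteq> V \<and>
              sym_grad_image K V \<subseteq> S' \<and> div_image K S \<subseteq> V' \<and>
              (let Sp = l2_orth_compl (lebesgue_on K) S S';
                   Vp = l2_orth_compl (lebesgue_on K) V V'
               in tr_image K Sp Vp = M \<and>
                  (\<forall>\<tau>\<in>Sp. \<forall>\<tau>'\<in>Sp. \<forall>v\<in>Vp. \<forall>v'\<in>Vp. \<forall>g. tr K \<tau> v g \<and> tr K \<tau>' v' g \<longrightarrow>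
                     (AE x in lebesgue_on K. \<tau> x = \<tau>' x) \<and>
                     (AE x in lebesgue_on K. v x = v' x))))"

definition divfree_normal_traces ::
    "(real^'n) set \<Rightarrow> (real^'n \<Rightarrow> real^'n^'n) set \<Rightarrow> (real^'n \<Rightarrow> real^'n) set" where
  "divfree_normal_traces K S = {g. \<exists>\<tau>\<in>S. weak_div K \<tau> (\<lambda>x. 0) \<and> normal_trace K \<tau> g}"

definition rigid_traces ::
    "(real^'n) set \<Rightarrow> (real^'n \<Rightarrow> real^'n) set \<Rightarrow> (real^'n \<Rightarrow> real^'n) set" where
  "rigid_traces K V =
     {g \<in> L2 (surface_measure K).
        \<exists>v\<in>V. weak_sym_grad K v (\<lambda>x. 0) \<and> (AE x in surface_measure K. g x = bdry_trace K v x)}"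

definition M_index ::
    "(real^'n) set \<Rightarrow> (real^'n \<Rightarrow> real^'n^'n) set \<Rightarrow> (real^'n \<Rightarrow> real^'n) set \<Rightarrow>
     (real^'n \<Rightarrow> real^'n) set \<Rightarrow> int" where
  "M_index K S V M =
     int (l2_dim (surface_measure K) M)
     - int (l2_dim (surface_measure K) (divfree_normal_traces K S))
     - int (l2_dim (surface_measure K) (rigid_traces K V))"

end

theory Submission
  imports Defs
begin

text \<open>
  Everything rests on Green's formula \<open>\<langle>\<tau> n, v\<rangle> = (\<tau>, \<epsilon>(v)) + (\<nabla>\<cdot>\<tau>, v)\<close>.  It makes normal traces of
  divergence-free stresses orthogonal to traces of rigid motions, so the index vanishes if and only
  if these two spaces sum to \<open>M\<close>; that sum is equivalent to the existence of an \<open>M\<close>-decomposition by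
  duality arguments in finite dimensions.  No Korn inequality and no uniqueness of normal traces is
  needed: rigid motions with zero trace can be absorbed into the subspace of \<open>V\<close> containing \<open>\<nabla>\<cdot>\<Sigma>\<close>.

  The analytic prerequisite is that the trace operator exists.  The trace inequality for \<open>C\<^sup>1\<close> functions
  is obtained by integrating along segments from a face into a convex piece of the element, and the
  trace is extended to \<open>H\<^sup>1\<close> through the orthogonal projection onto the closure of the \<open>C\<^sup>1\<close> functions, so
  that their density is not needed.
\<close>

section \<open>Square-integrable functions\<close>

lemma L2D:
  assumes "f \<in> L2 \<mu>"
  shows "f \<in> borel_measurable \<mu>" "integrable \<mu> (\<lambda>x. (norm (f x))\<^sup>2)"
  using assms by (auto simp: L2_def)

lemma L2_inner_integrable:
  assumes "f \<in> L2 \<mu>" "g \<in> L2 \<mu>"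
  shows "integrable \<mu> (\<lambda>x. f x \<bullet> g x)"
proof (rule Bochner_Integration.integrable_bound)
  show "integrable \<mu> (\<lambda>x. (norm (f x))\<^sup>2 + (norm (g x))\<^sup>2)"
    using assms by (intro Bochner_Integration.integrable_add L2D)
  show "(\<lambda>x. f x \<bullet> g x) \<in> borel_measurable \<mu>"
    using assms[THEN L2D(1)] by measurable
  show "AE x in \<mu>. norm (f x \<bullet> g x) \<le> norm ((norm (f x))\<^sup>2 + (norm (g x))\<^sup>2)"
  proof (rule AE_I2)
    fix x
    have "\<bar>f x \<bullet> g x\<bar> \<le> norm (f x) * norm (g x)"
      by (rule Cauchy_Schwarz_ineq2)
    also have "\<dots> \<le> (norm (f x))\<^sup>2 + (norm (g x))\<^sup>2"
      using sum_squares_bound[of "norm (f x)" "norm (g x)"]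
        mult_nonneg_nonneg[OF norm_ge_zero norm_ge_zero, of "f x" "g x"] by linarith
    finally show "norm (f x \<bullet> g x) \<le> norm ((norm (f x))\<^sup>2 + (norm (g x))\<^sup>2)"
      by simp
  qed
qed

lemma L2_zero [simp, intro]: "(\<lambda>x. 0) \<in> L2 \<mu>"
  by (simp add: L2_def)

lemma L2_add [intro]:
  assumes "f \<in> L2 \<mu>" "g \<in> L2 \<mu>"
  shows "(\<lambda>x. f x + g x) \<in> L2 \<mu>"
proof -
  have "integrable \<mu> (\<lambda>x. (norm (f x))\<^sup>2 + 2 * (f x \<bullet> g x) + (norm (g x))\<^sup>2)"
    using assms by (intro Bochner_Integration.integrable_add integrable_mult_right
        L2D L2_inner_integrable)
  then have "integrable \<mu> (\<lambda>x. (norm (f x + g x))\<^sup>2)"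
    by (simp add: power2_norm_eq_inner inner_add_left inner_add_right inner_commute algebra_simps)
  then show ?thesis
    using assms[THEN L2D(1)] by (simp add: L2_def)
qed

lemma L2_scaleR [intro]:
  assumes "f \<in> L2 \<mu>"
  shows "(\<lambda>x. c *\<^sub>R f x) \<in> L2 \<mu>"
  using assms by (auto simp: L2_def power_mult_distrib)

lemma L2_minus [intro]: "f \<in> L2 \<mu> \<Longrightarrow> (\<lambda>x. - f x) \<in> L2 \<mu>"
  by (auto simp: L2_def)

lemma L2_diff [intro]:
  assumes "f \<in> L2 \<mu>" "g \<in> L2 \<mu>"
  shows "(\<lambda>x. f x - g x) \<in> L2 \<mu>"
  using L2_add[OF assms(1) L2_minus[OF assms(2)]] by simp

lemma L2_sum [intro]:
  assumes "\<And>i. i \<in> I \<Longrightarrow> f i \<in> L2 \<mu>"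
  shows "(\<lambda>x. \<Sum>i\<in>I. f i x) \<in> L2 \<mu>"
  using assms by (induction I rule: infinite_finite_induct) auto

lemma l2_inner_commute: "l2_inner \<mu> f g = l2_inner \<mu> g f"
  by (simp add: l2_inner_def inner_commute)

lemma l2_inner_add_left:
  "\<lbrakk>f \<in> L2 \<mu>; g \<in> L2 \<mu>; h \<in> L2 \<mu>\<rbrakk> \<Longrightarrow>
    l2_inner \<mu> (\<lambda>x. f x + g x) h = l2_inner \<mu> f h + l2_inner \<mu> g h"
  by (simp add: l2_inner_def inner_add_left L2_inner_integrable)

lemma l2_inner_add_right:
  "\<lbrakk>f \<in> L2 \<mu>; g \<in> L2 \<mu>; h \<in> L2 \<mu>\<rbrakk> \<Longrightarrow>
    l2_inner \<mu> h (\<lambda>x. f x + g x) = l2_inner \<mu> h f + l2_inner \<mu> h g"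
  by (simp add: l2_inner_def inner_add_right L2_inner_integrable)

lemma l2_inner_diff_left:
  "\<lbrakk>f \<in> L2 \<mu>; g \<in> L2 \<mu>; h \<in> L2 \<mu>\<rbrakk> \<Longrightarrow>
    l2_inner \<mu> (\<lambda>x. f x - g x) h = l2_inner \<mu> f h - l2_inner \<mu> g h"
  by (simp add: l2_inner_def inner_diff_left L2_inner_integrable)

lemma l2_inner_diff_right:
  "\<lbrakk>f \<in> L2 \<mu>; g \<in> L2 \<mu>; h \<in> L2 \<mu>\<rbrakk> \<Longrightarrow>
    l2_inner \<mu> h (\<lambda>x. f x - g x) = l2_inner \<mu> h f - l2_inner \<mu> h g"
  by (simp add: l2_inner_def inner_diff_right L2_inner_integrable)

lemma l2_inner_scaleR_left [simp]:
  "l2_inner \<mu> (\<lambda>x. c *\<^sub>R f x) h = c * l2_inner \<mu> f h"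
  by (simp add: l2_inner_def)

lemma l2_inner_scaleR_right [simp]:
  "l2_inner \<mu> h (\<lambda>x. c *\<^sub>R f x) = c * l2_inner \<mu> h f"
  by (simp add: l2_inner_def)

lemma l2_inner_zero [simp]: "l2_inner \<mu> (\<lambda>x. 0) h = 0" "l2_inner \<mu> h (\<lambda>x. 0) = 0"
  by (simp_all add: l2_inner_def)

lemma l2_inner_sum_left:
  "\<lbrakk>\<And>i. i \<in> I \<Longrightarrow> f i \<in> L2 \<mu>; h \<in> L2 \<mu>\<rbrakk> \<Longrightarrow>
    l2_inner \<mu> (\<lambda>x. \<Sum>i\<in>I. f i x) h = (\<Sum>i\<in>I. l2_inner \<mu> (f i) h)"
  by (simp add: l2_inner_def inner_sum_left L2_inner_integrable)

lemma l2_inner_sum_right: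
  "\<lbrakk>\<And>i. i \<in> I \<Longrightarrow> f i \<in> L2 \<mu>; h \<in> L2 \<mu>\<rbrakk> \<Longrightarrow>
    l2_inner \<mu> h (\<lambda>x. \<Sum>i\<in>I. f i x) = (\<Sum>i\<in>I. l2_inner \<mu> h (f i))"
  by (simp add: l2_inner_def inner_sum_right L2_inner_integrable)

lemma l2_inner_cong_AE:
  assumes "f \<in> L2 \<mu>" "f' \<in> L2 \<mu>" "g \<in> L2 \<mu>" "g' \<in> L2 \<mu>"
    and "AE x in \<mu>. f x = f' x" "AE x in \<mu>. g x = g' x"
  shows "l2_inner \<mu> f g = l2_inner \<mu> f' g'"
  unfolding l2_inner_def
proof (rule integral_cong_AE)
  show "AE x in \<mu>. f x \<bullet> g x = f' x \<bullet> g' x"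
    using assms(5,6) by eventually_elim simp
qed (use assms L2_inner_integrable borel_measurable_integrable in blast)+

lemma l2_inner_AE_zero:
  assumes "f \<in> L2 \<mu>" "g \<in> L2 \<mu>" "AE x in \<mu>. f x = 0"
  shows "l2_inner \<mu> f g = 0" "l2_inner \<mu> g f = 0"
  using l2_inner_cong_AE[of f \<mu> "\<lambda>x. 0" g g] assms by (auto simp: l2_inner_commute)

lemma l2_inner_self_nonneg: "0 \<le> l2_inner \<mu> f f"
  by (simp add: l2_inner_def)

lemma l2_inner_self_eq_0_iff:
  assumes "f \<in> L2 \<mu>"
  shows "l2_inner \<mu> f f = 0 \<longleftrightarrow> (AE x in \<mu>. f x = 0)"
  using integral_nonneg_eq_0_iff_AE[OF L2_inner_integrable[OF assms assms]]
  by (simp add: l2_inner_def)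

lemma l2_Cauchy_Schwarz:
  assumes f: "f \<in> L2 \<mu>" and g: "g \<in> L2 \<mu>"
  shows "\<bar>l2_inner \<mu> f g\<bar> \<le> sqrt (l2_inner \<mu> f f) * sqrt (l2_inner \<mu> g g)"
proof -
  let ?a = "l2_inner \<mu> f f" and ?b = "l2_inner \<mu> f g" and ?c = "l2_inner \<mu> g g"
  have q: "0 \<le> ?a - 2 * t * ?b + t\<^sup>2 * ?c" for t
  proof -
    have "0 \<le> l2_inner \<mu> (\<lambda>x. f x - t *\<^sub>R g x) (\<lambda>x. f x - t *\<^sub>R g x)"
      by (rule l2_inner_self_nonneg)
    also have "\<dots> = ?a - 2 * t * ?b + t\<^sup>2 * ?c"
      using f g by (simp add: l2_inner_diff_left l2_inner_diff_right L2_diff L2_scaleR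
          l2_inner_commute[of \<mu> g f] power2_eq_square algebra_simps)
    finally show ?thesis .
  qed
  have "?b\<^sup>2 \<le> ?a * ?c"
  proof (cases "?c = 0")
    case True
    then have "?b = 0"
      using l2_inner_AE_zero[OF g f] l2_inner_self_eq_0_iff[OF g] by simp
    then show ?thesis by (simp add: True)
  next
    case False
    then have c: "?c > 0" using l2_inner_self_nonneg[of \<mu> g] by linarith
    have "0 \<le> ?c * (?a - 2 * (?b / ?c) * ?b + (?b / ?c)\<^sup>2 * ?c)"
      using q[of "?b / ?c"] c by (intro mult_nonneg_nonneg) auto
    also have "\<dots> = ?a * ?c - ?b\<^sup>2"
      using c by (simp add: field_simps power2_eq_square)
    finally show ?thesis by simp
  qed
  then have "sqrt (?b\<^sup>2) \<le> sqrt (?a * ?c)" by (rule real_sqrt_le_mono)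
  then show ?thesis by (simp add: real_sqrt_mult)
qed

definition l2_norm :: "'a measure \<Rightarrow> ('a \<Rightarrow> 'b::euclidean_space) \<Rightarrow> real" where
  "l2_norm \<mu> f = sqrt (l2_inner \<mu> f f)"

lemma l2_norm_nonneg [simp]: "0 \<le> l2_norm \<mu> f"
  by (simp add: l2_norm_def l2_inner_self_nonneg)

lemma l2_norm_squared: "(l2_norm \<mu> f)\<^sup>2 = l2_inner \<mu> f f"
  by (simp add: l2_norm_def l2_inner_self_nonneg)

lemma l2_norm_eq_0_iff: "f \<in> L2 \<mu> \<Longrightarrow> l2_norm \<mu> f = 0 \<longleftrightarrow> (AE x in \<mu>. f x = 0)"
  by (simp add: l2_norm_def l2_inner_self_eq_0_iff)

lemma l2_norm_add:
  assumes "f \<in> L2 \<mu>" "g \<in> L2 \<mu>"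
  shows "l2_norm \<mu> (\<lambda>x. f x + g x) \<le> l2_norm \<mu> f + l2_norm \<mu> g"
proof (rule power2_le_imp_le)
  have "(l2_norm \<mu> (\<lambda>x. f x + g x))\<^sup>2 = (l2_norm \<mu> f)\<^sup>2 + 2 * l2_inner \<mu> f g + (l2_norm \<mu> g)\<^sup>2"
    using assms by (simp add: l2_norm_squared l2_inner_add_left l2_inner_add_right L2_add
        l2_inner_commute[of \<mu> g f])
  also have "\<dots> \<le> (l2_norm \<mu> f)\<^sup>2 + 2 * (l2_norm \<mu> f * l2_norm \<mu> g) + (l2_norm \<mu> g)\<^sup>2"
    using l2_Cauchy_Schwarz[OF assms] by (simp add: l2_norm_def)
  also have "\<dots> = (l2_norm \<mu> f + l2_norm \<mu> g)\<^sup>2"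
    by (simp add: power2_sum)
  finally show "(l2_norm \<mu> (\<lambda>x. f x + g x))\<^sup>2 \<le> (l2_norm \<mu> f + l2_norm \<mu> g)\<^sup>2" .
qed simp

lemma l2_norm_scaleR: "l2_norm \<mu> (\<lambda>x. c *\<^sub>R f x) = \<bar>c\<bar> * l2_norm \<mu> f"
proof -
  have "c * (c * r) = c\<^sup>2 * r" for r by (simp add: power2_eq_square)
  then show ?thesis by (simp add: l2_norm_def real_sqrt_mult)
qed

lemma l2_norm_minus_commute: "l2_norm \<mu> (\<lambda>x. f x - g x) = l2_norm \<mu> (\<lambda>x. g x - f x)"
  using l2_norm_scaleR[of \<mu> "-1" "\<lambda>x. f x - g x"] by simp

lemma l2_norm_cong_AE:
  assumes "f \<in> L2 \<mu>" "g \<in> L2 \<mu>" "AE x in \<mu>. f x = g x"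
  shows "l2_norm \<mu> f = l2_norm \<mu> g"
  unfolding l2_norm_def using l2_inner_cong_AE[OF assms(1,2,1,2,3,3)] by simp

lemma l2_norm_tendsto_unique:
  assumes "\<And>n. f n \<in> L2 \<mu>" "g \<in> L2 \<mu>" "h \<in> L2 \<mu>"
    and "(\<lambda>n. l2_norm \<mu> (\<lambda>x. f n x - g x)) \<longlonglongrightarrow> 0"
    and "(\<lambda>n. l2_norm \<mu> (\<lambda>x. f n x - h x)) \<longlonglongrightarrow> 0"
  shows "AE x in \<mu>. g x = h x"
proof -
  have "l2_norm \<mu> (\<lambda>x. g x - h x) \<le> l2_norm \<mu> (\<lambda>x. f n x - g x) + l2_norm \<mu> (\<lambda>x. f n x - h x)" for n
    using l2_norm_add[of "\<lambda>x. g x - f n x" \<mu> "\<lambda>x. f n x - h x"] assms(1-3)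
    by (auto simp: l2_norm_minus_commute[of \<mu> g])
  moreover have "(\<lambda>n. l2_norm \<mu> (\<lambda>x. f n x - g x) + l2_norm \<mu> (\<lambda>x. f n x - h x)) \<longlonglongrightarrow> 0 + 0"
    using assms(4,5) by (rule tendsto_add)
  ultimately have "l2_norm \<mu> (\<lambda>x. g x - h x) \<le> 0"
    using LIMSEQ_le_const by fastforce
  then have "l2_norm \<mu> (\<lambda>x. g x - h x) = 0"
    using l2_norm_nonneg[of \<mu> "\<lambda>x. g x - h x"] by linarith
  then show ?thesis
    using assms by (subst (asm) l2_norm_eq_0_iff) auto
qed

text \<open>With \<open>W = \<Sum>\<^sub>k 4\<^sup>k |f\<^sub>k\<^sub>+\<^sub>1 - f\<^sub>k|\<^sup>2\<close>, which is integrable, \<open>|f\<^sub>k\<^sub>+\<^sub>1 - f\<^sub>k| \<le> 2\<^sup>-\<^sup>k \<surd>W\<close> pointwise.\<close>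

lemma l2_complete:
  fixes f :: "nat \<Rightarrow> 'a \<Rightarrow> 'b::euclidean_space"
  assumes f: "\<And>n. f n \<in> L2 \<mu>"
    and fast: "\<And>n. l2_norm \<mu> (\<lambda>x. f (Suc n) x - f n x) \<le> c * (1/4) ^ n"
  obtains g where "g \<in> L2 \<mu>" "(\<lambda>n. l2_norm \<mu> (\<lambda>x. f n x - g x)) \<longlonglongrightarrow> 0"
proof -
  note [measurable] = f[THEN L2D(1)]
  define a where "a k x = (norm (f (Suc k) x - f k x))\<^sup>2" for k x
  have [measurable]: "a k \<in> borel_measurable \<mu>" for k
    unfolding a_def by measurable
  have a_nonneg: "0 \<le> a k x" for k x by (simp add: a_def)
  have a_int: "integrable \<mu> (a k)" for k
    unfolding a_def using f by (intro L2D(2)) auto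
  have a_le: "(\<integral>x. a k x \<partial>\<mu>) \<le> c\<^sup>2 * (1/16) ^ k" for k
  proof -
    have "(\<integral>x. a k x \<partial>\<mu>) = (l2_norm \<mu> (\<lambda>x. f (Suc k) x - f k x))\<^sup>2"
      by (simp add: l2_norm_squared l2_inner_def a_def power2_norm_eq_inner)
    also have "\<dots> \<le> (c * (1/4) ^ k)\<^sup>2"
      using fast by (rule power_mono) simp
    also have "\<dots> = c\<^sup>2 * (1/16) ^ k"
      by (simp add: power_mult_distrib power2_eq_square flip: power_mult_distrib)
    finally show ?thesis .
  qed
  have W_int: "integrable \<mu> (\<lambda>x. \<Sum>k. 4 ^ k * a k x)" and W_sum: "AE x in \<mu>. summable (\<lambda>k. 4 ^ k * a k x)"
  proof -
    have I: "integrable \<mu> (\<lambda>x. 4 ^ k * a k x)" for k using a_int by simp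
    have "(\<Sum>k. \<integral>\<^sup>+x. ennreal (4 ^ k * a k x) \<partial>\<mu>) \<le> (\<Sum>k. ennreal (c\<^sup>2 * (1/4) ^ k))"
    proof (intro suminf_le)
      fix k
      have "(\<integral>\<^sup>+x. ennreal (4 ^ k * a k x) \<partial>\<mu>) = ennreal (\<integral>x. 4 ^ k * a k x \<partial>\<mu>)"
        using I a_nonneg by (intro nn_integral_eq_integral) auto
      also have "\<dots> \<le> ennreal (c\<^sup>2 * (1/4) ^ k)"
      proof (rule ennreal_leI)
        have "(\<integral>x. 4 ^ k * a k x \<partial>\<mu>) \<le> 4 ^ k * (c\<^sup>2 * (1/16) ^ k)"
          using a_le[of k] by simp
        also have "\<dots> = c\<^sup>2 * (4 * (1/16)) ^ k"
          by (simp only: power_mult_distrib) simp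
        finally show "(\<integral>x. 4 ^ k * a k x \<partial>\<mu>) \<le> c\<^sup>2 * (1/4) ^ k" by simp
      qed
      finally show "(\<integral>\<^sup>+x. ennreal (4 ^ k * a k x) \<partial>\<mu>) \<le> ennreal (c\<^sup>2 * (1/4) ^ k)" .
    qed auto
    also have "\<dots> = ennreal (\<Sum>k. c\<^sup>2 * (1/4) ^ k)"
      by (intro suminf_ennreal2 summable_mult summable_geometric) auto
    finally have fin: "(\<integral>\<^sup>+x. (\<Sum>k. ennreal (4 ^ k * a k x)) \<partial>\<mu>) < \<infinity>"
      by (subst nn_integral_suminf) (auto simp: less_top le_less_trans)
    have "AE x in \<mu>. (\<Sum>k. ennreal (4 ^ k * a k x)) \<noteq> \<infinity>"
      using fin by (intro nn_integral_noteq_infinite) auto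
    then show W_sum: "AE x in \<mu>. summable (\<lambda>k. 4 ^ k * a k x)"
      by eventually_elim (use a_nonneg in \<open>auto intro!: summable_suminf_not_top simp: top_ennreal_def\<close>)
    have "(\<integral>\<^sup>+x. ennreal (norm (\<Sum>k. 4 ^ k * a k x)) \<partial>\<mu>) = (\<integral>\<^sup>+x. (\<Sum>k. ennreal (4 ^ k * a k x)) \<partial>\<mu>)"
      using W_sum by (intro nn_integral_cong_AE) (auto elim!: eventually_mono
          simp: suminf_nonneg a_nonneg suminf_ennreal2)
    with fin show "integrable \<mu> (\<lambda>x. \<Sum>k. 4 ^ k * a k x)"
      by (intro integrableI_bounded) auto
  qed
  define W where "W x = (\<Sum>k. 4 ^ k * a k x)" for x
  define g where "g x = lim (\<lambda>n. f n x)" for x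
  have [measurable]: "g \<in> borel_measurable \<mu>"
    unfolding g_def[abs_def] by measurable
  have pt: "(norm (f n x - g x))\<^sup>2 \<le> 4 * (1/4) ^ n * W x" if sm: "summable (\<lambda>k. 4 ^ k * a k x)" for x n
  proof -
    have W0: "0 \<le> W x" unfolding W_def using sm a_nonneg by (intro suminf_nonneg) auto
    have half2: "((1/2) ^ k)\<^sup>2 = (1/4 :: real) ^ k" for k :: nat
      by (simp add: power2_eq_square flip: power_mult_distrib)
    have inc: "norm (f (Suc k) x - f k x) \<le> sqrt (W x) * (1/2) ^ k" for k
    proof (rule power2_le_imp_le)
      have "4 ^ k * a k x \<le> W x"
        unfolding W_def using sum_le_suminf[OF sm, of "{k}"] a_nonneg by simp
      then have "a k x \<le> W x * (1/4) ^ k"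
        by (simp add: field_simps power_one_over)
      also have "\<dots> = (sqrt (W x) * (1/2) ^ k)\<^sup>2"
        using W0 half2[of k] by (simp add: power_mult_distrib)
      finally show "(norm (f (Suc k) x - f k x))\<^sup>2 \<le> (sqrt (W x) * (1/2) ^ k)\<^sup>2"
        by (simp add: a_def)
    qed (use W0 in simp)
    have tele: "norm (f (n + m) x - f n x) \<le> 2 * sqrt (W x) * ((1/2) ^ n - (1/2) ^ (n + m))" for n m
    proof (induction m)
      case (Suc m)
      have "norm (f (n + Suc m) x - f n x) \<le> norm (f (Suc (n + m)) x - f (n + m) x) + norm (f (n + m) x - f n x)"
        using norm_triangle_ineq[of "f (Suc (n + m)) x - f (n + m) x" "f (n + m) x - f n x"] by simp
      also have "\<dots> \<le> sqrt (W x) * (1/2) ^ (n + m) + 2 * sqrt (W x) * ((1/2) ^ n - (1/2) ^ (n + m))"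
        using inc[of "n + m"] Suc by linarith
      also have "\<dots> = 2 * sqrt (W x) * ((1/2) ^ n - (1/2) ^ (n + Suc m))"
        by (simp add: algebra_simps)
      finally show ?case .
    qed simp
    have tele': "norm (f (n + m) x - f n x) \<le> 2 * sqrt (W x) * (1/2) ^ n" for n m
      using W0 by (intro order_trans[OF tele] mult_left_mono) auto
    have "Cauchy (\<lambda>n. f n x)"
    proof (rule CauchyI')
      fix e :: real assume "0 < e"
      have "(\<lambda>n. 2 * sqrt (W x) * (1/2) ^ n) \<longlonglongrightarrow> 2 * sqrt (W x) * 0"
        by (intro tendsto_mult_left LIMSEQ_power_zero) simp
      then have "\<forall>\<^sub>F n in sequentially. 2 * sqrt (W x) * (1/2) ^ n < e"
        using \<open>0 < e\<close> order_tendstoD(2)[of _ 0 _ e] by simp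
      then obtain N where N: "\<And>n. n \<ge> N \<Longrightarrow> 2 * sqrt (W x) * (1/2) ^ n < e"
        by (auto simp: eventually_sequentially)
      have "norm (f m x - f n x) < e" if "n \<ge> N" "n < m" for m n
        using tele'[of n "m - n"] N[of n] that by simp
      then show "\<exists>M. \<forall>m\<ge>M. \<forall>n>m. dist (f m x) (f n x) < e"
        by (metis dist_norm norm_minus_commute)
    qed
    then have lim: "(\<lambda>n. f n x) \<longlonglongrightarrow> g x"
      unfolding g_def using Cauchy_convergent_iff convergent_LIMSEQ_iff by blast
    have "(\<lambda>m. norm (f (n + m) x - f n x)) \<longlonglongrightarrow> norm (g x - f n x)"
      using LIMSEQ_ignore_initial_segment[OF lim, of n]
      by (intro tendsto_norm tendsto_diff) (auto simp: add.commute)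
    then have "norm (g x - f n x) \<le> 2 * sqrt (W x) * (1/2) ^ n"
      using tele' by (intro LIMSEQ_le_const2) auto
    then have "(norm (f n x - g x))\<^sup>2 \<le> (2 * sqrt (W x) * (1/2) ^ n)\<^sup>2"
      by (intro power_mono) (auto simp: norm_minus_commute)
    also have "\<dots> = 4 * (1/4) ^ n * W x"
      using W0 half2[of n] by (simp add: power_mult_distrib)
    finally show ?thesis .
  qed
  have pt_AE: "AE x in \<mu>. (norm (f n x - g x))\<^sup>2 \<le> 4 * (1/4) ^ n * W x" for n
    using W_sum by eventually_elim (rule pt)
  have WI: "integrable \<mu> (\<lambda>x. 4 * (1/4) ^ n * W x)" for n :: nat
    using W_int unfolding W_def by (intro integrable_mult_right) simp
  have di: "(\<lambda>x. f n x - g x) \<in> L2 \<mu>" for n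
    unfolding L2_def
  proof (safe, measurable)
    show "integrable \<mu> (\<lambda>x. (norm (f n x - g x))\<^sup>2)"
    proof (rule Bochner_Integration.integrable_bound[OF WI])
      show "AE x in \<mu>. norm ((norm (f n x - g x))\<^sup>2) \<le> norm (4 * (1/4) ^ n * W x)"
        using pt_AE[of n] by eventually_elim (metis abs_ge_self norm_power order_trans real_norm_def abs_norm_cancel)
    qed measurable
  qed
  have g: "g \<in> L2 \<mu>"
    using L2_diff[OF f di, of 0 0] by simp
  have "(\<lambda>n. (l2_norm \<mu> (\<lambda>x. f n x - g x))\<^sup>2) \<longlonglongrightarrow> 0"
  proof (rule tendsto_sandwich[of "\<lambda>_. 0" _ _ "\<lambda>n. 4 * (1/4) ^ n * (\<integral>x. W x \<partial>\<mu>)"])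
    show "\<forall>\<^sub>F n in sequentially. (l2_norm \<mu> (\<lambda>x. f n x - g x))\<^sup>2 \<le> 4 * (1/4) ^ n * (\<integral>x. W x \<partial>\<mu>)"
    proof (rule always_eventually, rule allI)
      fix n
      have "(l2_norm \<mu> (\<lambda>x. f n x - g x))\<^sup>2 = (\<integral>x. (norm (f n x - g x))\<^sup>2 \<partial>\<mu>)"
        by (simp add: l2_norm_squared l2_inner_def power2_norm_eq_inner)
      also have "\<dots> \<le> (\<integral>x. 4 * (1/4) ^ n * W x \<partial>\<mu>)"
        using L2D(2)[OF di] WI pt_AE by (rule integral_mono_AE)
      finally show "(l2_norm \<mu> (\<lambda>x. f n x - g x))\<^sup>2 \<le> 4 * (1/4) ^ n * (\<integral>x. W x \<partial>\<mu>)"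
        by simp
    qed
    have "(\<lambda>n. 4 * (1/4) ^ n * (\<integral>x. W x \<partial>\<mu>)) \<longlonglongrightarrow> 4 * 0 * (\<integral>x. W x \<partial>\<mu>)"
      by (intro tendsto_mult tendsto_const LIMSEQ_power_zero) simp
    then show "(\<lambda>n. 4 * (1/4) ^ n * (\<integral>x. W x \<partial>\<mu>)) \<longlonglongrightarrow> 0" by simp
  qed auto
  then have "(\<lambda>n. sqrt ((l2_norm \<mu> (\<lambda>x. f n x - g x))\<^sup>2)) \<longlonglongrightarrow> sqrt 0"
    by (rule tendsto_real_sqrt)
  with g that show ?thesis by simp
qed


section \<open>Orthonormal bases and dimension\<close>

definition l2_orthonormal :: "'a measure \<Rightarrow> ('a \<Rightarrow> 'b::euclidean_space) set \<Rightarrow> bool" where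
  "l2_orthonormal \<mu> Q \<longleftrightarrow> finite Q \<and> Q \<subseteq> L2 \<mu> \<and>
     (\<forall>f\<in>Q. \<forall>g\<in>Q. l2_inner \<mu> f g = (if f = g then 1 else 0))"

definition l2_residual ::
    "'a measure \<Rightarrow> ('a \<Rightarrow> 'b::euclidean_space) set \<Rightarrow> ('a \<Rightarrow> 'b) \<Rightarrow> 'a \<Rightarrow> 'b" where
  "l2_residual \<mu> Q f = (\<lambda>x. f x - (\<Sum>q\<in>Q. l2_inner \<mu> f q *\<^sub>R q x))"

definition l2_basis :: "'a measure \<Rightarrow> ('a \<Rightarrow> 'b::euclidean_space) set \<Rightarrow> ('a \<Rightarrow> 'b) set \<Rightarrow> bool" where
  "l2_basis \<mu> Q S \<longleftrightarrow> l2_orthonormal \<mu> Q \<and> Q \<subseteq> S \<and> (\<forall>f\<in>S. AE x in \<mu>. l2_residual \<mu> Q f x = 0)"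

lemma l2_subspaceD:
  assumes "l2_subspace \<mu> S"
  shows "S \<subseteq> L2 \<mu>" "(\<lambda>x. 0) \<in> S" "\<And>f g. f \<in> S \<Longrightarrow> g \<in> S \<Longrightarrow> (\<lambda>x. f x + g x) \<in> S"
    "\<And>f c. f \<in> S \<Longrightarrow> (\<lambda>x. c *\<^sub>R f x) \<in> S"
    "\<And>f g. f \<in> S \<Longrightarrow> g \<in> L2 \<mu> \<Longrightarrow> AE x in \<mu>. g x = f x \<Longrightarrow> g \<in> S"
  using assms unfolding l2_subspace_def by blast+

lemma l2_subspace_L2: "l2_subspace \<mu> S \<Longrightarrow> f \<in> S \<Longrightarrow> f \<in> L2 \<mu>"
  using l2_subspaceD(1) by blast

lemma l2_subspace_diff:
  assumes "l2_subspace \<mu> S" "f \<in> S" "g \<in> S"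
  shows "(\<lambda>x. f x - g x) \<in> S"
  using l2_subspaceD(3)[OF assms(1,2) l2_subspaceD(4)[OF assms(1,3), of "-1"]] by simp

lemma l2_subspace_sum:
  assumes "l2_subspace \<mu> S" "\<And>i. i \<in> I \<Longrightarrow> f i \<in> S"
  shows "(\<lambda>x. \<Sum>i\<in>I. f i x) \<in> S"
  using assms(2) by (induction I rule: infinite_finite_induct)
    (auto intro: l2_subspaceD(2,3)[OF assms(1)])

lemma l2_orthonormal_proj_L2:
  assumes "l2_orthonormal \<mu> Q"
  shows "(\<lambda>x. \<Sum>q\<in>Q. c q *\<^sub>R q x) \<in> L2 \<mu>"
  using assms by (intro L2_sum L2_scaleR) (auto simp: l2_orthonormal_def)

lemma l2_residual_L2:
  assumes "l2_orthonormal \<mu> Q" "f \<in> L2 \<mu>"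
  shows "l2_residual \<mu> Q f \<in> L2 \<mu>"
  unfolding l2_residual_def using assms by (intro L2_diff l2_orthonormal_proj_L2)

lemma l2_inner_proj:
  assumes "l2_orthonormal \<mu> Q" "h \<in> L2 \<mu>"
  shows "l2_inner \<mu> (\<lambda>x. \<Sum>q\<in>Q. c q *\<^sub>R q x) h = (\<Sum>q\<in>Q. c q * l2_inner \<mu> q h)"
  using assms by (subst l2_inner_sum_left) (auto simp: l2_orthonormal_def)

lemma l2_inner_proj_basis:
  assumes "l2_orthonormal \<mu> Q" "r \<in> Q"
  shows "l2_inner \<mu> (\<lambda>x. \<Sum>q\<in>Q. c q *\<^sub>R q x) r = c r"
proof -
  have "l2_inner \<mu> (\<lambda>x. \<Sum>q\<in>Q. c q *\<^sub>R q x) r = (\<Sum>q\<in>Q. c q * l2_inner \<mu> q r)"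
    using assms by (intro l2_inner_proj) (auto simp: l2_orthonormal_def)
  also have "\<dots> = (\<Sum>q\<in>Q. if q = r then c q else 0)"
    using assms by (intro sum.cong) (auto simp: l2_orthonormal_def)
  also have "\<dots> = c r"
    using assms by (simp add: l2_orthonormal_def)
  finally show ?thesis .
qed

lemma l2_residual_orth:
  assumes "l2_orthonormal \<mu> Q" "f \<in> L2 \<mu>" "r \<in> Q"
  shows "l2_inner \<mu> (l2_residual \<mu> Q f) r = 0" "l2_inner \<mu> r (l2_residual \<mu> Q f) = 0"
proof -
  have "r \<in> L2 \<mu>" using assms by (auto simp: l2_orthonormal_def)
  then show "l2_inner \<mu> (l2_residual \<mu> Q f) r = 0"
    unfolding l2_residual_def
    using assms l2_orthonormal_proj_L2[OF assms(1)]
    by (simp add: l2_inner_diff_left l2_inner_proj_basis)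
  then show "l2_inner \<mu> r (l2_residual \<mu> Q f) = 0" by (simp add: l2_inner_commute)
qed

lemma l2_inner_residual_self:
  assumes "l2_orthonormal \<mu> Q" "f \<in> L2 \<mu>"
  shows "l2_inner \<mu> (l2_residual \<mu> Q f) (l2_residual \<mu> Q f) = l2_inner \<mu> (l2_residual \<mu> Q f) f"
    and "l2_inner \<mu> (l2_residual \<mu> Q f) f = l2_inner \<mu> f f - (\<Sum>q\<in>Q. (l2_inner \<mu> f q)\<^sup>2)"
proof -
  let ?r = "l2_residual \<mu> Q f" and ?p = "\<lambda>x. \<Sum>q\<in>Q. l2_inner \<mu> f q *\<^sub>R q x"
  note L = l2_residual_L2[OF assms] l2_orthonormal_proj_L2[OF assms(1)] assms(2)
  have "l2_inner \<mu> ?r (\<lambda>x. f x - ?p x) = l2_inner \<mu> ?r f - l2_inner \<mu> ?p ?r"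
    using L by (simp add: l2_inner_diff_right l2_inner_commute[of \<mu> ?p ?r])
  also have "l2_inner \<mu> ?p ?r = 0"
    using assms L l2_residual_orth[OF assms] by (simp add: l2_inner_proj)
  finally show "l2_inner \<mu> ?r ?r = l2_inner \<mu> ?r f" by (simp add: l2_residual_def)
  have "(\<Sum>q\<in>Q. l2_inner \<mu> f q * l2_inner \<mu> q f) = (\<Sum>q\<in>Q. (l2_inner \<mu> f q)\<^sup>2)"
    by (simp add: power2_eq_square l2_inner_commute)
  then show "l2_inner \<mu> ?r f = l2_inner \<mu> f f - (\<Sum>q\<in>Q. (l2_inner \<mu> f q)\<^sup>2)"
    unfolding l2_residual_def using assms L by (simp add: l2_inner_diff_left l2_inner_proj)
qed

lemma l2_Bessel:
  assumes "l2_orthonormal \<mu> Q" "f \<in> L2 \<mu>"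
  shows "(\<Sum>q\<in>Q. (l2_inner \<mu> f q)\<^sup>2) \<le> l2_inner \<mu> f f"
  using l2_inner_residual_self[OF assms] l2_inner_self_nonneg[of \<mu> "l2_residual \<mu> Q f"] by simp

lemma l2_basis_Parseval:
  assumes "l2_basis \<mu> Q S" "f \<in> S" "f \<in> L2 \<mu>"
  shows "(\<Sum>q\<in>Q. (l2_inner \<mu> f q)\<^sup>2) = l2_inner \<mu> f f"
  using assms l2_inner_residual_self[of \<mu> Q f] l2_residual_L2[of \<mu> Q f]
  by (auto simp: l2_basis_def l2_inner_AE_zero)

lemma l2_orthonormal_insert:
  assumes "l2_orthonormal \<mu> Q" "f \<in> L2 \<mu>" "\<And>q. q \<in> Q \<Longrightarrow> l2_inner \<mu> f q = 0"
    and "\<not> (AE x in \<mu>. f x = 0)"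
  defines "e \<equiv> \<lambda>x. (1 / l2_norm \<mu> f) *\<^sub>R f x"
  shows "l2_orthonormal \<mu> (insert e Q)" "e \<notin> Q"
proof -
  have n: "l2_norm \<mu> f \<noteq> 0" using assms(2,4) by (simp add: l2_norm_eq_0_iff)
  have 1: "l2_inner \<mu> e e = 1"
    using n by (simp add: e_def flip: l2_norm_squared) (simp add: power2_eq_square)
  have 0: "l2_inner \<mu> e q = 0" "l2_inner \<mu> q e = 0" if "q \<in> Q" for q
    using assms(3)[OF that] by (simp_all add: e_def l2_inner_commute[of \<mu> q f])
  show e: "e \<notin> Q" using 0 1 by fastforce
  have "e \<in> L2 \<mu>" using assms(2) by (auto simp: e_def)
  then show "l2_orthonormal \<mu> (insert e Q)"
    using assms(1) 0 1 e unfolding l2_orthonormal_def by auto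
qed

text \<open>Gram--Schmidt; that \<open>B\<close> lies in the span of \<open>Q\<close> is expressed by annihilators.\<close>

lemma l2_Gram_Schmidt:
  assumes "l2_subspace \<mu> S" "finite B" "B \<subseteq> S"
  shows "\<exists>Q. l2_orthonormal \<mu> Q \<and> Q \<subseteq> S \<and> card Q \<le> card B \<and>
    (\<forall>h\<in>L2 \<mu>. (\<forall>q\<in>Q. l2_inner \<mu> h q = 0) \<longrightarrow> (\<forall>b\<in>B. l2_inner \<mu> h b = 0))"
  using assms(2,3)
proof induction
  case empty
  show ?case by (rule exI[of _ "{}"]) (auto simp: l2_orthonormal_def)
next
  case (insert b B)
  then obtain Q where Q: "l2_orthonormal \<mu> Q" "Q \<subseteq> S" "card Q \<le> card B"
    and ann: "\<And>h c. \<lbrakk>h \<in> L2 \<mu>; \<forall>q\<in>Q. l2_inner \<mu> h q = 0; c \<in> B\<rbrakk> \<Longrightarrow> l2_inner \<mu> h c = 0"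
    by blast
  define r where "r = l2_residual \<mu> Q b"
  have bS: "b \<in> S" and b: "b \<in> L2 \<mu>"
    using insert.prems l2_subspace_L2[OF assms(1)] by auto
  have r: "r \<in> L2 \<mu>" unfolding r_def using Q(1) b by (rule l2_residual_L2)
  have rS: "r \<in> S"
    unfolding r_def l2_residual_def using bS Q(2)
    by (intro l2_subspace_diff[OF assms(1)] l2_subspace_sum[OF assms(1)] l2_subspaceD(4)[OF assms(1)]) auto
  have inner_b: "l2_inner \<mu> h b = l2_inner \<mu> h r" if "h \<in> L2 \<mu>" "\<forall>q\<in>Q. l2_inner \<mu> h q = 0" for h
  proof -
    have "l2_inner \<mu> r h = l2_inner \<mu> b h - (\<Sum>q\<in>Q. l2_inner \<mu> b q * l2_inner \<mu> q h)"
      unfolding r_def l2_residual_def using that b Q(1) l2_orthonormal_proj_L2[OF Q(1)]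
      by (simp add: l2_inner_diff_left l2_inner_proj)
    then show ?thesis using that by (simp add: l2_inner_commute)
  qed
  show ?case
  proof (cases "AE x in \<mu>. r x = 0")
    case True
    have "l2_inner \<mu> h c = 0"
      if "h \<in> L2 \<mu>" "\<forall>q\<in>Q. l2_inner \<mu> h q = 0" "c \<in> insert b B" for h c
    proof (cases "c = b")
      case True
      then show ?thesis
        using inner_b[OF that(1,2)] l2_inner_AE_zero(2)[OF r that(1) \<open>AE x in \<mu>. r x = 0\<close>] by simp
    next
      case False
      then show ?thesis using ann[OF that(1,2)] that(3) by simp
    qed
    moreover have "card Q \<le> card (insert b B)" using Q(3) insert.hyps by simp
    ultimately show ?thesis using Q(1,2) by blast
  next
    case False
    define e where "e = (\<lambda>x. (1 / l2_norm \<mu> r) *\<^sub>R r x)"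
    have e: "l2_orthonormal \<mu> (insert e Q)" "e \<notin> Q"
      using l2_orthonormal_insert[OF Q(1) r _ False] l2_residual_orth[OF Q(1) b]
      unfolding e_def r_def by auto
    have eS: "e \<in> S" unfolding e_def using l2_subspaceD(4)[OF assms(1) rS] .
    have "l2_inner \<mu> h c = 0"
      if "h \<in> L2 \<mu>" "\<forall>q\<in>insert e Q. l2_inner \<mu> h q = 0" "c \<in> insert b B" for h c
    proof -
      have "l2_norm \<mu> r \<noteq> 0" using False r by (simp add: l2_norm_eq_0_iff)
      then have "l2_inner \<mu> h r = 0" using that(2) by (simp add: e_def)
      then show ?thesis
        using that(2,3) ann[OF that(1)] inner_b[OF that(1)] by (cases "c = b") simp_all
    qed
    moreover have "card (insert e Q) \<le> card (insert b B)"
      using Q(1,3) e(2) insert.hyps by (simp add: l2_orthonormal_def)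
    moreover have "insert e Q \<subseteq> S" using eS Q(2) by simp
    ultimately show ?thesis using e(1) by blast
  qed
qed

lemma l2_basis_exists_le:
  assumes "l2_subspace \<mu> S" "l2_generates \<mu> B S"
  obtains Q where "l2_basis \<mu> Q S" "card Q \<le> card B"
proof -
  have B: "finite B" "B \<subseteq> S" using assms(2) by (auto simp: l2_generates_def)
  obtain Q where Q: "l2_orthonormal \<mu> Q" "Q \<subseteq> S" "card Q \<le> card B"
    and ann: "\<And>h c. \<lbrakk>h \<in> L2 \<mu>; \<forall>q\<in>Q. l2_inner \<mu> h q = 0; c \<in> B\<rbrakk> \<Longrightarrow> l2_inner \<mu> h c = 0"
    using l2_Gram_Schmidt[OF assms(1) B] by blast
  have "AE x in \<mu>. l2_residual \<mu> Q f x = 0" if fS: "f \<in> S" for f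
  proof -
    let ?r = "l2_residual \<mu> Q f"
    have f: "f \<in> L2 \<mu>" using l2_subspace_L2[OF assms(1) fS] .
    have r: "?r \<in> L2 \<mu>" using Q(1) f by (rule l2_residual_L2)
    obtain c where c: "AE x in \<mu>. f x = (\<Sum>b\<in>B. c b *\<^sub>R b x)"
      using assms(2) fS unfolding l2_generates_def by blast
    have BL: "b \<in> L2 \<mu>" if "b \<in> B" for b using that B l2_subspace_L2[OF assms(1)] by auto
    have "l2_inner \<mu> ?r f = l2_inner \<mu> ?r (\<lambda>x. \<Sum>b\<in>B. c b *\<^sub>R b x)"
      using c by (intro l2_inner_cong_AE r f L2_sum L2_scaleR BL) auto
    also have "\<dots> = (\<Sum>b\<in>B. l2_inner \<mu> ?r (\<lambda>x. c b *\<^sub>R b x))"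
      using BL r by (intro l2_inner_sum_right) auto
    also have "\<dots> = 0"
      using ann[OF r] l2_residual_orth[OF Q(1) f] by simp
    finally show ?thesis
      using l2_inner_residual_self(1)[OF Q(1) f] l2_inner_self_eq_0_iff[OF r] by simp
  qed
  then have "l2_basis \<mu> Q S" using Q(1,2) by (simp add: l2_basis_def)
  then show ?thesis using Q(3) by (rule that)
qed

lemma l2_basis_generates:
  assumes "l2_basis \<mu> Q S"
  shows "l2_generates \<mu> Q S"
  unfolding l2_generates_def
proof (intro conjI ballI)
  fix f assume "f \<in> S"
  then have "AE x in \<mu>. f x = (\<Sum>q\<in>Q. l2_inner \<mu> f q *\<^sub>R q x)"
    using assms by (auto simp: l2_basis_def l2_residual_def)
  then show "\<exists>c. AE x in \<mu>. f x = (\<Sum>q\<in>Q. c q *\<^sub>R q x)" by (rule exI[of _ "l2_inner \<mu> f"])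
next
  have "l2_orthonormal \<mu> Q" and QS: "Q \<subseteq> S" using assms by (simp_all add: l2_basis_def)
  then show "finite Q" by (simp add: l2_orthonormal_def)
  show "Q \<subseteq> S" by (rule QS)
qed

text \<open>Both cardinalities are traces of the identity: sum \<open>\<langle>q, r\<rangle>\<^sup>2\<close> over both families.\<close>

lemma l2_orthonormal_card_le:
  assumes Q: "l2_basis \<mu> Q S" and R: "l2_orthonormal \<mu> R" "R \<subseteq> S"
  shows "card R \<le> card Q"
proof -
  have Q': "l2_orthonormal \<mu> Q" using Q by (simp add: l2_basis_def)
  have "real (card R) = (\<Sum>r\<in>R. l2_inner \<mu> r r)"
    using R by (simp add: l2_orthonormal_def)
  also have "\<dots> = (\<Sum>r\<in>R. \<Sum>q\<in>Q. (l2_inner \<mu> r q)\<^sup>2)"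
    using R by (intro sum.cong l2_basis_Parseval[OF Q, symmetric]) (auto simp: l2_orthonormal_def)
  also have "\<dots> = (\<Sum>q\<in>Q. \<Sum>r\<in>R. (l2_inner \<mu> q r)\<^sup>2)"
    by (subst sum.swap) (simp add: l2_inner_commute)
  also have "\<dots> \<le> (\<Sum>q\<in>Q. l2_inner \<mu> q q)"
    using Q' by (intro sum_mono l2_Bessel[OF R(1)]) (auto simp: l2_orthonormal_def)
  also have "\<dots> = real (card Q)"
    using Q' by (simp add: l2_orthonormal_def)
  finally show ?thesis by simp
qed

lemma l2_dim_eq_card:
  assumes "l2_subspace \<mu> S" "l2_basis \<mu> Q S"
  shows "l2_dim \<mu> S = card Q"
  unfolding l2_dim_def
proof (rule Least_equality)
  show "\<exists>B. l2_generates \<mu> B S \<and> card B = card Q"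
    using l2_basis_generates[OF assms(2)] by blast
next
  fix k assume "\<exists>B. l2_generates \<mu> B S \<and> card B = k"
  then obtain B where B: "l2_generates \<mu> B S" "card B = k" by blast
  obtain R where "l2_basis \<mu> R S" "card R \<le> card B"
    using l2_basis_exists_le[OF assms(1) B(1)] .
  then show "card Q \<le> k"
    using l2_orthonormal_card_le[of \<mu> R S Q] assms(2) B(2) unfolding l2_basis_def by linarith
qed

lemma l2_basis_exists:
  assumes "l2_findim_subspace \<mu> S" "l2_subspace \<mu> A" "A \<subseteq> S"
  obtains Q where "l2_basis \<mu> Q A"
proof -
  obtain R where R: "l2_basis \<mu> R S"
    using assms(1) l2_basis_exists_le[of \<mu> S] unfolding l2_findim_subspace_def by metis
  define P where "P k \<longleftrightarrow> (\<exists>Q. l2_orthonormal \<mu> Q \<and> Q \<subseteq> A \<and> card Q = k)" for k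
  have "P 0" unfolding P_def by (intro exI[of _ "{}"]) (auto simp: l2_orthonormal_def)
  moreover have bd: "\<And>k. P k \<Longrightarrow> k \<le> card R"
    unfolding P_def using l2_orthonormal_card_le[OF R] order_trans[OF _ assms(3)] by auto
  ultimately have "P (Greatest P)" by (intro GreatestI_nat[of P 0 "card R"]) auto
  then obtain k where k: "P k" "\<And>j. P j \<Longrightarrow> j \<le> k"
    using that Greatest_le_nat[of P _ "card R"] bd by auto
  then obtain Q where Q: "l2_orthonormal \<mu> Q" "Q \<subseteq> A" "card Q = k" unfolding P_def by blast
  have "AE x in \<mu>. l2_residual \<mu> Q f x = 0" if "f \<in> A" for f
  proof (rule ccontr)
    assume nz: "\<not> ?thesis"
    have f: "f \<in> L2 \<mu>" using that l2_subspace_L2[OF assms(2)] by simp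
    define r where "r = l2_residual \<mu> Q f"
    have r: "r \<in> L2 \<mu>" unfolding r_def using Q(1) f by (rule l2_residual_L2)
    have rA: "r \<in> A"
      unfolding r_def l2_residual_def using that Q(2)
      by (intro l2_subspace_diff[OF assms(2)] l2_subspace_sum[OF assms(2)] l2_subspaceD(4)[OF assms(2)]) auto
    define e where "e = (\<lambda>x. (1 / l2_norm \<mu> r) *\<^sub>R r x)"
    have e: "l2_orthonormal \<mu> (insert e Q)" "e \<notin> Q"
      using l2_orthonormal_insert[OF Q(1) r] l2_residual_orth[OF Q(1) f] nz
      unfolding e_def r_def by auto
    have "e \<in> A" unfolding e_def using l2_subspaceD(4)[OF assms(2) rA] .
    then have "P (Suc k)"
      unfolding P_def using e Q by (intro exI[of _ "insert e Q"]) (auto simp: l2_orthonormal_def)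
    then show False using k(2) by fastforce
  qed
  then have "l2_basis \<mu> Q A" using Q(1,2) by (simp add: l2_basis_def)
  then show ?thesis by (rule that)
qed

lemma l2_decompose:
  assumes "l2_findim_subspace \<mu> S" "l2_subspace \<mu> A" "A \<subseteq> S" "f \<in> L2 \<mu>"
  obtains p where "p \<in> A" "\<And>h. h \<in> A \<Longrightarrow> l2_inner \<mu> (\<lambda>x. f x - p x) h = 0"
proof -
  obtain Q where Q: "l2_basis \<mu> Q A" using l2_basis_exists[OF assms(1-3)] .
  then have Q': "l2_orthonormal \<mu> Q" "Q \<subseteq> A" by (auto simp: l2_basis_def)
  define p where "p = (\<lambda>x. \<Sum>q\<in>Q. l2_inner \<mu> f q *\<^sub>R q x)"
  have fp: "(\<lambda>x. f x - p x) = l2_residual \<mu> Q f" by (simp add: p_def l2_residual_def)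
  show ?thesis
  proof
    show "p \<in> A"
      unfolding p_def using Q'
      by (intro l2_subspace_sum[OF assms(2)] l2_subspaceD(4)[OF assms(2)]) auto
    fix h assume h: "h \<in> A"
    then have hL: "h \<in> L2 \<mu>" using l2_subspace_L2[OF assms(2)] by simp
    let ?c = "\<lambda>x. \<Sum>q\<in>Q. l2_inner \<mu> h q *\<^sub>R q x"
    have r: "l2_residual \<mu> Q f \<in> L2 \<mu>" using Q'(1) assms(4) by (rule l2_residual_L2)
    have "AE x in \<mu>. h x = ?c x"
      using Q h by (auto simp: l2_basis_def l2_residual_def)
    then have "l2_inner \<mu> h (l2_residual \<mu> Q f) = l2_inner \<mu> ?c (l2_residual \<mu> Q f)"
      using hL r l2_orthonormal_proj_L2[OF Q'(1)] by (intro l2_inner_cong_AE) auto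
    also have "\<dots> = 0"
      using l2_residual_orth[OF Q'(1) assms(4)] r Q'(1) by (simp add: l2_inner_proj)
    finally show "l2_inner \<mu> (\<lambda>x. f x - p x) h = 0"
      by (simp add: fp l2_inner_commute)
  qed
qed

lemma l2_subspace_eqI:
  assumes "l2_findim_subspace \<mu> S" "l2_subspace \<mu> A" "A \<subseteq> S"
    and "\<And>m. m \<in> S \<Longrightarrow> (\<And>h. h \<in> A \<Longrightarrow> l2_inner \<mu> m h = 0) \<Longrightarrow> AE x in \<mu>. m x = 0"
  shows "A = S"
proof
  have S: "l2_subspace \<mu> S" using assms(1) by (simp add: l2_findim_subspace_def)
  show "S \<subseteq> A"
  proof
    fix f assume f: "f \<in> S"
    then have fL: "f \<in> L2 \<mu>" using l2_subspace_L2[OF S] by simp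
    obtain p where p: "p \<in> A" "\<And>h. h \<in> A \<Longrightarrow> l2_inner \<mu> (\<lambda>x. f x - p x) h = 0"
      using l2_decompose[OF assms(1-3) fL] by blast
    have "(\<lambda>x. f x - p x) \<in> S" using f p(1) assms(3) by (intro l2_subspace_diff[OF S]) auto
    then have "AE x in \<mu>. f x - p x = 0" using assms(4) p(2) by blast
    then show "f \<in> A" using l2_subspaceD(5)[OF assms(2) p(1) fL] by simp
  qed
qed fact

lemma l2_sumI:
  assumes "h \<in> L2 \<mu>" "f \<in> A" "g \<in> B" "AE x in \<mu>. h x = f x + g x"
  shows "h \<in> l2_sum \<mu> A B"
  using assms unfolding l2_sum_def by blast

lemma l2_subspace_l2_sum:
  assumes A: "l2_subspace \<mu> A" and B: "l2_subspace \<mu> B"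
  shows "l2_subspace \<mu> (l2_sum \<mu> A B)"
  unfolding l2_subspace_def
proof (intro conjI ballI allI impI)
  show "l2_sum \<mu> A B \<subseteq> L2 \<mu>" by (auto simp: l2_sum_def)
  show "(\<lambda>x. 0) \<in> l2_sum \<mu> A B"
    by (rule l2_sumI[OF _ l2_subspaceD(2)[OF A] l2_subspaceD(2)[OF B]]) auto
next
  fix f g assume "f \<in> l2_sum \<mu> A B" "g \<in> l2_sum \<mu> A B"
  then obtain a b a' b' where f: "f \<in> L2 \<mu>" "a \<in> A" "b \<in> B" "AE x in \<mu>. f x = a x + b x"
    and g: "g \<in> L2 \<mu>" "a' \<in> A" "b' \<in> B" "AE x in \<mu>. g x = a' x + b' x"
    by (auto simp: l2_sum_def)
  have "AE x in \<mu>. f x + g x = (a x + a' x) + (b x + b' x)"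
    using f(4) g(4) by eventually_elim simp
  then show "(\<lambda>x. f x + g x) \<in> l2_sum \<mu> A B"
    by (rule l2_sumI[OF L2_add[OF f(1) g(1)] l2_subspaceD(3)[OF A f(2) g(2)] l2_subspaceD(3)[OF B f(3) g(3)]])
next
  fix c f assume "f \<in> l2_sum \<mu> A B"
  then obtain a b where f: "f \<in> L2 \<mu>" "a \<in> A" "b \<in> B" "AE x in \<mu>. f x = a x + b x"
    by (auto simp: l2_sum_def)
  have "AE x in \<mu>. c *\<^sub>R f x = c *\<^sub>R a x + c *\<^sub>R b x"
    using f(4) by eventually_elim (simp add: scaleR_add_right)
  then show "(\<lambda>x. c *\<^sub>R f x) \<in> l2_sum \<mu> A B"
    by (rule l2_sumI[OF L2_scaleR[OF f(1)] l2_subspaceD(4)[OF A f(2)] l2_subspaceD(4)[OF B f(3)]])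
next
  fix f g assume "f \<in> l2_sum \<mu> A B" and g: "g \<in> L2 \<mu>" "AE x in \<mu>. g x = f x"
  then obtain a b where f: "f \<in> L2 \<mu>" "a \<in> A" "b \<in> B" "AE x in \<mu>. f x = a x + b x"
    by (auto simp: l2_sum_def)
  have "AE x in \<mu>. g x = a x + b x"
    using f(4) g(2) by eventually_elim simp
  then show "g \<in> l2_sum \<mu> A B"
    by (rule l2_sumI[OF g(1) f(2,3)])
qed

lemma l2_sum_subset:
  assumes "l2_subspace \<mu> S" "A \<subseteq> S" "B \<subseteq> S"
  shows "l2_sum \<mu> A B \<subseteq> S"
proof
  fix h assume "h \<in> l2_sum \<mu> A B"
  then obtain f g where "h \<in> L2 \<mu>" "f \<in> A" "g \<in> B" "AE x in \<mu>. h x = f x + g x"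
    by (auto simp: l2_sum_def)
  with assms show "h \<in> S"
    using l2_subspaceD(5)[OF assms(1) l2_subspaceD(3)[OF assms(1), of f g]] by auto
qed

lemma l2_sum_left:
  assumes "l2_subspace \<mu> A" "l2_subspace \<mu> B"
  shows "A \<subseteq> l2_sum \<mu> A B"
proof
  fix f assume f: "f \<in> A"
  show "f \<in> l2_sum \<mu> A B"
    by (rule l2_sumI[OF l2_subspace_L2[OF assms(1) f] f l2_subspaceD(2)[OF assms(2)]]) simp
qed

lemma l2_sum_right:
  assumes "l2_subspace \<mu> A" "l2_subspace \<mu> B"
  shows "B \<subseteq> l2_sum \<mu> A B"
proof
  fix f assume f: "f \<in> B"
  show "f \<in> l2_sum \<mu> A B"
    by (rule l2_sumI[OF l2_subspace_L2[OF assms(2) f] l2_subspaceD(2)[OF assms(1)] f]) simp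
qed

lemma l2_orthogonal_dim_iff:
  assumes M: "l2_findim_subspace \<mu> M" and A: "l2_subspace \<mu> A" "A \<subseteq> M"
    and B: "l2_subspace \<mu> B" "B \<subseteq> M"
    and orth: "\<And>f g. f \<in> A \<Longrightarrow> g \<in> B \<Longrightarrow> l2_inner \<mu> f g = 0"
  shows "l2_dim \<mu> M = l2_dim \<mu> A + l2_dim \<mu> B \<longleftrightarrow> l2_sum \<mu> A B = M"
proof -
  have M': "l2_subspace \<mu> M" using M by (simp add: l2_findim_subspace_def)
  obtain P where P: "l2_basis \<mu> P A" using l2_basis_exists[OF M A] .
  obtain Q where Q: "l2_basis \<mu> Q B" using l2_basis_exists[OF M B] .
  have P': "l2_orthonormal \<mu> P" "P \<subseteq> A" and Q': "l2_orthonormal \<mu> Q" "Q \<subseteq> B"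
    using P Q by (auto simp: l2_basis_def)
  have disj: "P \<inter> Q = {}"
  proof -
    have False if "f \<in> P" "f \<in> Q" for f
      using orth[of f f] that P' Q' by (auto simp: l2_orthonormal_def)
    then show ?thesis by blast
  qed
  have fin: "finite P" "finite Q" using P' Q' by (auto simp: l2_orthonormal_def)
  have cross: "l2_inner \<mu> f g = 0" "l2_inner \<mu> g f = 0" "f \<noteq> g" if "f \<in> P" "g \<in> Q" for f g
    using orth[of f g] that P'(2) Q'(2) disj by (auto simp: l2_inner_commute[of \<mu> g f])
  have PQ: "l2_orthonormal \<mu> (P \<union> Q)"
    unfolding l2_orthonormal_def
  proof (intro conjI ballI)
    fix f g assume "f \<in> P \<union> Q" "g \<in> P \<union> Q"
    then show "l2_inner \<mu> f g = (if f = g then 1 else 0)"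
      using P'(1) Q'(1) cross(1)[of f g] cross(2)[of g f] cross(3)[of f g] cross(3)[of g f]
      unfolding l2_orthonormal_def by (elim UnE) simp_all
  qed (use P' Q' in \<open>auto simp: l2_orthonormal_def\<close>)
  have dims: "l2_dim \<mu> A + l2_dim \<mu> B = card (P \<union> Q)"
    using l2_dim_eq_card[OF A(1) P] l2_dim_eq_card[OF B(1) Q] disj fin by (simp add: card_Un_disjoint)
  have PQM: "P \<union> Q \<subseteq> M" using P' Q' A B by blast
  have sub: "l2_sum \<mu> A B \<subseteq> M" using l2_sum_subset[OF M' A(2) B(2)] .
  note S = l2_subspace_l2_sum[OF A(1) B(1)]
  have PQ_sum: "P \<union> Q \<subseteq> l2_sum \<mu> A B"
    using P' Q' l2_sum_left[OF A(1) B(1)] l2_sum_right[OF A(1) B(1)] by blast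
  have basis: "l2_basis \<mu> (P \<union> Q) (l2_sum \<mu> A B)"
  proof -
    have "AE x in \<mu>. l2_residual \<mu> (P \<union> Q) h x = 0" if h: "h \<in> l2_sum \<mu> A B" for h
    proof -
      let ?r = "l2_residual \<mu> (P \<union> Q) h"
      obtain f g where fg: "h \<in> L2 \<mu>" "f \<in> A" "g \<in> B" "AE x in \<mu>. h x = f x + g x"
        using h by (auto simp: l2_sum_def)
      have L: "f \<in> L2 \<mu>" "g \<in> L2 \<mu>"
        using fg l2_subspace_L2[OF A(1)] l2_subspace_L2[OF B(1)] by auto
      have r: "?r \<in> L2 \<mu>" using PQ fg(1) by (rule l2_residual_L2)
      have f: "AE x in \<mu>. f x = (\<Sum>q\<in>P. l2_inner \<mu> f q *\<^sub>R q x)"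
        using P fg(2) by (auto simp: l2_basis_def l2_residual_def)
      have g: "AE x in \<mu>. g x = (\<Sum>q\<in>Q. l2_inner \<mu> g q *\<^sub>R q x)"
        using Q fg(3) by (auto simp: l2_basis_def l2_residual_def)
      have "l2_inner \<mu> h ?r = l2_inner \<mu> f ?r + l2_inner \<mu> g ?r"
        using l2_inner_cong_AE[of h \<mu> "\<lambda>x. f x + g x" ?r ?r] fg L r
        by (simp add: l2_inner_add_left L2_add)
      also have "l2_inner \<mu> f ?r = l2_inner \<mu> (\<lambda>x. \<Sum>q\<in>P. l2_inner \<mu> f q *\<^sub>R q x) ?r"
        using L r f l2_orthonormal_proj_L2[OF P'(1)] by (intro l2_inner_cong_AE) auto
      also have "\<dots> = 0"
        using l2_residual_orth[OF PQ fg(1)] r P'(1) by (simp add: l2_inner_proj)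
      also have "l2_inner \<mu> g ?r = l2_inner \<mu> (\<lambda>x. \<Sum>q\<in>Q. l2_inner \<mu> g q *\<^sub>R q x) ?r"
        using L r g l2_orthonormal_proj_L2[OF Q'(1)] by (intro l2_inner_cong_AE) auto
      also have "\<dots> = 0"
        using l2_residual_orth[OF PQ fg(1)] r Q'(1) by (simp add: l2_inner_proj)
      finally show ?thesis
        using l2_inner_residual_self(1)[OF PQ fg(1)] l2_inner_self_eq_0_iff[OF r]
        by (simp add: l2_inner_commute)
    qed
    then show ?thesis using PQ PQ_sum by (simp add: l2_basis_def)
  qed
  obtain R where R: "l2_basis \<mu> R M" using l2_basis_exists[OF M M' order_refl] .
  show ?thesis
  proof
    assume "l2_sum \<mu> A B = M"
    then show "l2_dim \<mu> M = l2_dim \<mu> A + l2_dim \<mu> B"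
      using l2_dim_eq_card[OF S basis] dims by simp
  next
    assume eq: "l2_dim \<mu> M = l2_dim \<mu> A + l2_dim \<mu> B"
    show "l2_sum \<mu> A B = M"
    proof (rule l2_subspace_eqI[OF M S sub], rule ccontr)
      fix m assume m: "m \<in> M" and orth: "\<And>h. h \<in> l2_sum \<mu> A B \<Longrightarrow> l2_inner \<mu> m h = 0"
        and nz: "\<not> (AE x in \<mu>. m x = 0)"
      have mL: "m \<in> L2 \<mu>" using m l2_subspace_L2[OF M'] by simp
      define e where "e = (\<lambda>x. (1 / l2_norm \<mu> m) *\<^sub>R m x)"
      have e: "l2_orthonormal \<mu> (insert e (P \<union> Q))" "e \<notin> P \<union> Q"
        using l2_orthonormal_insert[OF PQ mL _ nz] orth PQ_sum unfolding e_def by blast+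
      have "e \<in> M" unfolding e_def using l2_subspaceD(4)[OF M' m] .
      then have "card (insert e (P \<union> Q)) \<le> card R"
        using l2_orthonormal_card_le[OF R e(1)] PQM by blast
      then show False
        using e(2) fin eq dims l2_dim_eq_card[OF M' R] by simp
    qed
  qed
qed

text \<open>\<open>R\<close> is the graph of a linear functional on \<open>T\<close>, possibly with redundant pairs over null functions.\<close>

lemma l2_representation:
  assumes S: "l2_findim_subspace \<mu> S" and T: "l2_subspace \<mu> T" "T \<subseteq> S"
    and tot: "\<And>d. d \<in> T \<Longrightarrow> \<exists>r. R d r"
    and add: "\<And>d r d' r'. R d r \<Longrightarrow> R d' r' \<Longrightarrow> R (\<lambda>x. d x + d' x) (r + r')"
    and scale: "\<And>c d r. R d r \<Longrightarrow> R (\<lambda>x. c *\<^sub>R d x) (c * r)"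
    and null: "\<And>d r. R d r \<Longrightarrow> AE x in \<mu>. d x = 0 \<Longrightarrow> r = (0::real)"
  obtains p where "p \<in> T" "\<And>d r. d \<in> T \<Longrightarrow> R d r \<Longrightarrow> r = l2_inner \<mu> d p"
proof -
  obtain Q where Q: "l2_basis \<mu> Q T" using l2_basis_exists[OF S T] .
  then have Q': "l2_orthonormal \<mu> Q" "Q \<subseteq> T" by (auto simp: l2_basis_def)
  have fin: "finite Q" using Q' by (simp add: l2_orthonormal_def)
  obtain \<rho> where \<rho>: "\<And>q. q \<in> Q \<Longrightarrow> R q (\<rho> q)"
    using tot Q'(2) by (metis subsetD)
  define p where "p = (\<lambda>x. \<Sum>q\<in>Q. \<rho> q *\<^sub>R q x)"
  have R0: "R (\<lambda>x. 0) 0"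
    using scale[of _ _ 0] tot[OF l2_subspaceD(2)[OF T(1)]] by fastforce
  have Rsum: "R (\<lambda>x. \<Sum>q\<in>I. c q *\<^sub>R q x) (\<Sum>q\<in>I. c q * \<rho> q)" if "I \<subseteq> Q" for I c
    using finite_subset[OF that fin] that
    by induction (auto intro!: R0 add scale \<rho>)
  show ?thesis
  proof
    show "p \<in> T"
      unfolding p_def using Q'
      by (intro l2_subspace_sum[OF T(1)] l2_subspaceD(4)[OF T(1)]) auto
    fix d r assume d: "d \<in> T" and R: "R d r"
    let ?c = "\<lambda>q. - l2_inner \<mu> d q"
    have "R (\<lambda>x. d x + (\<Sum>q\<in>Q. ?c q *\<^sub>R q x)) (r + (\<Sum>q\<in>Q. ?c q * \<rho> q))"
      by (intro add R Rsum order_refl)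
    moreover have "AE x in \<mu>. d x + (\<Sum>q\<in>Q. ?c q *\<^sub>R q x) = 0"
      using Q d by (auto simp: l2_basis_def l2_residual_def sum_negf)
    ultimately have "r + (\<Sum>q\<in>Q. ?c q * \<rho> q) = 0" by (rule null)
    moreover have "l2_inner \<mu> d p = (\<Sum>q\<in>Q. \<rho> q * l2_inner \<mu> q d)"
      unfolding p_def using l2_inner_proj[OF Q'(1) l2_subspace_L2[OF T(1) d], of \<rho>]
      by (simp add: l2_inner_commute)
    ultimately show "r = l2_inner \<mu> d p"
      by (simp add: sum_negf mult.commute l2_inner_commute)
  qed
qed


section \<open>Extension of bounded operators\<close>

text \<open>A sequence in \<open>X\<close> approaching the orthogonal projection of \<open>u\<close> onto the closure of \<open>X\<close>.\<close>

definition l2_approx_proj ::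
    "'a measure \<Rightarrow> ('a \<Rightarrow> 'b::euclidean_space) set \<Rightarrow> ('a \<Rightarrow> 'b) \<Rightarrow> (nat \<Rightarrow> 'a \<Rightarrow> 'b) \<Rightarrow> bool" where
  "l2_approx_proj \<mu> X u s \<longleftrightarrow> (\<forall>n. s n \<in> X) \<and>
     (\<exists>c. \<forall>n. \<forall>y\<in>X. \<bar>l2_inner \<mu> (\<lambda>x. u x - s n x) y\<bar> \<le> c * (1/4) ^ n * l2_norm \<mu> y)"

lemma l2_approx_proj_exists:
  assumes X: "X \<subseteq> L2 \<mu>" "(\<lambda>x. 0) \<in> X"
    and X_add: "\<And>f g. f \<in> X \<Longrightarrow> g \<in> X \<Longrightarrow> (\<lambda>x. f x + g x) \<in> X"
    and X_scale: "\<And>f c. f \<in> X \<Longrightarrow> (\<lambda>x. c *\<^sub>R f x) \<in> X"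
    and u: "u \<in> L2 \<mu>"
  obtains s where "l2_approx_proj \<mu> X u s"
proof -
  define D where "D y = l2_inner \<mu> (\<lambda>x. u x - y x) (\<lambda>x. u x - y x)" for y
  have D0: "0 \<le> D y" for y unfolding D_def by (rule l2_inner_self_nonneg)
  define \<delta> where "\<delta> = (INF y\<in>X. D y)"
  have bdd: "bdd_below (D ` X)" using D0 by (intro bdd_belowI[of _ 0]) auto
  have "\<exists>y\<in>X. D y < \<delta> + (1/16) ^ n" for n :: nat
    using cINF_less_iff[of X D "\<delta> + (1/16) ^ n"] bdd X(2) unfolding \<delta>_def by auto
  then obtain s where s: "\<And>n. s n \<in> X" "\<And>n. D (s n) < \<delta> + (1/16) ^ n" by metis
  have "\<bar>l2_inner \<mu> (\<lambda>x. u x - s n x) y\<bar> \<le> 1 * (1/4) ^ n * l2_norm \<mu> y" if y: "y \<in> X" for n y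
  proof -
    let ?v = "\<lambda>x. u x - s n x"
    let ?b = "l2_inner \<mu> ?v y" and ?c = "l2_inner \<mu> y y"
    have L: "?v \<in> L2 \<mu>" "y \<in> L2 \<mu>" using s(1) X(1) u y by auto
    have q: "0 \<le> (1/16) ^ n - 2 * t * ?b + t\<^sup>2 * ?c" for t
    proof -
      have "(\<lambda>x. s n x + t *\<^sub>R y x) \<in> X" using X_add[OF s(1) X_scale[OF y]] .
      then have "\<delta> \<le> D (\<lambda>x. s n x + t *\<^sub>R y x)"
        unfolding \<delta>_def using bdd by (rule cINF_lower[rotated])
      also have "\<dots> = l2_inner \<mu> (\<lambda>x. ?v x - t *\<^sub>R y x) (\<lambda>x. ?v x - t *\<^sub>R y x)"
        unfolding D_def by (simp add: algebra_simps)
      also have "\<dots> = D (s n) - 2 * t * ?b + t\<^sup>2 * ?c"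
        unfolding D_def l2_inner_diff_left[OF L(1) L2_scaleR[OF L(2)] L2_diff[OF L(1) L2_scaleR[OF L(2)]]]
          l2_inner_diff_right[OF L(1) L2_scaleR[OF L(2)] L(1)]
          l2_inner_diff_right[OF L(1) L2_scaleR[OF L(2)] L2_scaleR[OF L(2)]]
        by (simp add: l2_inner_commute[of \<mu> y ?v] power2_eq_square algebra_simps)
      finally show ?thesis using s(2)[of n] by simp
    qed
    have "?b\<^sup>2 \<le> (1/16) ^ n * ?c"
    proof (cases "?c = 0")
      case True
      then have "?b = 0"
        using l2_inner_AE_zero(2)[OF L(2,1)] l2_inner_self_eq_0_iff[OF L(2)] by simp
      then show ?thesis by (simp add: True)
    next
      case False
      then have c: "?c > 0" using l2_inner_self_nonneg[of \<mu> y] by linarith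
      have "0 \<le> ?c * ((1/16) ^ n - 2 * (?b / ?c) * ?b + (?b / ?c)\<^sup>2 * ?c)"
        using q[of "?b / ?c"] c by (intro mult_nonneg_nonneg) auto
      also have "\<dots> = (1/16) ^ n * ?c - ?b\<^sup>2"
        using c by (simp add: field_simps power2_eq_square)
      finally show ?thesis by simp
    qed
    also have "(1/16) ^ n * ?c = ((1/4) ^ n * l2_norm \<mu> y)\<^sup>2"
    proof -
      have "((1/4) ^ n)\<^sup>2 = (1/16 :: real) ^ n"
        by (simp add: power2_eq_square flip: power_mult_distrib)
      then show ?thesis by (simp add: power_mult_distrib l2_norm_squared)
    qed
    finally show ?thesis
      using abs_le_square_iff[of ?b "(1/4) ^ n * l2_norm \<mu> y"] by simp
  qed
  with s(1) that show ?thesis unfolding l2_approx_proj_def by blast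
qed

lemma l2_norm_le_of_inner:
  assumes "l2_inner \<mu> y y \<le> c * l2_norm \<mu> y" "0 \<le> c"
  shows "l2_norm \<mu> y \<le> c"
proof (cases "l2_norm \<mu> y = 0")
  case False
  then have "0 < l2_norm \<mu> y" using l2_norm_nonneg[of \<mu> y] by linarith
  moreover have "l2_norm \<mu> y * l2_norm \<mu> y \<le> c * l2_norm \<mu> y"
    using assms(1) by (simp add: power2_eq_square flip: l2_norm_squared)
  ultimately show ?thesis by simp
qed (use assms in simp)

lemma tendsto_geometric_bound:
  fixes f :: "nat \<Rightarrow> real"
  assumes "\<And>n. 0 \<le> f n" "\<And>n. f n \<le> c * (1/4) ^ n"
  shows "f \<longlonglongrightarrow> 0"
proof (rule tendsto_sandwich[of "\<lambda>_. 0" f _ "\<lambda>n. c * (1/4) ^ n"])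
  have "(\<lambda>n. c * (1/4) ^ n) \<longlonglongrightarrow> c * 0"
    by (intro tendsto_mult_left LIMSEQ_power_zero) simp
  then show "(\<lambda>n. c * (1/4) ^ n) \<longlonglongrightarrow> 0" by simp
qed (use assms in auto)

text \<open>
  The extension is \<open>T\<close> composed with the orthogonal projection onto the closure of \<open>X\<close>.
\<close>

lemma l2_bounded_extension:
  fixes X :: "('a \<Rightarrow> 'b::euclidean_space) set" and T :: "('a \<Rightarrow> 'b) \<Rightarrow> 'c \<Rightarrow> 'd::euclidean_space"
  assumes X: "X \<subseteq> L2 \<mu>" "(\<lambda>x. 0) \<in> X"
    and X_add: "\<And>f g. f \<in> X \<Longrightarrow> g \<in> X \<Longrightarrow> (\<lambda>x. f x + g x) \<in> X"
    and X_scale: "\<And>f c. f \<in> X \<Longrightarrow> (\<lambda>x. c *\<^sub>R f x) \<in> X"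
    and T: "\<And>f. f \<in> X \<Longrightarrow> T f \<in> L2 \<nu>"
    and T_add: "\<And>f g. f \<in> X \<Longrightarrow> g \<in> X \<Longrightarrow> T (\<lambda>x. f x + g x) = (\<lambda>x. T f x + T g x)"
    and T_scale: "\<And>f c. f \<in> X \<Longrightarrow> T (\<lambda>x. c *\<^sub>R f x) = (\<lambda>x. c *\<^sub>R T f x)"
    and C: "0 \<le> C" "\<And>f. f \<in> X \<Longrightarrow> l2_norm \<nu> (T f) \<le> C * l2_norm \<mu> f"
  shows "\<exists>T'. (\<forall>f\<in>L2 \<mu>. T' f \<in> L2 \<nu> \<and> l2_norm \<nu> (T' f) \<le> C * l2_norm \<mu> f \<and>
      (\<forall>c. AE x in \<nu>. T' (\<lambda>x. c *\<^sub>R f x) x = c *\<^sub>R T' f x) \<and>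
      (\<forall>g\<in>L2 \<mu>. AE x in \<nu>. T' (\<lambda>x. f x + g x) x = T' f x + T' g x)) \<and>
    (\<forall>f\<in>X. AE x in \<nu>. T' f x = T f x)"
proof -
  define G where "G u g \<longleftrightarrow> g \<in> L2 \<nu> \<and>
    (\<exists>s. l2_approx_proj \<mu> X u s \<and> (\<lambda>n. l2_norm \<nu> (\<lambda>x. T (s n) x - g x)) \<longlonglongrightarrow> 0)" for u g
  have X_diff: "(\<lambda>x. f x - g x) \<in> X" if "f \<in> X" "g \<in> X" for f g
    using X_add[OF that(1) X_scale[OF that(2), of "-1"]] by simp
  have T_diff: "T (\<lambda>x. f x - g x) = (\<lambda>x. T f x - T g x)" if "f \<in> X" "g \<in> X" for f g
    using T_add[OF that(1) X_scale[OF that(2), of "-1"]] T_scale[OF that(2), of "-1"] by simp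
  have XL: "f \<in> L2 \<mu>" if "f \<in> X" for f using X that by blast
  have ex: "\<exists>g. G u g" if u: "u \<in> L2 \<mu>" for u
  proof -
    obtain s where s: "l2_approx_proj \<mu> X u s"
      using l2_approx_proj_exists[OF X X_add X_scale u] by blast
    then obtain c where sX: "\<And>n. s n \<in> X"
      and c: "\<And>n y. y \<in> X \<Longrightarrow> \<bar>l2_inner \<mu> (\<lambda>x. u x - s n x) y\<bar> \<le> c * (1/4) ^ n * l2_norm \<mu> y"
      by (auto simp: l2_approx_proj_def)
    have bd: "l2_norm \<mu> (\<lambda>x. s (Suc n) x - s n x) \<le> 2 * \<bar>c\<bar> * (1/4) ^ n" for n
    proof (rule l2_norm_le_of_inner)
      let ?y = "\<lambda>x. s (Suc n) x - s n x"
      have y: "?y \<in> X" using X_diff sX by blast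
      have "l2_inner \<mu> ?y ?y = l2_inner \<mu> (\<lambda>x. (u x - s n x) - (u x - s (Suc n) x)) ?y"
        by simp
      also have "\<dots> = l2_inner \<mu> (\<lambda>x. u x - s n x) ?y - l2_inner \<mu> (\<lambda>x. u x - s (Suc n) x) ?y"
        using u sX XL XL[OF y] by (intro l2_inner_diff_left) auto
      also have "\<dots> \<le> c * (1/4) ^ n * l2_norm \<mu> ?y + c * (1/4) ^ Suc n * l2_norm \<mu> ?y"
        using c[OF y, of n] c[OF y, of "Suc n"] by linarith
      also have "\<dots> \<le> 2 * \<bar>c\<bar> * (1/4) ^ n * l2_norm \<mu> ?y"
      proof -
        have "c * (1/4) ^ n + c * (1/4) ^ Suc n = (5/4 * c) * (1/4) ^ n" by simp
        also have "\<dots> \<le> 2 * \<bar>c\<bar> * (1/4) ^ n" by (intro mult_right_mono) auto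
        finally have "(c * (1/4) ^ n + c * (1/4) ^ Suc n) * l2_norm \<mu> ?y \<le> (2 * \<bar>c\<bar> * (1/4) ^ n) * l2_norm \<mu> ?y"
          by (rule mult_right_mono) simp
        then show ?thesis by (simp only: distrib_right)
      qed
      finally show "l2_inner \<mu> ?y ?y \<le> 2 * \<bar>c\<bar> * (1/4) ^ n * l2_norm \<mu> ?y" .
    qed simp
    have "l2_norm \<nu> (\<lambda>x. T (s (Suc n)) x - T (s n) x) \<le> (C * (2 * \<bar>c\<bar>)) * (1/4) ^ n" for n
    proof -
      have "l2_norm \<nu> (\<lambda>x. T (s (Suc n)) x - T (s n) x) \<le> C * l2_norm \<mu> (\<lambda>x. s (Suc n) x - s n x)"
        using C(2)[OF X_diff[OF sX sX], of "Suc n" n] T_diff[OF sX sX, of "Suc n" n] by simp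
      also have "\<dots> \<le> C * (2 * \<bar>c\<bar> * (1/4) ^ n)" using bd C(1) by (rule mult_left_mono)
      finally show ?thesis by simp
    qed
    then obtain g where "g \<in> L2 \<nu>" "(\<lambda>n. l2_norm \<nu> (\<lambda>x. T (s n) x - g x)) \<longlonglongrightarrow> 0"
      using l2_complete[of "\<lambda>n. T (s n)" \<nu> "C * (2 * \<bar>c\<bar>)"] T sX by blast
    with s show ?thesis unfolding G_def by blast
  qed
  have unique: "AE x in \<nu>. h x = a *\<^sub>R f x + b *\<^sub>R g x"
    if w: "w \<in> L2 \<mu>" "AE x in \<mu>. w x = a *\<^sub>R u x + b *\<^sub>R v x" and u: "u \<in> L2 \<mu>" and v: "v \<in> L2 \<mu>"
      and "G u f" "G v g" "G w h" for u v w f g h a b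
  proof -
    obtain r c1 where r: "\<And>n. r n \<in> X" "(\<lambda>n. l2_norm \<nu> (\<lambda>x. T (r n) x - f x)) \<longlonglongrightarrow> 0"
      and r': "\<And>n y. y \<in> X \<Longrightarrow> \<bar>l2_inner \<mu> (\<lambda>x. u x - r n x) y\<bar> \<le> c1 * (1/4) ^ n * l2_norm \<mu> y"
      using \<open>G u f\<close> unfolding G_def l2_approx_proj_def by blast
    obtain s c2 where s: "\<And>n. s n \<in> X" "(\<lambda>n. l2_norm \<nu> (\<lambda>x. T (s n) x - g x)) \<longlonglongrightarrow> 0"
      and s': "\<And>n y. y \<in> X \<Longrightarrow> \<bar>l2_inner \<mu> (\<lambda>x. v x - s n x) y\<bar> \<le> c2 * (1/4) ^ n * l2_norm \<mu> y"
      using \<open>G v g\<close> unfolding G_def l2_approx_proj_def by blast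
    obtain t c3 where t: "\<And>n. t n \<in> X" "(\<lambda>n. l2_norm \<nu> (\<lambda>x. T (t n) x - h x)) \<longlonglongrightarrow> 0"
      and t': "\<And>n y. y \<in> X \<Longrightarrow> \<bar>l2_inner \<mu> (\<lambda>x. w x - t n x) y\<bar> \<le> c3 * (1/4) ^ n * l2_norm \<mu> y"
      using \<open>G w h\<close> unfolding G_def l2_approx_proj_def by blast
    have L: "f \<in> L2 \<nu>" "g \<in> L2 \<nu>" "h \<in> L2 \<nu>"
      using \<open>G u f\<close> \<open>G v g\<close> \<open>G w h\<close> by (auto simp: G_def)
    define z where "z n = (\<lambda>x. a *\<^sub>R r n x + b *\<^sub>R s n x)" for n
    have zX: "z n \<in> X" for n unfolding z_def by (intro X_add X_scale r s)
    have Tz: "T (z n) = (\<lambda>x. a *\<^sub>R T (r n) x + b *\<^sub>R T (s n) x)" for n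
      unfolding z_def by (simp add: T_add T_scale X_scale r s)
    define K where "K = \<bar>a\<bar> * \<bar>c1\<bar> + \<bar>b\<bar> * \<bar>c2\<bar> + \<bar>c3\<bar>"
    have K: "0 \<le> K" by (simp add: K_def)
    have tz: "l2_norm \<mu> (\<lambda>x. t n x - z n x) \<le> K * (1/4) ^ n" for n
    proof (rule l2_norm_le_of_inner)
      let ?y = "\<lambda>x. t n x - z n x" and ?N = "l2_norm \<mu> (\<lambda>x. t n x - z n x)"
      let ?U = "\<lambda>x. u x - r n x" and ?V = "\<lambda>x. v x - s n x" and ?W = "\<lambda>x. w x - t n x"
      have y: "?y \<in> X" using X_diff t zX by blast
      have LL: "?U \<in> L2 \<mu>" "?V \<in> L2 \<mu>" "?W \<in> L2 \<mu>" "?y \<in> L2 \<mu>"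
        using u v w(1) r(1) s(1) t(1) XL XL[OF y] by auto
      have LL': "(\<lambda>x. a *\<^sub>R ?U x) \<in> L2 \<mu>" "(\<lambda>x. b *\<^sub>R ?V x) \<in> L2 \<mu>"
        using L2_scaleR[OF LL(1)] L2_scaleR[OF LL(2)] by auto
      have "AE x in \<mu>. ?y x = (a *\<^sub>R ?U x + b *\<^sub>R ?V x) - ?W x"
        using w(2) by eventually_elim (simp add: z_def algebra_simps)
      then have "l2_inner \<mu> ?y ?y = l2_inner \<mu> (\<lambda>x. (a *\<^sub>R ?U x + b *\<^sub>R ?V x) - ?W x) ?y"
        using LL LL' by (intro l2_inner_cong_AE) (auto intro: L2_diff L2_add)
      also have "\<dots> = a * l2_inner \<mu> ?U ?y + b * l2_inner \<mu> ?V ?y - l2_inner \<mu> ?W ?y"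
        using l2_inner_diff_left[OF L2_add[OF LL'] LL(3,4)] l2_inner_add_left[OF LL' LL(4)]
        by (simp only: l2_inner_scaleR_left)
      also have "\<dots> \<le> \<bar>a\<bar> * \<bar>l2_inner \<mu> ?U ?y\<bar> + \<bar>b\<bar> * \<bar>l2_inner \<mu> ?V ?y\<bar> + \<bar>l2_inner \<mu> ?W ?y\<bar>"
      proof -
        have "a * A \<le> \<bar>a\<bar> * \<bar>A\<bar>" for a A :: real by (metis abs_ge_self abs_mult)
        from this[of a "l2_inner \<mu> ?U ?y"] this[of b "l2_inner \<mu> ?V ?y"] show ?thesis by linarith
      qed
      also have "\<dots> \<le> \<bar>a\<bar> * (\<bar>c1\<bar> * (1/4) ^ n * ?N) + \<bar>b\<bar> * (\<bar>c2\<bar> * (1/4) ^ n * ?N) + \<bar>c3\<bar> * (1/4) ^ n * ?N"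
      proof -
        have "c * (1/4) ^ n * ?N \<le> \<bar>c\<bar> * (1/4) ^ n * ?N" for c
          by (intro mult_right_mono) auto
        then show ?thesis
          using r'[OF y, of n] s'[OF y, of n] t'[OF y, of n]
          by (intro add_mono mult_left_mono) (auto intro: order_trans)
      qed
      also have "\<dots> = K * (1/4) ^ n * ?N" by (simp add: K_def algebra_simps)
      finally show "l2_inner \<mu> ?y ?y \<le> K * (1/4) ^ n * ?N" .
    qed (use K in simp)
    have TL: "T (r n) \<in> L2 \<nu>" "T (s n) \<in> L2 \<nu>" "T (t n) \<in> L2 \<nu>" "T (z n) \<in> L2 \<nu>" for n
      using T r s t zX by auto
    have lin: "(\<lambda>n. l2_norm \<nu> (\<lambda>x. T (z n) x - (a *\<^sub>R f x + b *\<^sub>R g x))) \<longlonglongrightarrow> 0"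
    proof (rule tendsto_sandwich[of "\<lambda>_. 0"])
      let ?B = "\<lambda>n. \<bar>a\<bar> * l2_norm \<nu> (\<lambda>x. T (r n) x - f x) + \<bar>b\<bar> * l2_norm \<nu> (\<lambda>x. T (s n) x - g x)"
      show "\<forall>\<^sub>F n in sequentially. l2_norm \<nu> (\<lambda>x. T (z n) x - (a *\<^sub>R f x + b *\<^sub>R g x)) \<le> ?B n"
      proof (rule always_eventually, rule allI)
        fix n
        have eq: "(\<lambda>x. T (z n) x - (a *\<^sub>R f x + b *\<^sub>R g x))
            = (\<lambda>x. a *\<^sub>R (T (r n) x - f x) + b *\<^sub>R (T (s n) x - g x))"
          by (simp add: Tz algebra_simps)
        have "l2_norm \<nu> (\<lambda>x. a *\<^sub>R (T (r n) x - f x) + b *\<^sub>R (T (s n) x - g x))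
            \<le> l2_norm \<nu> (\<lambda>x. a *\<^sub>R (T (r n) x - f x)) + l2_norm \<nu> (\<lambda>x. b *\<^sub>R (T (s n) x - g x))"
          by (intro l2_norm_add L2_scaleR L2_diff TL L)
        then show "l2_norm \<nu> (\<lambda>x. T (z n) x - (a *\<^sub>R f x + b *\<^sub>R g x)) \<le> ?B n"
          by (simp only: l2_norm_scaleR eq)
      qed
      have "?B \<longlonglongrightarrow> \<bar>a\<bar> * 0 + \<bar>b\<bar> * 0" using r(2) s(2) by (intro tendsto_intros)
      then show "?B \<longlonglongrightarrow> 0" by simp
    qed auto
    have dif: "(\<lambda>n. l2_norm \<nu> (\<lambda>x. T (z n) x - T (t n) x)) \<longlonglongrightarrow> 0"
    proof (rule tendsto_geometric_bound[of _ "C * K"])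
      fix n
      have "l2_norm \<nu> (\<lambda>x. T (t n) x - T (z n) x) \<le> C * l2_norm \<mu> (\<lambda>x. t n x - z n x)"
        using C(2)[OF X_diff[OF t(1) zX], of n n] T_diff[OF t(1) zX, of n n] by simp
      also have "\<dots> \<le> C * (K * (1/4) ^ n)" using tz C(1) by (rule mult_left_mono)
      finally show "l2_norm \<nu> (\<lambda>x. T (z n) x - T (t n) x) \<le> C * K * (1/4) ^ n"
        by (simp add: l2_norm_minus_commute[of \<nu> "T (z n)"])
    qed simp
    have hz: "(\<lambda>n. l2_norm \<nu> (\<lambda>x. T (z n) x - h x)) \<longlonglongrightarrow> 0"
    proof (rule tendsto_sandwich[of "\<lambda>_. 0"])
      show "\<forall>\<^sub>F n in sequentially. l2_norm \<nu> (\<lambda>x. T (z n) x - h x)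
          \<le> l2_norm \<nu> (\<lambda>x. T (z n) x - T (t n) x) + l2_norm \<nu> (\<lambda>x. T (t n) x - h x)"
      proof (rule always_eventually, rule allI)
        fix n
        show "l2_norm \<nu> (\<lambda>x. T (z n) x - h x)
          \<le> l2_norm \<nu> (\<lambda>x. T (z n) x - T (t n) x) + l2_norm \<nu> (\<lambda>x. T (t n) x - h x)"
          using l2_norm_add[OF L2_diff[OF TL(4,3)] L2_diff[OF TL(3) L(3)], of n n n] by simp
      qed
      show "(\<lambda>n. l2_norm \<nu> (\<lambda>x. T (z n) x - T (t n) x) + l2_norm \<nu> (\<lambda>x. T (t n) x - h x)) \<longlonglongrightarrow> 0"
        using tendsto_add[OF dif t(2)] by simp
    qed auto
    show ?thesis
      by (rule l2_norm_tendsto_unique[OF TL(4) L(3) _ hz lin]) (use L in auto)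
  qed
  define T' where "T' u = (SOME g. G u g)" for u
  have T': "G u (T' u)" if "u \<in> L2 \<mu>" for u
    unfolding T'_def using someI_ex[OF ex[OF that]] .
  show ?thesis
  proof (intro exI[of _ T'] conjI ballI allI)
    fix f :: "'a \<Rightarrow> 'b" assume f: "f \<in> L2 \<mu>"
    show "T' f \<in> L2 \<nu>" using T'[OF f] by (simp add: G_def)
    show "l2_norm \<nu> (T' f) \<le> C * l2_norm \<mu> f"
    proof -
      obtain s c where s: "\<And>n. s n \<in> X" "(\<lambda>n. l2_norm \<nu> (\<lambda>x. T (s n) x - T' f x)) \<longlonglongrightarrow> 0"
        and c: "\<And>n y. y \<in> X \<Longrightarrow> \<bar>l2_inner \<mu> (\<lambda>x. f x - s n x) y\<bar> \<le> c * (1/4) ^ n * l2_norm \<mu> y"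
        using T'[OF f] unfolding G_def l2_approx_proj_def by blast
      have sn: "l2_norm \<mu> (s n) \<le> l2_norm \<mu> f + \<bar>c\<bar> * (1/4) ^ n" for n
      proof (rule l2_norm_le_of_inner)
        have sL: "s n \<in> L2 \<mu>" using s(1) XL by blast
        have "l2_inner \<mu> (s n) (s n) = l2_inner \<mu> (\<lambda>x. f x - (f x - s n x)) (s n)" by simp
        also have "\<dots> = l2_inner \<mu> f (s n) - l2_inner \<mu> (\<lambda>x. f x - s n x) (s n)"
          using f sL by (intro l2_inner_diff_left) auto
        also have "\<dots> \<le> l2_norm \<mu> f * l2_norm \<mu> (s n) + c * (1/4) ^ n * l2_norm \<mu> (s n)"
          using l2_Cauchy_Schwarz[OF f sL] c[OF s(1), of n n] unfolding l2_norm_def by linarith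
        also have "\<dots> \<le> (l2_norm \<mu> f + \<bar>c\<bar> * (1/4) ^ n) * l2_norm \<mu> (s n)"
          unfolding distrib_right by (intro add_left_mono mult_right_mono) auto
        finally show "l2_inner \<mu> (s n) (s n) \<le> (l2_norm \<mu> f + \<bar>c\<bar> * (1/4) ^ n) * l2_norm \<mu> (s n)" .
      qed simp
      have TL: "T (s n) \<in> L2 \<nu>" "T' f \<in> L2 \<nu>" for n
        using T s(1) T'[OF f] by (auto simp: G_def)
      have bnd: "l2_norm \<nu> (T' f) \<le> l2_norm \<nu> (\<lambda>x. T (s n) x - T' f x) + C * (l2_norm \<mu> f + \<bar>c\<bar> * (1/4) ^ n)" for n
      proof -
        have "l2_norm \<nu> (T' f) \<le> l2_norm \<nu> (\<lambda>x. T' f x - T (s n) x) + l2_norm \<nu> (T (s n))"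
          using l2_norm_add[OF L2_diff[OF TL(2,1)] TL(1), of n n] by simp
        also have "l2_norm \<nu> (T (s n)) \<le> C * (l2_norm \<mu> f + \<bar>c\<bar> * (1/4) ^ n)"
          using C(2)[OF s(1), of n] mult_left_mono[OF sn C(1), of n] by linarith
        finally show ?thesis by (simp add: l2_norm_minus_commute[of \<nu> "T' f"])
      qed
      have "(\<lambda>n. l2_norm \<nu> (\<lambda>x. T (s n) x - T' f x) + C * (l2_norm \<mu> f + \<bar>c\<bar> * (1/4) ^ n))
          \<longlonglongrightarrow> 0 + C * (l2_norm \<mu> f + \<bar>c\<bar> * 0)"
        by (intro tendsto_intros s(2) LIMSEQ_power_zero) simp
      then show ?thesis
        by (intro LIMSEQ_le_const[where a = "l2_norm \<nu> (T' f)"]) (use bnd in auto)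
    qed
    show "AE x in \<nu>. T' (\<lambda>x. c *\<^sub>R f x) x = c *\<^sub>R T' f x" for c
      using unique[of "\<lambda>x. c *\<^sub>R f x" c f 0 f, OF _ _ f f T'[OF f] T'[OF f] T'] f by auto
    show "AE x in \<nu>. T' (\<lambda>x. f x + g x) x = T' f x + T' g x" if g: "g \<in> L2 \<mu>" for g
      using unique[of "\<lambda>x. f x + g x" 1 f 1 g, OF _ _ f g T'[OF f] T'[OF g] T'] f g by auto
  next
    fix f :: "'a \<Rightarrow> 'b" assume f: "f \<in> X"
    have "l2_approx_proj \<mu> X f (\<lambda>n. f)"
      using f unfolding l2_approx_proj_def by (auto intro!: exI[of _ 0])
    then have "G f (T f)"
      unfolding G_def using T[OF f] by (auto intro!: exI[of _ "\<lambda>n. f"] simp: l2_norm_def)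
    then show "AE x in \<nu>. T' f x = T f x"
      using unique[of f 1 f 0 f, OF _ _ _ _ _ _ T'[OF XL[OF f]]] XL[OF f] by auto
  qed
qed


section \<open>Continuously differentiable functions and weak derivatives\<close>

lemma C1_has_derivative: "C1 f \<Longrightarrow> (f has_derivative frechet_derivative f (at x)) (at x)"
  unfolding C1_def using frechet_derivative_works by blast

lemma C1_continuous_derivative: "C1 f \<Longrightarrow> continuous_on A (\<lambda>x. frechet_derivative f (at x) h)"
  unfolding C1_def using continuous_on_subset by blast

lemma C1I:
  assumes "\<And>x. (f has_derivative f' x) (at x)" "\<And>h. continuous_on UNIV (\<lambda>x. f' x h)"
  shows "C1 f"
proof -
  have "f' x = frechet_derivative f (at x)" for x
    using frechet_derivative_at[OF assms(1)] .
  with assms show ?thesis unfolding C1_def by (auto simp: differentiable_def)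
qed

lemma C1_continuous: "C1 f \<Longrightarrow> continuous_on A f"
  using C1_has_derivative has_derivative_continuous
  by (metis continuous_at_imp_continuous_on)

lemma C1_const: "C1 (\<lambda>x. c)"
  by (rule C1I) (auto intro: derivative_eq_intros)

lemma C1_linear:
  assumes "bounded_linear L" "C1 f"
  shows "C1 (\<lambda>x. L (f x))"
  using bounded_linear.has_derivative[OF assms(1) C1_has_derivative[OF assms(2)]]
  by (rule C1I)
     (intro bounded_linear.continuous_on[OF assms(1)] C1_continuous_derivative assms(2))

lemma C1_add: "C1 f \<Longrightarrow> C1 g \<Longrightarrow> C1 (\<lambda>x. f x + g x)"
  by (rule C1I[of _ "\<lambda>x h. frechet_derivative f (at x) h + frechet_derivative g (at x) h"])
     (intro has_derivative_add C1_has_derivative continuous_on_add C1_continuous_derivative; assumption)+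

lemma C1_mult:
  fixes f g :: "real^'n \<Rightarrow> real"
  assumes "C1 f" "C1 g"
  shows "C1 (\<lambda>x. f x * g x)"
  by (rule C1I[OF has_derivative_mult[OF C1_has_derivative[OF assms(1)] C1_has_derivative[OF assms(2)]]])
     (intro continuous_intros C1_continuous_derivative C1_continuous assms)

lemma C1_prod:
  fixes f :: "'i \<Rightarrow> real^'n \<Rightarrow> real"
  shows "(\<And>i. i \<in> I \<Longrightarrow> C1 (f i)) \<Longrightarrow> C1 (\<lambda>x. \<Prod>i\<in>I. f i x)"
  by (induction I rule: infinite_finite_induct) (auto intro: C1_const C1_mult)

lemma C1_compose_real:
  fixes f :: "real^'n \<Rightarrow> real"
  assumes "\<And>t. (q has_field_derivative q' t) (at t)" "continuous_on UNIV q'" "C1 f"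
  shows "C1 (\<lambda>x. q (f x))"
proof (rule C1I)
  show "((\<lambda>x. q (f x)) has_derivative (\<lambda>h. q' (f x) * frechet_derivative f (at x) h)) (at x)" for x
    using has_derivative_compose[OF C1_has_derivative[OF assms(3)], of q]
      assms(1)[unfolded has_field_derivative_def] by fastforce
  show "continuous_on UNIV (\<lambda>x. q' (f x) * frechet_derivative f (at x) h)" for h
    by (intro continuous_on_mult C1_continuous_derivative assms(3)
        continuous_on_compose2[OF assms(2) C1_continuous[OF assms(3)]]) auto
qed

lemma C1_inverse:
  fixes f :: "real^'n \<Rightarrow> real"
  assumes "C1 f" "\<And>x. f x \<noteq> 0"
  shows "C1 (\<lambda>x. inverse (f x))"
proof (rule C1I)
  show "((\<lambda>x. inverse (f x)) has_derivative
      (\<lambda>h. - (inverse (f x) * frechet_derivative f (at x) h * inverse (f x)))) (at x)" for x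
    using Deriv.has_derivative_inverse[OF assms(2) C1_has_derivative[OF assms(1)]] .
  show "continuous_on UNIV (\<lambda>x. - (inverse (f x) * frechet_derivative f (at x) h * inverse (f x)))" for h
    using assms(2)
    by (intro continuous_on_minus continuous_on_mult continuous_on_inverse
        C1_continuous_derivative C1_continuous assms(1)) auto
qed

lemma C1_frechet_derivative_add:
  assumes "C1 f" "C1 g"
  shows "frechet_derivative (\<lambda>x. f x + g x) (at x) h =
    frechet_derivative f (at x) h + frechet_derivative g (at x) h"
  using frechet_derivative_at[OF has_derivative_add[OF assms[THEN C1_has_derivative]], of x]
  by (metis (no_types))

lemma C1_frechet_derivative_linear:
  assumes "bounded_linear L" "C1 f"
  shows "frechet_derivative (\<lambda>x. L (f x)) (at x) h = L (frechet_derivative f (at x) h)"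
  using frechet_derivative_at[OF bounded_linear.has_derivative[OF assms(1) C1_has_derivative[OF assms(2)]], of x]
  by (metis (no_types))

lemma partial_deriv_mult:
  assumes "C1 f" "C1 g"
  shows "partial_deriv j (\<lambda>x. f x * g x) x = partial_deriv j f x * g x + f x * partial_deriv j g x"
  unfolding partial_deriv_def
  using frechet_derivative_at[OF has_derivative_mult[OF assms[THEN C1_has_derivative]], of x, symmetric]
  by (simp add: algebra_simps)

lemma has_field_derivative_max_0_sqr:
  "((\<lambda>t. (max 0 t)\<^sup>2) has_field_derivative 2 * max 0 t) (at (t::real))"
proof -
  consider "t < 0" | "t = 0" | "0 < t" by linarith
  then show ?thesis
  proof cases
    case 1
    have "((\<lambda>t. 0) has_field_derivative 0) (at t)" by simp
    moreover have "\<forall>\<^sub>F s in nhds t. (0::real) = (max 0 s)\<^sup>2"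
      using eventually_nhds_in_open[of "{..<0}" t] 1 by (auto elim!: eventually_mono)
    ultimately show ?thesis
      using 1 DERIV_cong_ev[of t t "\<lambda>t. 0" "\<lambda>t. (max 0 t)\<^sup>2" 0 0] by simp
  next
    case 2
    have "((\<lambda>h. ((max 0 h)\<^sup>2 - (max 0 0)\<^sup>2) / h) \<longlongrightarrow> (0::real)) (at 0)"
    proof (rule Lim_null_comparison)
      show "\<forall>\<^sub>F h in at 0. norm (((max 0 h)\<^sup>2 - (max 0 0)\<^sup>2) / h) \<le> \<bar>h::real\<bar>"
        by (rule always_eventually) (auto simp: max_def power2_eq_square)
      show "((\<lambda>h::real. \<bar>h\<bar>) \<longlongrightarrow> 0) (at 0)"
        using tendsto_rabs[OF tendsto_ident_at[of "0::real" UNIV]] by simp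
    qed
    then show ?thesis using 2 by (simp add: DERIV_def)
  next
    case 3
    have "((\<lambda>t. t\<^sup>2) has_field_derivative 2 * t) (at t)"
      by (auto intro!: derivative_eq_intros)
    moreover have "\<forall>\<^sub>F s in nhds t. s\<^sup>2 = (max 0 s)\<^sup>2"
      using eventually_nhds_in_open[of "{0<..}" t] 3 by (auto elim!: eventually_mono)
    ultimately show ?thesis
      using 3 DERIV_cong_ev[of t t "\<lambda>t. t\<^sup>2" "\<lambda>t. (max 0 t)\<^sup>2" "2 * t" "2 * t"] by simp
  qed
qed

lemma test_function_zero_derivative:
  assumes "C1 \<phi>" "closed C" "\<And>x. x \<notin> C \<Longrightarrow> \<phi> x = 0" "x \<notin> C"
  shows "partial_deriv j \<phi> x = 0"
proof -
  have "((\<lambda>x. 0) has_derivative (\<lambda>h. 0)) (at x)" by simp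
  then have "(\<phi> has_derivative (\<lambda>h. 0)) (at x)"
  proof (rule has_derivative_transform_eventually)
    have "\<forall>\<^sub>F y in nhds x. y \<in> - C"
      using assms(2,4) by (intro eventually_nhds_in_open) auto
    then show "\<forall>\<^sub>F y in at x. 0 = \<phi> y"
      unfolding eventually_at_filter using assms(3) by (auto elim!: eventually_mono)
  qed (use assms in auto)
  then show ?thesis
    using frechet_derivative_at[of \<phi> "\<lambda>h. 0" x, symmetric] by (simp add: partial_deriv_def)
qed

lemma integral_lborel_translate:
  fixes f :: "'a::euclidean_space \<Rightarrow> real"
  assumes [measurable]: "f \<in> borel_measurable borel"
  shows "(\<integral>x. f (c + x) \<partial>lborel) = (\<integral>x. f x \<partial>lborel)"
  using integral_distr[of "(+) c" lborel borel f] by (simp add: lborel_distr_plus)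

text \<open>Translation invariance, differentiated under the integral sign.\<close>

lemma integral_partial_deriv_zero:
  fixes w :: "real^'n \<Rightarrow> real"
  assumes w: "C1 w" and C: "compact C" "\<And>x. x \<notin> C \<Longrightarrow> w x = 0"
  shows "(\<integral>x. partial_deriv j w x \<partial>lborel) = 0"
proof -
  define e where "e = (axis j 1 :: real^'n)"
  have e: "norm e = 1" by (simp add: e_def)
  have [measurable]: "w \<in> borel_measurable borel"
    using C1_continuous[OF w] by (rule borel_measurable_continuous_onI)
  have cd: "continuous_on UNIV (partial_deriv j w)"
    unfolding partial_deriv_def[abs_def] using w by (rule C1_continuous_derivative)
  then have [measurable]: "partial_deriv j w \<in> borel_measurable borel"
    by (rule borel_measurable_continuous_onI)
  have pz: "partial_deriv j w x = 0" if "x \<notin> C" for x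
    using test_function_zero_derivative[OF w compact_imp_closed[OF C(1)] C(2) that] .
  have "bounded (partial_deriv j w ` C)"
    using compact_continuous_image[OF continuous_on_subset[OF cd subset_UNIV] C(1)]
    by (rule compact_imp_bounded)
  then obtain B where B: "\<And>x. x \<in> C \<Longrightarrow> \<bar>partial_deriv j w x\<bar> \<le> B"
    by (auto simp: bounded_iff)
  define B' where "B' = max B 0"
  have B': "\<bar>partial_deriv j w x\<bar> \<le> B'" for x
    using B[of x] pz[of x] by (cases "x \<in> C") (auto simp: B'_def)
  obtain R where R: "\<And>x. x \<in> C \<Longrightarrow> norm x \<le> R"
    using compact_imp_bounded[OF C(1)] by (auto simp: bounded_iff)
  have line: "((\<lambda>t. w (x + t *\<^sub>R e)) has_real_derivative partial_deriv j w (x + t *\<^sub>R e)) (at t within A)"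
    for x t A
  proof -
    have "((\<lambda>t. x + t *\<^sub>R e) has_derivative (\<lambda>s. s *\<^sub>R e)) (at t within A)"
      by (auto intro!: derivative_eq_intros)
    from has_derivative_compose[OF this C1_has_derivative[OF w]]
    have "((\<lambda>t. w (x + t *\<^sub>R e)) has_derivative
        (\<lambda>s. frechet_derivative w (at (x + t *\<^sub>R e)) (s *\<^sub>R e))) (at t within A)" .
    moreover have "frechet_derivative w (at y) (s *\<^sub>R e) = partial_deriv j w y * s" for y s
      using linear_cmul[OF has_derivative_linear[OF C1_has_derivative[OF w, of y]], of s e]
      by (simp add: partial_deriv_def e_def)
    ultimately show ?thesis by (simp add: has_field_derivative_def mult_commute_abs)
  qed
  define s where "s k x = (w (x + (1 / real (Suc k)) *\<^sub>R e) - w x) * real (Suc k)" for k x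
  have s_lim: "(\<lambda>k. s k x) \<longlonglongrightarrow> partial_deriv j w x" for x
  proof -
    have "((\<lambda>h. (w (x + (0 + h) *\<^sub>R e) - w (x + 0 *\<^sub>R e)) / h) \<longlongrightarrow> partial_deriv j w (x + 0 *\<^sub>R e)) (at 0)"
      using line[of x 0 UNIV] unfolding DERIV_def .
    moreover have "filterlim (\<lambda>k. 1 / real (Suc k)) (at 0) sequentially"
      unfolding filterlim_at using LIMSEQ_inverse_real_of_nat by (auto simp: inverse_eq_divide)
    ultimately have "(\<lambda>k. (w (x + (0 + 1 / real (Suc k)) *\<^sub>R e) - w (x + 0 *\<^sub>R e)) / (1 / real (Suc k)))
        \<longlonglongrightarrow> partial_deriv j w (x + 0 *\<^sub>R e)"
      by (rule filterlim_compose)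
    then show ?thesis by (simp add: s_def del: of_nat_Suc)
  qed
  have s_bd: "norm (s k x) \<le> B' * indicator (cball 0 (R + 1)) x" for k x
  proof -
    let ?h = "1 / real (Suc k)"
    have h: "0 < ?h" "?h \<le> 1" by auto
    show ?thesis
    proof (cases "norm x \<le> R + 1")
      case True
      obtain z where "w (x + ?h *\<^sub>R e) - w (x + 0 *\<^sub>R e) = (?h - 0) * partial_deriv j w (x + z *\<^sub>R e)"
        using MVT2[of 0 ?h "\<lambda>t. w (x + t *\<^sub>R e)" "\<lambda>t. partial_deriv j w (x + t *\<^sub>R e)"] line h by blast
      then have "s k x = partial_deriv j w (x + z *\<^sub>R e)" by (simp add: s_def)
      then show ?thesis using True B'[of "x + z *\<^sub>R e"] by simp
    next
      case False
      have "norm x \<le> norm (x + ?h *\<^sub>R e) + norm (?h *\<^sub>R e)"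
        using norm_triangle_ineq4[of "x + ?h *\<^sub>R e" "?h *\<^sub>R e"] by simp
      also have "norm (?h *\<^sub>R e) \<le> 1" using h e by simp
      finally have "x \<notin> C" "x + ?h *\<^sub>R e \<notin> C" using False R[of x] R[of "x + ?h *\<^sub>R e"] by auto
      then show ?thesis using C(2) False by (simp add: s_def)
    qed
  qed
  have ind: "integrable lborel (\<lambda>x::real^'n. B' * indicator (cball 0 (R + 1)) x)"
    by (intro integrable_mult_right integrable_real_indicator)
       (use emeasure_bounded_finite[OF bounded_cball[of "0::real^'n" "R + 1"]] in auto)
  have wint: "integrable lborel w"
  proof -
    have "integrable lborel (\<lambda>x. indicator C x *\<^sub>R w x)"
      using borel_integrable_compact[OF C(1) C1_continuous[OF w]] by simp
    moreover have "(\<lambda>x. indicator C x *\<^sub>R w x) = w"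
      using C(2) by (intro ext) (auto simp: indicator_def)
    ultimately show ?thesis by simp
  qed
  have "(\<lambda>k. \<integral>x. s k x \<partial>lborel) \<longlonglongrightarrow> (\<integral>x. partial_deriv j w x \<partial>lborel)"
  proof (rule integral_dominated_convergence[OF _ _ ind])
    show "s k \<in> borel_measurable lborel" for k unfolding s_def by measurable
  qed (use s_lim s_bd in auto)
  moreover have "(\<integral>x. s k x \<partial>lborel) = 0" for k
  proof -
    let ?c = "(1 / real (Suc k)) *\<^sub>R e"
    have tr: "integrable lborel (\<lambda>x. w (x + ?c))"
      using wint integrable_distr_eq[of "(+) ?c" lborel borel w] by (simp add: lborel_distr_plus add.commute)
    have "(\<integral>x. s k x \<partial>lborel) = ((\<integral>x. w (x + ?c) \<partial>lborel) - (\<integral>x. w x \<partial>lborel)) * real (Suc k)"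
      unfolding s_def using wint tr by simp
    then show ?thesis using integral_lborel_translate[of w ?c] by (simp add: add.commute)
  qed
  ultimately have "(\<lambda>k. 0) \<longlonglongrightarrow> (\<integral>x. partial_deriv j w x \<partial>lborel)" by simp
  then show ?thesis using LIMSEQ_unique[OF _ tendsto_const] by blast
qed

lemma integral_lebesgue_on_borel:
  fixes f :: "real^'n \<Rightarrow> real"
  assumes K: "open K" and f: "f \<in> borel_measurable borel" and z: "\<And>x. x \<notin> K \<Longrightarrow> f x = 0"
  shows "(\<integral>x. f x \<partial>lebesgue_on K) = (\<integral>x. f x \<partial>lborel)"
proof -
  have "(\<integral>x. f x \<partial>lebesgue_on K) = (\<integral>x. indicator K x *\<^sub>R f x \<partial>lebesgue)"
    using K by (subst integral_restrict_space) auto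
  also have "(\<lambda>x. indicator K x *\<^sub>R f x) = f"
    using z by (intro ext) (auto simp: indicator_def)
  also have "(\<integral>x. f x \<partial>lebesgue) = (\<integral>x. f x \<partial>lborel)"
    using f by (intro integral_completion) simp
  finally show ?thesis .
qed

lemma L2_continuous:
  fixes f :: "real^'n \<Rightarrow> 'b::euclidean_space"
  assumes K: "open K" "bounded K" and f: "continuous_on UNIV f"
  shows "f \<in> L2 (lebesgue_on K)"
proof -
  have "compact (closure K)" using K(2) by (simp add: compact_closure)
  then have "bounded (f ` closure K)"
    using compact_continuous_image[OF continuous_on_subset[OF f subset_UNIV]] compact_imp_bounded by blast
  then obtain B where B: "\<And>x. x \<in> closure K \<Longrightarrow> norm (f x) \<le> B"
    by (auto simp: bounded_iff)
  have m: "f \<in> borel_measurable (lebesgue_on K)"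
    using borel_measurable_continuous_onI[OF f] by (intro measurable_restrict_space1 measurable_completion) simp
  have "integrable (lebesgue_on K) (\<lambda>x. B\<^sup>2)"
  proof -
    have "emeasure (lebesgue_on K) (space (lebesgue_on K)) < \<infinity>"
      using emeasure_bounded_finite[OF K(2)] K(1) by (simp add: emeasure_restrict_space)
    then interpret finite_measure "lebesgue_on K" by (intro finite_measureI) auto
    show ?thesis by simp
  qed
  then have "integrable (lebesgue_on K) (\<lambda>x. (norm (f x))\<^sup>2)"
  proof (rule Bochner_Integration.integrable_bound)
    show "AE x in lebesgue_on K. norm ((norm (f x))\<^sup>2) \<le> norm (B\<^sup>2)"
      using B closure_subset[of K] by (intro AE_I2) (auto intro!: power_mono)
  qed (use m in measurable)
  then show ?thesis using m by (simp add: L2_def)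
qed

definition grad_matrix :: "(real^'n \<Rightarrow> real^'n) \<Rightarrow> real^'n \<Rightarrow> real^'n^'n" where
  "grad_matrix u x = (\<chi> i j. frechet_derivative u (at x) (axis j 1) $ i)"

lemma grad_matrix_continuous: "C1 u \<Longrightarrow> continuous_on A (grad_matrix u)"
  unfolding grad_matrix_def[abs_def]
  by (intro continuous_intros C1_continuous_derivative)

lemma weak_grad_C1:
  fixes u :: "real^'n \<Rightarrow> real^'n"
  assumes K: "open K" "bounded K" and u: "C1 u"
  shows "weak_grad K u (grad_matrix u)"
  unfolding weak_grad_def
proof (intro conjI allI impI)
  show "u \<in> L2 (lebesgue_on K)" using K C1_continuous[OF u] by (rule L2_continuous)
  show "grad_matrix u \<in> L2 (lebesgue_on K)" using K grad_matrix_continuous[OF u] by (rule L2_continuous)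
  fix \<phi> :: "real^'n \<Rightarrow> real" and i j :: 'n assume "test_function K \<phi>"
  then obtain C where \<phi>: "C1 \<phi>" and C: "compact C" "C \<subseteq> K" "\<And>x. x \<notin> C \<Longrightarrow> \<phi> x = 0"
    by (auto simp: test_function_def)
  have ui: "C1 (\<lambda>x. u x $ i)" using C1_linear[OF bounded_linear_vec_nth u] .
  have gi: "partial_deriv j (\<lambda>x. u x $ i) x = grad_matrix u x $ i $ j" for x
    using C1_frechet_derivative_linear[OF bounded_linear_vec_nth u]
    by (simp add: partial_deriv_def grad_matrix_def)
  let ?f = "\<lambda>x. u x $ i * partial_deriv j \<phi> x" and ?g = "\<lambda>x. grad_matrix u x $ i $ j * \<phi> x"
  have z: "?f x = 0" "?g x = 0" if "x \<notin> C" for x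
    using test_function_zero_derivative[OF \<phi> compact_imp_closed[OF C(1)] C(3) that] C(3)[OF that] by auto
  have cont: "continuous_on UNIV ?f" "continuous_on UNIV ?g"
    unfolding partial_deriv_def
    by (intro continuous_intros C1_continuous[OF u] C1_continuous[OF \<phi>] C1_continuous_derivative[OF \<phi>]
        grad_matrix_continuous[OF u])+
  have int: "integrable lborel ?f" "integrable lborel ?g"
  proof -
    have "integrable lborel h" if "continuous_on UNIV h" "\<And>x. x \<notin> C \<Longrightarrow> h x = 0" for h :: "real^'n \<Rightarrow> real"
    proof -
      have "integrable lborel (\<lambda>x. indicator C x *\<^sub>R h x)"
        using borel_integrable_compact[OF C(1) continuous_on_subset[OF that(1) subset_UNIV]] by simp
      moreover have "(\<lambda>x. indicator C x *\<^sub>R h x) = h"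
        using that(2) by (intro ext) (auto simp: indicator_def)
      ultimately show ?thesis by simp
    qed
    then show "integrable lborel ?f" "integrable lborel ?g" using z cont by blast+
  qed
  have "(\<integral>x. partial_deriv j (\<lambda>x. u x $ i * \<phi> x) x \<partial>lborel) = 0"
    by (rule integral_partial_deriv_zero[OF C1_mult[OF ui \<phi>] C(1)]) (simp add: C(3))
  then have "(\<integral>x. ?g x + ?f x \<partial>lborel) = 0"
    by (simp add: partial_deriv_mult[OF ui \<phi>] gi)
  then have "(\<integral>x. ?f x \<partial>lborel) = - (\<integral>x. ?g x \<partial>lborel)"
    using int by simp
  moreover have "(\<integral>x. ?f x \<partial>lebesgue_on K) = (\<integral>x. ?f x \<partial>lborel)"
    using z C(2) by (intro integral_lebesgue_on_borel[OF K(1) borel_measurable_continuous_onI[OF cont(1)]]) blast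
  moreover have "(\<integral>x. ?g x \<partial>lebesgue_on K) = (\<integral>x. ?g x \<partial>lborel)"
    using z C(2) by (intro integral_lebesgue_on_borel[OF K(1) borel_measurable_continuous_onI[OF cont(2)]]) blast
  ultimately show "(\<integral>x. ?f x \<partial>lebesgue_on K) = - (\<integral>x. ?g x \<partial>lebesgue_on K)" by simp
qed

lemma AE_zero_of_box_integrals:
  fixes g :: "'a::euclidean_space \<Rightarrow> real"
  assumes g: "integrable lborel g" and z: "\<And>a b. (\<integral>x. indicator (box a b) x * g x \<partial>lborel) = 0"
  shows "AE x in lborel. g x = 0"
proof -
  have [measurable]: "g \<in> borel_measurable borel" using borel_measurable_integrable[OF g] by simp
  let ?p = "\<lambda>x. ennreal (g x)" and ?m = "\<lambda>x. ennreal (- g x)"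
  have fin: "(\<integral>\<^sup>+x. ?p x \<partial>lborel) < \<infinity>" "(\<integral>\<^sup>+x. ?m x \<partial>lborel) < \<infinity>"
    using g by (auto simp: real_integrable_def less_top)
  have eq: "emeasure (density lborel ?p) (box a b) = emeasure (density lborel ?m) (box a b)" for a b :: 'a
  proof -
    let ?h = "\<lambda>x. indicator (box a b) x * g x"
    have hi: "integrable lborel ?h"
      using integrable_mult_indicator[OF _ g, of "box a b"] by simp
    have e1: "(\<integral>\<^sup>+x. ennreal (?h x) \<partial>lborel) = (\<integral>\<^sup>+x. ?p x * indicator (box a b) x \<partial>lborel)"
      by (intro nn_integral_cong) (auto simp: indicator_def)
    have e2: "(\<integral>\<^sup>+x. ennreal (- ?h x) \<partial>lborel) = (\<integral>\<^sup>+x. ?m x * indicator (box a b) x \<partial>lborel)"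
      by (intro nn_integral_cong) (auto simp: indicator_def)
    have "enn2real (\<integral>\<^sup>+x. ennreal (?h x) \<partial>lborel) = enn2real (\<integral>\<^sup>+x. ennreal (- ?h x) \<partial>lborel)"
      using z[of a b] real_lebesgue_integral_def[OF hi] by simp
    moreover have "(\<integral>\<^sup>+x. ennreal (?h x) \<partial>lborel) < \<infinity>" "(\<integral>\<^sup>+x. ennreal (- ?h x) \<partial>lborel) < \<infinity>"
      using hi by (auto simp: real_integrable_def less_top)
    ultimately have "(\<integral>\<^sup>+x. ennreal (?h x) \<partial>lborel) = (\<integral>\<^sup>+x. ennreal (- ?h x) \<partial>lborel)"
      by (metis ennreal_enn2real infinity_ennreal_def)
    then show ?thesis by (simp add: emeasure_density e1 e2)
  qed
  have "density lborel ?p = density lborel ?m"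
  proof (rule measure_eqI_generator_eq)
    let ?E = "range (\<lambda>(a, b). box a b :: 'a set)"
    show "Int_stable ?E"
      by (auto simp: Int_stable_def box_Int_box)
    show "emeasure (density lborel ?p) X = emeasure (density lborel ?m) X" if "X \<in> ?E" for X
      using that eq by auto
    show "sets (density lborel ?p) = sigma_sets UNIV ?E" "sets (density lborel ?m) = sigma_sets UNIV ?E"
      by (simp_all add: borel_eq_box)
    let ?A = "\<lambda>n::nat. box (- (real n *\<^sub>R One)) (real n *\<^sub>R One) :: 'a set"
    show "range ?A \<subseteq> ?E" "(\<Union>i. ?A i) = UNIV"
      unfolding UN_box_eq_UNIV by auto
    show "emeasure (density lborel ?p) (?A i) \<noteq> \<infinity>" for i
    proof -
      have "emeasure (density lborel ?p) (?A i) \<le> (\<integral>\<^sup>+x. ?p x \<partial>lborel)"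
        by (subst emeasure_density) (auto intro!: nn_integral_mono simp: indicator_def)
      then show ?thesis using fin(1) by (auto simp: top_unique)
    qed
  qed auto
  then have "AE x in lborel. ?p x = ?m x"
    by (subst (asm) sigma_finite_measure.density_unique_iff[OF sigma_finite_lborel]) auto
  then show ?thesis
  proof eventually_elim
    case (elim x)
    then show ?case by (cases "0 \<le> g x") (auto simp: ennreal_neg ennreal_eq_0_iff)
  qed
qed

text \<open>
  The functions \<open>k m / (1 + k m)\<close>, where \<open>m\<close> is a \<open>C\<^sup>1\<close> function positive exactly on an open box,
  increase to the indicator function of the box.
\<close>

lemma box_indicator_limit:
  fixes a b :: "real^'n"
  shows "\<exists>\<phi> :: nat \<Rightarrow> real^'n \<Rightarrow> real. \<forall>k. C1 (\<phi> k) \<and>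
    (\<forall>x. (x \<notin> box a b \<longrightarrow> \<phi> k x = 0) \<and> \<bar>\<phi> k x\<bar> \<le> 1 \<and> (\<lambda>k. \<phi> k x) \<longlonglongrightarrow> indicator (box a b) x)"
proof -
  define m where "m x = (\<Prod>i\<in>UNIV. (max 0 (x $ i - a $ i))\<^sup>2 * (max 0 (b $ i - x $ i))\<^sup>2)" for x :: "real^'n"
  have m0: "0 \<le> m x" for x unfolding m_def by (intro prod_nonneg) auto
  have lin: "C1 (\<lambda>x::real^'n. x $ i - c)" "C1 (\<lambda>x::real^'n. c - x $ i)" for i c
    by (rule C1I, auto intro!: derivative_eq_intros bounded_linear.has_derivative[OF bounded_linear_vec_nth])+
  have mC: "C1 m"
    unfolding m_def[abs_def]
    by (intro C1_prod C1_mult C1_compose_real[OF has_field_derivative_max_0_sqr] lin continuous_intros)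
  define \<phi> where "\<phi> k x = 1 + (-1) * inverse (1 + real k * m x)" for k x
  have pos: "0 < 1 + real k * m x" for k x using m0[of x] by (simp add: add_pos_nonneg)
  have 1: "C1 (\<phi> k)" for k
    unfolding \<phi>_def[abs_def] using pos
    by (intro C1_add C1_mult C1_const C1_inverse mC) (metis less_irrefl)
  have 2: "\<phi> k x = 0" if x: "x \<notin> box a b" for k x
  proof -
    obtain i where "x $ i \<le> a $ i \<or> b $ i \<le> x $ i"
      using x by (auto simp: mem_box_cart not_less)
    then have "m x = 0" unfolding m_def by (intro prod_zero) (auto intro!: exI[of _ i])
    then show ?thesis by (simp add: \<phi>_def)
  qed
  have 3: "\<bar>\<phi> k x\<bar> \<le> 1" for k x
  proof -
    have "0 < inverse (1 + real k * m x)" using pos by simp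
    moreover have "inverse (1 + real k * m x) \<le> 1"
      using m0[of x] by (intro inverse_le_1_iff[THEN iffD2] disjI2) simp
    ultimately show ?thesis by (simp add: \<phi>_def)
  qed
  have 4: "(\<lambda>k. \<phi> k x) \<longlonglongrightarrow> indicator (box a b) x" for x
  proof (cases "x \<in> box a b")
    case True
    then have "0 < m x" unfolding m_def by (intro prod_pos) (auto simp: mem_box_cart intro!: mult_pos_pos zero_less_power)
    then have "filterlim (\<lambda>k. 1 + real k * m x) at_top sequentially"
      by (intro filterlim_tendsto_add_at_top[OF tendsto_const]
          filterlim_at_top_mult_tendsto_pos[OF tendsto_const _ filterlim_real_sequentially])
    then have "(\<lambda>k. inverse (1 + real k * m x)) \<longlonglongrightarrow> 0"
      by (rule tendsto_inverse_0_at_top)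
    then have "(\<lambda>k. \<phi> k x) \<longlonglongrightarrow> 1 + (-1) * 0"
      unfolding \<phi>_def by (intro tendsto_intros)
    then show ?thesis using True by simp
  next
    case False
    then show ?thesis by (simp add: 2)
  qed
  show ?thesis using 1 2 3 4 by (intro exI[of _ \<phi>]) simp
qed

lemma fundamental_lemma:
  fixes f :: "real^'n \<Rightarrow> real"
  assumes K: "open K" and f: "integrable (lebesgue_on K) f"
    and z: "\<And>\<phi>. test_function K \<phi> \<Longrightarrow> (\<integral>x. f x * \<phi> x \<partial>lebesgue_on K) = 0"
  shows "AE x in lebesgue_on K. f x = 0"
proof -
  have Ks: "K \<in> sets lebesgue" using K by auto
  have F: "integrable lebesgue (\<lambda>x. indicator K x *\<^sub>R f x)"
    using f Ks by (subst (asm) integrable_restrict_space) auto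
  then obtain g where gm: "g \<in> borel_measurable lborel" and g: "AE x in lborel. indicator K x *\<^sub>R f x = g x"
    using completion_ex_borel_measurable_real[OF borel_measurable_integrable[OF F]] by blast
  have [measurable]: "g \<in> borel_measurable borel" using gm by simp
  have g': "AE x in lebesgue. indicator K x *\<^sub>R f x = g x" using g by (rule AE_completion)
  have gi: "integrable lborel g"
  proof -
    have "integrable lebesgue g"
      using g' by (intro integrable_cong_AE_imp[OF F]) (auto intro: measurable_completion elim: eventually_mono)
    then show ?thesis by (simp add: integrable_completion)
  qed
  have key: "AE x in lborel. indicator (cbox a b) x * g x = 0" if sub: "cbox a b \<subseteq> K" for a b
  proof (rule AE_zero_of_box_integrals)
    show "integrable lborel (\<lambda>x. indicator (cbox a b) x * g x)"
      using integrable_mult_indicator[OF _ gi, of "cbox a b"] by simp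
    fix c d :: "real^'n"
    obtain a' b' where ab': "box a b \<inter> box c d = box a' b'"
      by (rule that) (rule box_Int_box)
    obtain \<phi> :: "nat \<Rightarrow> real^'n \<Rightarrow> real" where \<phi>': "\<forall>k. C1 (\<phi> k) \<and>
      (\<forall>x. (x \<notin> box a' b' \<longrightarrow> \<phi> k x = 0) \<and> \<bar>\<phi> k x\<bar> \<le> 1 \<and> (\<lambda>k. \<phi> k x) \<longlonglongrightarrow> indicator (box a' b') x)"
      using box_indicator_limit[of a' b'] ..
    have \<phi>: "C1 (\<phi> k)" "x \<notin> box a' b' \<Longrightarrow> \<phi> k x = 0" "\<bar>\<phi> k x\<bar> \<le> 1"
      "(\<lambda>k. \<phi> k x) \<longlonglongrightarrow> indicator (box a' b') x" for k x
      using \<phi>' by simp_all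
    have [measurable]: "\<phi> k \<in> borel_measurable borel" for k
      using C1_continuous[OF \<phi>(1)] by (rule borel_measurable_continuous_onI)
    have zk: "(\<integral>x. \<phi> k x * g x \<partial>lborel) = 0" for k
    proof -
      have "\<phi> k x = 0" if "x \<notin> cbox a b" for x
        using \<phi>(2)[of x k] that ab' box_subset_cbox by blast
      then have "test_function K (\<phi> k)"
        unfolding test_function_def using \<phi>(1) sub by (auto intro!: exI[of _ "cbox a b"])
      then have "(\<integral>x. f x * \<phi> k x \<partial>lebesgue_on K) = 0" by (rule z)
      then have "(\<integral>x. indicator K x *\<^sub>R (f x * \<phi> k x) \<partial>lebesgue) = 0"
        using Ks by (subst (asm) integral_restrict_space) auto
      also have "(\<integral>x. indicator K x *\<^sub>R (f x * \<phi> k x) \<partial>lebesgue) = (\<integral>x. \<phi> k x * g x \<partial>lebesgue)"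
      proof (rule integral_cong_AE)
        have m: "(\<lambda>x. indicator K x *\<^sub>R f x) \<in> borel_measurable lebesgue" "\<phi> k \<in> borel_measurable lebesgue"
          using F by (auto intro: measurable_completion)
        show "(\<lambda>x. indicator K x *\<^sub>R (f x * \<phi> k x)) \<in> borel_measurable lebesgue"
          using borel_measurable_times[OF m] by (simp add: mult.assoc)
        show "AE x in lebesgue. indicator K x *\<^sub>R (f x * \<phi> k x) = \<phi> k x * g x"
          using g' by eventually_elim (metis mult.commute mult_scaleR_left)
      qed (intro measurable_completion, measurable)
      finally show ?thesis by (subst (asm) integral_completion) auto
    qed
    have "(\<lambda>k. \<integral>x. \<phi> k x * g x \<partial>lborel) \<longlonglongrightarrow> (\<integral>x. indicator (box a' b') x * g x \<partial>lborel)"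
    proof (rule integral_dominated_convergence[of _ _ _ "\<lambda>x. \<bar>g x\<bar>"])
      show "AE x in lborel. (\<lambda>k. \<phi> k x * g x) \<longlonglongrightarrow> indicator (box a' b') x * g x"
        using \<phi>(4) by (intro AE_I2 tendsto_mult tendsto_const)
      show "AE x in lborel. norm (\<phi> k x * g x) \<le> \<bar>g x\<bar>" for k
        using \<phi>(3) by (intro AE_I2) (auto simp: abs_mult intro: mult_left_le_one_le)
    qed (use gi in auto)
    then have "(\<lambda>k. 0) \<longlonglongrightarrow> (\<integral>x. indicator (box a' b') x * g x \<partial>lborel)"
      by (simp only: zk)
    then have "(\<integral>x. indicator (box a' b') x * g x \<partial>lborel) = 0"
      using LIMSEQ_unique[OF _ tendsto_const] by blast
    moreover have "AE x in lborel. x \<notin> cbox a b - box a b"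
      using AE_not_in[of "cbox a b - box a b" lborel] emeasure_lborel_cbox_eq[of a b]
        emeasure_lborel_box_eq[of a b] by (simp add: null_sets_def emeasure_Diff box_subset_cbox)
    then have "(\<integral>x. indicator (box c d) x * (indicator (cbox a b) x * g x) \<partial>lborel)
        = (\<integral>x. indicator (box a' b') x * g x \<partial>lborel)"
      by (intro integral_cong_AE, measurable)
        (use box_subset_cbox[of a b] in \<open>auto elim!: eventually_mono simp: indicator_def simp flip: ab'\<close>)
    ultimately show "(\<integral>x. indicator (box c d) x * (indicator (cbox a b) x * g x) \<partial>lborel) = 0"
      by simp
  qed
  obtain \<D> where D: "countable \<D>" "\<D> \<subseteq> Pow K" "\<And>X. X \<in> \<D> \<Longrightarrow> \<exists>a b. X = cbox a b" "\<Union>\<D> = K"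
    using open_countable_Union_open_cbox[OF K] by metis
  have "AE x in lborel. \<forall>X\<in>\<D>. indicator X x * g x = 0"
    using D key by (intro AE_ball_countable[THEN iffD2]) (metis PowD subsetD)+
  then have "AE x in lborel. x \<in> K \<longrightarrow> f x = 0"
    using g by eventually_elim (use D(4) in \<open>force simp: indicator_def\<close>)
  then have "AE x in lebesgue. x \<in> K \<longrightarrow> f x = 0" by (rule AE_completion)
  then show ?thesis using Ks by (subst AE_restrict_space_iff) auto
qed


section \<open>The trace inequality\<close>

definition plane_proj :: "'a::real_inner \<Rightarrow> real \<Rightarrow> 'a \<Rightarrow> 'a" where
  "plane_proj \<nu> b z = z - (z \<bullet> \<nu> - b) *\<^sub>R \<nu>"

lemma plane_proj_borel [measurable]: "plane_proj \<nu> b \<in> borel_measurable (borel :: 'a::euclidean_space measure)"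
  unfolding plane_proj_def[abs_def] by measurable

lemma plane_proj_prism:
  assumes "norm \<nu> = 1" "y \<bullet> \<nu> = b"
  shows "plane_proj \<nu> b (y + t *\<^sub>R \<nu>) = y" "(y + t *\<^sub>R \<nu>) \<bullet> \<nu> - b = t"
proof -
  have "\<nu> \<bullet> \<nu> = 1" using assms(1) by (simp add: norm_eq_1)
  then show "(y + t *\<^sub>R \<nu>) \<bullet> \<nu> - b = t" using assms(2) by (simp add: inner_add_left)
  then show "plane_proj \<nu> b (y + t *\<^sub>R \<nu>) = y" by (simp add: plane_proj_def)
qed

lemma plane_proj_mem:
  assumes "norm \<nu> = 1"
  shows "plane_proj \<nu> b z \<bullet> \<nu> = b"
proof -
  have "\<nu> \<bullet> \<nu> = 1" using assms(1) by (simp add: norm_eq_1)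
  then show ?thesis by (simp add: plane_proj_def inner_diff_left)
qed

lemma facetD:
  assumes "x \<in> facet K \<nu> b"
  shows "norm \<nu> = 1" "x \<bullet> \<nu> = b"
  using assms by (simp_all add: facet_def outward_normal_at_def)

lemma facet_halfball:
  assumes "x \<in> facet K \<nu> b"
  shows "\<exists>r>0. K \<inter> ball x r = {y \<in> ball x r. y \<bullet> \<nu> < x \<bullet> \<nu>}"
  using assms unfolding facet_def outward_normal_at_def by (elim CollectE conjE)

lemma facet_borel: "facet K \<nu> b \<in> sets borel"
proof -
  define U where "U = \<Union>{ball x (r/2) | x r. r > 0 \<and> x \<bullet> \<nu> = b \<and> K \<inter> ball x r = {y \<in> ball x r. y \<bullet> \<nu> < x \<bullet> \<nu>}}"
  have "open U" unfolding U_def by auto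
  have "facet K \<nu> b = (if norm \<nu> = 1 then {x. x \<bullet> \<nu> = b} \<inter> U else {})"
  proof (cases "norm \<nu> = 1")
    case True
    have "x' \<in> facet K \<nu> b" if "x' \<bullet> \<nu> = b" "r > 0" "x \<bullet> \<nu> = b" "x' \<in> ball x (r/2)"
      and eq: "K \<inter> ball x r = {y \<in> ball x r. y \<bullet> \<nu> < x \<bullet> \<nu>}" for x x' r
    proof -
      have sub: "ball x' (r/2) \<subseteq> ball x r"
      proof
        fix y assume "y \<in> ball x' (r/2)"
        with that(4) show "y \<in> ball x r"
          using dist_triangle[of x y x'] by (auto simp: dist_commute)
      qed
      have "y \<in> K \<longleftrightarrow> y \<bullet> \<nu> < x' \<bullet> \<nu>" if "y \<in> ball x' (r/2)" for y
      proof -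
        have "y \<in> ball x r" using that sub by (rule rev_subsetD)
        then have "y \<in> K \<longleftrightarrow> y \<in> K \<inter> ball x r" by (simp only: Int_iff simp_thms)
        also have "\<dots> \<longleftrightarrow> y \<bullet> \<nu> < x \<bullet> \<nu>"
          using \<open>y \<in> ball x r\<close> by (simp only: eq mem_Collect_eq simp_thms)
        finally show ?thesis by (simp only: \<open>x \<bullet> \<nu> = b\<close> \<open>x' \<bullet> \<nu> = b\<close>)
      qed
      then have "K \<inter> ball x' (r/2) = {y \<in> ball x' (r/2). y \<bullet> \<nu> < x' \<bullet> \<nu>}"
        by (intro set_eqI) (simp only: Int_iff mem_Collect_eq, meson)
      moreover have "0 < r/2" using \<open>r > 0\<close> by simp
      ultimately have "outward_normal_at K x' \<nu>"
        unfolding outward_normal_at_def using True by (intro conjI exI[of _ "r/2"])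
      then show ?thesis using \<open>x' \<bullet> \<nu> = b\<close> by (simp add: facet_def)
    qed
    then have "{x. x \<bullet> \<nu> = b} \<inter> U \<subseteq> facet K \<nu> b"
      unfolding U_def by (intro subsetI) (elim IntE UnionE CollectE exE conjE, simp)
    moreover have "x \<in> U" if x: "x \<in> facet K \<nu> b" for x
    proof -
      obtain r where r: "r > 0" "K \<inter> ball x r = {y \<in> ball x r. y \<bullet> \<nu> < x \<bullet> \<nu>}"
        using facet_halfball[OF x] by blast
      have "x \<in> ball x (r/2)" using r(1) by simp
      then show ?thesis
        unfolding U_def using r facetD(2)[OF x] by (intro UnionI[of "ball x (r/2)"] CollectI exI[of _ x] exI[of _ r] conjI) auto
    qed
    ultimately show ?thesis using True facetD(2) by auto
  next
    case False
    then show ?thesis using facetD(1) by auto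
  qed
  moreover have "{x. x \<bullet> \<nu> = b} \<in> sets borel" by measurable
  ultimately show ?thesis using \<open>open U\<close> by auto
qed

definition facet_weight :: "(real^'n) set \<Rightarrow> real^'n \<Rightarrow> real \<Rightarrow> real^'n \<Rightarrow> ennreal" where
  "facet_weight K \<nu> b z = indicator {0..1} (z \<bullet> \<nu> - b) * indicator (facet K \<nu> b) (plane_proj \<nu> b z)"

lemma facet_weight_borel [measurable]: "facet_weight K \<nu> b \<in> borel_measurable borel"
  unfolding facet_weight_def[abs_def] using facet_borel[of K \<nu> b] by measurable

definition facet_measure :: "(real^'n) set \<Rightarrow> real^'n \<Rightarrow> real \<Rightarrow> (real^'n) measure" where
  "facet_measure K \<nu> b = distr (density lborel (facet_weight K \<nu> b)) borel (plane_proj \<nu> b)"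

lemma sets_facet_measure [simp]: "sets (facet_measure K \<nu> b) = sets borel"
  by (simp add: facet_measure_def)

lemma nn_integral_facet_measure:
  assumes [measurable]: "f \<in> borel_measurable borel"
  shows "(\<integral>\<^sup>+x. f x \<partial>facet_measure K \<nu> b) = (\<integral>\<^sup>+z. facet_weight K \<nu> b z * f (plane_proj \<nu> b z) \<partial>lborel)"
  unfolding facet_measure_def by (simp add: nn_integral_distr nn_integral_density)

lemma emeasure_facet_measure:
  assumes [measurable]: "A \<in> sets borel" and ne: "facet K \<nu> b \<noteq> {}"
  shows "emeasure (facet_measure K \<nu> b) A =
    emeasure lborel {y + t *\<^sub>R \<nu> | y t. y \<in> A \<inter> facet K \<nu> b \<and> t \<in> {0..1}}"
proof -
  let ?Q = "{y + t *\<^sub>R \<nu> | y t. y \<in> A \<inter> facet K \<nu> b \<and> t \<in> {0..1}}"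
  have \<nu>: "norm \<nu> = 1" using ne facetD(1) by blast
  have Q: "z \<in> ?Q \<longleftrightarrow> 0 \<le> z \<bullet> \<nu> - b \<and> z \<bullet> \<nu> - b \<le> 1 \<and> plane_proj \<nu> b z \<in> A \<inter> facet K \<nu> b" for z
  proof
    assume "z \<in> ?Q"
    then obtain y t where z: "z = y + t *\<^sub>R \<nu>" "y \<in> A" "y \<in> facet K \<nu> b" "0 \<le> t" "t \<le> 1" by auto
    have y: "y \<bullet> \<nu> = b" using z(3) by (simp add: facet_def)
    show "0 \<le> z \<bullet> \<nu> - b \<and> z \<bullet> \<nu> - b \<le> 1 \<and> plane_proj \<nu> b z \<in> A \<inter> facet K \<nu> b"
      unfolding z(1) plane_proj_prism[OF \<nu> y] using z by simp
  next
    assume z: "0 \<le> z \<bullet> \<nu> - b \<and> z \<bullet> \<nu> - b \<le> 1 \<and> plane_proj \<nu> b z \<in> A \<inter> facet K \<nu> b"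
    have "z = plane_proj \<nu> b z + (z \<bullet> \<nu> - b) *\<^sub>R \<nu>" by (simp add: plane_proj_def)
    with z show "z \<in> ?Q" by (intro CollectI exI[of _ "plane_proj \<nu> b z"] exI[of _ "z \<bullet> \<nu> - b"]) simp
  qed
  have [measurable]: "facet K \<nu> b \<in> sets borel" by (rule facet_borel)
  have Qb: "?Q \<in> sets borel"
  proof -
    have "?Q = {z. 0 \<le> z \<bullet> \<nu> - b \<and> z \<bullet> \<nu> - b \<le> 1 \<and> plane_proj \<nu> b z \<in> A \<inter> facet K \<nu> b}"
      using Q by blast
    also have "\<dots> \<in> sets borel" by measurable
    finally show ?thesis .
  qed
  have "emeasure (facet_measure K \<nu> b) A = (\<integral>\<^sup>+x. indicator A x \<partial>facet_measure K \<nu> b)"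
    by (simp add: nn_integral_indicator)
  also have "\<dots> = (\<integral>\<^sup>+z. facet_weight K \<nu> b z * indicator A (plane_proj \<nu> b z) \<partial>lborel)"
    by (rule nn_integral_facet_measure) simp
  also have "\<dots> = (\<integral>\<^sup>+z. indicator ?Q z \<partial>lborel)"
    by (rule nn_integral_cong) (use Q in \<open>auto simp: facet_weight_def indicator_def\<close>)
  also have "\<dots> = emeasure lborel ?Q" using Qb by simp
  finally show ?thesis .
qed

lemma space_surface_measure [simp]: "space (surface_measure K) = UNIV"
  by (simp add: surface_measure_def space_measure_of_conv)

lemma sets_surface_measure [simp, measurable_cong]: "sets (surface_measure K) = sets borel"
  unfolding surface_measure_def using sets.sigma_sets_eq[of borel] by (simp add: sets_measure_of_conv)

lemma emeasure_surface_measure: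
  fixes K :: "(real^'n) set"
  assumes "A \<in> sets borel"
  shows "emeasure (surface_measure K) A =
    (\<Sum>(\<nu>, b) \<in> {(\<nu>, b). facet K \<nu> b \<noteq> {}}. emeasure (facet_measure K \<nu> b) A)"
proof -
  let ?I = "{(\<nu>, b). facet K \<nu> b \<noteq> {}}"
  let ?m = "\<lambda>A. \<Sum>(\<nu>, b) \<in> ?I. emeasure lborel {y + t *\<^sub>R \<nu> | y t. y \<in> A \<inter> facet K \<nu> b \<and> t \<in> {0..1}}"
  have m: "?m A = (\<Sum>i\<in>?I. emeasure (facet_measure K (fst i) (snd i)) A)" if "A \<in> sets borel" for A
  proof (intro sum.cong refl)
    fix i assume "i \<in> ?I"
    then show "(case i of (\<nu>, b) \<Rightarrow> emeasure lborel {y + t *\<^sub>R \<nu> | y t. y \<in> A \<inter> facet K \<nu> b \<and> t \<in> {0..1}})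
        = emeasure (facet_measure K (fst i) (snd i)) A"
      using emeasure_facet_measure[OF that, of K "fst i" "snd i"] by (simp add: case_prod_unfold)
  qed
  have "countably_additive (sets borel) ?m"
  proof (rule countably_additiveI)
    fix A :: "nat \<Rightarrow> (real^'n) set"
    assume A: "range A \<subseteq> sets borel" "disjoint_family A" "(\<Union>i. A i) \<in> sets borel"
    have "(\<Sum>n. ?m (A n)) = (\<Sum>n. \<Sum>i\<in>?I. emeasure (facet_measure K (fst i) (snd i)) (A n))"
      using A(1) by (intro suminf_cong m) auto
    also have "\<dots> = (\<Sum>i\<in>?I. \<Sum>n. emeasure (facet_measure K (fst i) (snd i)) (A n))"
      by (rule suminf_sum) simp
    also have "\<dots> = (\<Sum>i\<in>?I. emeasure (facet_measure K (fst i) (snd i)) (\<Union>n. A n))"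
      using A by (intro sum.cong suminf_emeasure) auto
    also have "\<dots> = ?m (\<Union>n. A n)" using m[OF A(3)] by simp
    finally show "(\<Sum>n. ?m (A n)) = ?m (\<Union>n. A n)" .
  qed
  moreover have "positive (sets borel) ?m"
    unfolding positive_def using m[of "{}"] by simp
  moreover have "sigma_algebra UNIV (sets (borel :: (real^'n) measure))"
    using sets.sigma_algebra_axioms[of "borel :: (real^'n) measure"] by simp
  ultimately have "emeasure (surface_measure K) A = ?m A"
    unfolding surface_measure_def using assms by (intro emeasure_measure_of_sigma)
  then show ?thesis using m[OF assms] by (simp add: case_prod_unfold)
qed

lemma nn_integral_surface_measure:
  fixes f :: "real^'n \<Rightarrow> ennreal"
  assumes "f \<in> borel_measurable borel"
  shows "(\<integral>\<^sup>+x. f x \<partial>surface_measure K) =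
    (\<Sum>i \<in> {(\<nu>, b). facet K \<nu> b \<noteq> {}}. \<integral>\<^sup>+x. f x \<partial>facet_measure K (fst i) (snd i))"
  using assms
proof (induction f rule: borel_measurable_induct)
  case (cong f g)
  then show ?case by simp
next
  case (set A)
  then show ?case by (simp add: emeasure_surface_measure case_prod_unfold)
next
  case (mult u c)
  then show ?case by (simp add: nn_integral_cmult measurable_def sum_distrib_left)
next
  case (add u v)
  then show ?case by (simp add: nn_integral_add measurable_def sum.distrib)
next
  case (seq U)
  have m: "U i \<in> borel_measurable (facet_measure K \<nu> b)" "U i \<in> borel_measurable (surface_measure K)" for i \<nu> b
    using seq(1)[of i] by (simp_all cong: measurable_cong_sets)
  have inc: "incseq (\<lambda>n. \<integral>\<^sup>+x. U n x \<partial>\<mu>)" for \<mu> :: "(real^'n) measure"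
    using seq by (auto simp: incseq_def le_fun_def intro!: nn_integral_mono)
  have mc: "(\<integral>\<^sup>+x. (SUP i. U i) x \<partial>\<mu>) = (SUP i. \<integral>\<^sup>+x. U i x \<partial>\<mu>)"
    if "\<And>i. U i \<in> borel_measurable \<mu>" for \<mu> :: "(real^'n) measure"
    unfolding SUP_apply using seq(3) that by (rule nn_integral_monotone_convergence_SUP)
  show ?case
    unfolding mc[OF m(1)] mc[OF m(2)] seq.IH
    by (rule ennreal_SUP_sum) (rule inc)
qed

lemma nn_integral_lborel_translate:
  fixes f :: "'a::euclidean_space \<Rightarrow> ennreal"
  assumes [measurable]: "f \<in> borel_measurable borel"
  shows "(\<integral>\<^sup>+x. f (c + x) \<partial>lborel) = (\<integral>\<^sup>+x. f x \<partial>lborel)"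
  using nn_integral_distr[of "(+) c" lborel borel f] by (simp add: lborel_distr_plus)

text \<open>
  The substitution \<open>(z, s) \<mapsto> (plane_proj z + s d, z \<bullet> \<nu> - b)\<close> is a composition of shears and one
  scaling of the line.
\<close>

lemma nn_integral_prism:
  fixes f :: "(real^'n) \<times> real \<Rightarrow> ennreal"
  assumes f [measurable]: "f \<in> borel_measurable borel" and d: "d \<bullet> \<nu> \<noteq> 0"
  shows "(\<integral>\<^sup>+z. \<integral>\<^sup>+s. f (plane_proj \<nu> b z + s *\<^sub>R d, z \<bullet> \<nu> - b) \<partial>lborel \<partial>lborel) =
    ennreal (1 / \<bar>d \<bullet> \<nu>\<bar>) * (\<integral>\<^sup>+z. \<integral>\<^sup>+r. f (z, r) \<partial>lborel \<partial>lborel)"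
proof -
  define \<kappa> where "\<kappa> = d \<bullet> \<nu>"
  have [measurable]: "f \<in> borel_measurable (borel \<Otimes>\<^sub>M borel)"
    using f by (simp add: borel_prod)
  define F where "F s z = f (z - (z \<bullet> \<nu> - b - \<kappa> * s) *\<^sub>R \<nu>, z \<bullet> \<nu> - b - \<kappa> * s)" for s z
  have Fub: "(\<integral>\<^sup>+z. \<integral>\<^sup>+s. g z s \<partial>lborel \<partial>lborel) = (\<integral>\<^sup>+s. \<integral>\<^sup>+z. g z s \<partial>lborel \<partial>lborel)"
    if "(\<lambda>(z, s). g z s) \<in> borel_measurable (borel \<Otimes>\<^sub>M borel)" for g :: "real^'n \<Rightarrow> real \<Rightarrow> ennreal"
    using lborel_pair.Fubini'[of g] that by (simp cong: measurable_cong_sets)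
  have "(\<integral>\<^sup>+z. \<integral>\<^sup>+s. f (plane_proj \<nu> b z + s *\<^sub>R d, z \<bullet> \<nu> - b) \<partial>lborel \<partial>lborel) =
      (\<integral>\<^sup>+s. \<integral>\<^sup>+z. f (plane_proj \<nu> b z + s *\<^sub>R d, z \<bullet> \<nu> - b) \<partial>lborel \<partial>lborel)"
    by (rule Fub) measurable
  also have "\<dots> = (\<integral>\<^sup>+s. \<integral>\<^sup>+z. F s (s *\<^sub>R d + z) \<partial>lborel \<partial>lborel)"
    by (simp add: F_def plane_proj_def \<kappa>_def inner_add_left algebra_simps)
  also have "\<dots> = (\<integral>\<^sup>+s. \<integral>\<^sup>+z. F s z \<partial>lborel \<partial>lborel)"
    by (intro nn_integral_cong nn_integral_lborel_translate) (unfold F_def, measurable)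
  also have "\<dots> = (\<integral>\<^sup>+z. \<integral>\<^sup>+s. F s z \<partial>lborel \<partial>lborel)"
    by (rule Fub[symmetric]) (unfold F_def, measurable)
  also have "\<dots> = (\<integral>\<^sup>+z. ennreal (1 / \<bar>\<kappa>\<bar>) * (\<integral>\<^sup>+r. f (z - r *\<^sub>R \<nu>, r) \<partial>lborel) \<partial>lborel)"
  proof (rule nn_integral_cong)
    fix z :: "real^'n"
    have "(\<integral>\<^sup>+r. f (z - r *\<^sub>R \<nu>, r) \<partial>lborel) = ennreal \<bar>\<kappa>\<bar> * (\<integral>\<^sup>+s. F s z \<partial>lborel)"
      using nn_integral_real_affine[of "\<lambda>r. f (z - r *\<^sub>R \<nu>, r)" "- \<kappa>" "z \<bullet> \<nu> - b"] d
      by (simp add: F_def \<kappa>_def)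
    then have "ennreal (1 / \<bar>\<kappa>\<bar>) * (\<integral>\<^sup>+r. f (z - r *\<^sub>R \<nu>, r) \<partial>lborel)
        = (ennreal (1 / \<bar>\<kappa>\<bar>) * ennreal \<bar>\<kappa>\<bar>) * (\<integral>\<^sup>+s. F s z \<partial>lborel)"
      by (simp add: mult.assoc)
    also have "ennreal (1 / \<bar>\<kappa>\<bar>) * ennreal \<bar>\<kappa>\<bar> = 1"
      using d by (simp add: \<kappa>_def flip: ennreal_mult)
    finally show "(\<integral>\<^sup>+s. F s z \<partial>lborel) = ennreal (1 / \<bar>\<kappa>\<bar>) * (\<integral>\<^sup>+r. f (z - r *\<^sub>R \<nu>, r) \<partial>lborel)"
      by simp
  qed
  also have "\<dots> = ennreal (1 / \<bar>\<kappa>\<bar>) * (\<integral>\<^sup>+z. \<integral>\<^sup>+r. f (z - r *\<^sub>R \<nu>, r) \<partial>lborel \<partial>lborel)"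
    by (rule nn_integral_cmult) measurable
  also have "(\<integral>\<^sup>+z. \<integral>\<^sup>+r. f (z - r *\<^sub>R \<nu>, r) \<partial>lborel \<partial>lborel) = (\<integral>\<^sup>+r. \<integral>\<^sup>+z. f (z - r *\<^sub>R \<nu>, r) \<partial>lborel \<partial>lborel)"
    by (rule Fub) measurable
  also have "\<dots> = (\<integral>\<^sup>+r. \<integral>\<^sup>+z. f (z, r) \<partial>lborel \<partial>lborel)"
  proof (rule nn_integral_cong)
    fix r :: real
    show "(\<integral>\<^sup>+z. f (z - r *\<^sub>R \<nu>, r) \<partial>lborel) = (\<integral>\<^sup>+z. f (z, r) \<partial>lborel)"
      using nn_integral_lborel_translate[of "\<lambda>z. f (z, r)" "- (r *\<^sub>R \<nu>)"] by simp
  qed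
  also have "\<dots> = (\<integral>\<^sup>+z. \<integral>\<^sup>+r. f (z, r) \<partial>lborel \<partial>lborel)"
    by (rule Fub[symmetric]) measurable
  finally show ?thesis by (simp add: \<kappa>_def)
qed

lemma norm_matrix_vector_le: "norm (A *v x) \<le> norm A * norm x" for A :: "real^'n^'m"
proof -
  have "norm (A *v x) = L2_set (\<lambda>i. norm ((A *v x) $ i)) UNIV" by (simp add: norm_vec_def)
  also have "\<dots> \<le> L2_set (\<lambda>i. norm (A $ i) * norm x) UNIV"
    by (intro L2_set_mono) (auto simp: matrix_vector_mul_component Cauchy_Schwarz_ineq2)
  also have "\<dots> = norm A * norm x" by (simp add: norm_vec_def flip: L2_set_left_distrib)
  finally show ?thesis .
qed

lemma grad_matrix_apply:
  assumes "C1 u"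
  shows "frechet_derivative u (at x) h = grad_matrix u x *v h"
proof -
  have "Vector_Spaces.linear (*s) (*s) (frechet_derivative u (at x))"
    using has_derivative_linear[OF C1_has_derivative[OF assms]] by (simp add: linear_matrix_vector_mul_eq)
  then show ?thesis using matrix_works[of "frechet_derivative u (at x)" h]
    by (simp add: grad_matrix_def matrix_def)
qed

text \<open>Integrate the derivative of \<open>(1 - s) |u (y + s d)|\<^sup>2\<close>.\<close>

lemma C1_norm_sqr_le_line_integral:
  fixes u :: "real^'n \<Rightarrow> real^'n"
  assumes u: "C1 u"
  shows "ennreal ((norm (u y))\<^sup>2) \<le> (\<integral>\<^sup>+s. indicator {0..1} s *
    ennreal (2 * (norm (u (y + s *\<^sub>R d)))\<^sup>2 + (norm d)\<^sup>2 * (norm (grad_matrix u (y + s *\<^sub>R d)))\<^sup>2) \<partial>lborel)"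
proof -
  define v where "v s = u (y + s *\<^sub>R d)" for s
  define w where "w s = grad_matrix u (y + s *\<^sub>R d) *v d" for s
  define q where "q s = 2 * (norm (v s))\<^sup>2 + (norm d)\<^sup>2 * (norm (grad_matrix u (y + s *\<^sub>R d)))\<^sup>2" for s
  have dv: "(v has_vector_derivative w s) (at s within A)" for s A
  proof -
    have "((\<lambda>s. y + s *\<^sub>R d) has_derivative (\<lambda>t. t *\<^sub>R d)) (at s within A)"
      by (auto intro!: derivative_eq_intros)
    from has_derivative_compose[OF this C1_has_derivative[OF u]]
    have "(v has_derivative (\<lambda>t. grad_matrix u (y + s *\<^sub>R d) *v (t *\<^sub>R d))) (at s within A)"
      unfolding v_def grad_matrix_apply[OF u] .
    then show ?thesis
      by (simp add: has_vector_derivative_def w_def matrix_vector_mult_scaleR)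
  qed
  define \<phi> where "\<phi> s = - ((1 - s) * (v s \<bullet> v s))" for s
  define \<phi>' where "\<phi>' s = v s \<bullet> v s - (1 - s) * (2 * (v s \<bullet> w s))" for s
  have "(\<phi> has_vector_derivative \<phi>' s) (at s within {0..1})" for s
  proof -
    have "((\<lambda>s. v s \<bullet> v s) has_derivative (\<lambda>t. v s \<bullet> (t *\<^sub>R w s) + (t *\<^sub>R w s) \<bullet> v s)) (at s within {0..1})"
      using has_derivative_inner[OF dv[unfolded has_vector_derivative_def] dv[unfolded has_vector_derivative_def]] .
    moreover have "(\<lambda>t. v s \<bullet> (t *\<^sub>R w s) + (t *\<^sub>R w s) \<bullet> v s) = (*) (2 * (v s \<bullet> w s))"
      by (rule ext) (simp add: inner_commute)
    ultimately have "((\<lambda>s. v s \<bullet> v s) has_real_derivative 2 * (v s \<bullet> w s)) (at s within {0..1})"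
      unfolding has_field_derivative_def by (simp only:)
    then have "(\<phi> has_real_derivative \<phi>' s) (at s within {0..1})"
      unfolding \<phi>_def \<phi>'_def by (auto intro!: derivative_eq_intros simp: algebra_simps)
    then show ?thesis by (simp add: has_real_derivative_iff_has_vector_derivative)
  qed
  then have I: "(\<phi>' has_integral \<phi> 1 - \<phi> 0) {0..1}"
    by (intro fundamental_theorem_of_calculus) auto
  have cv: "continuous_on UNIV v"
    unfolding v_def by (intro continuous_on_compose2[OF C1_continuous[OF u, of UNIV]] continuous_intros) auto
  have cg: "continuous_on UNIV (\<lambda>s. grad_matrix u (y + s *\<^sub>R d))"
    by (intro continuous_on_compose2[OF grad_matrix_continuous[OF u, of UNIV]] continuous_intros) auto
  have "continuous_on {0..1} q"
    unfolding q_def by (intro continuous_intros continuous_on_subset[OF cv] continuous_on_subset[OF cg]) auto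
  then have Q: "(q has_integral integral {0..1} q) {0..1}"
    by (intro integrable_integral integrable_continuous_interval)
  have "\<phi>' s \<le> q s" if "s \<in> {0..1}" for s
  proof -
    have "- (2 * (1 - s) * (v s \<bullet> w s)) \<le> 2 * (1 - s) * (norm (v s) * norm (w s))"
    proof -
      have "- (v s \<bullet> w s) \<le> norm (v s) * norm (w s)"
        using Cauchy_Schwarz_ineq2[of "v s" "w s"] by linarith
      then have "2 * (1 - s) * (- (v s \<bullet> w s)) \<le> 2 * (1 - s) * (norm (v s) * norm (w s))"
        using that by (intro mult_left_mono) auto
      then show ?thesis by simp
    qed
    also have "\<dots> \<le> 1 * (2 * (norm (v s) * norm (w s)))"
    proof -
      have "(1 - s) * (2 * (norm (v s) * norm (w s))) \<le> 1 * (2 * (norm (v s) * norm (w s)))"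
        using that by (intro mult_right_mono) auto
      moreover have "2 * (1 - s) * (norm (v s) * norm (w s)) = (1 - s) * (2 * (norm (v s) * norm (w s)))"
        by (simp only: mult_ac)
      ultimately show ?thesis by (simp only:)
    qed
    also have "\<dots> \<le> (norm (v s))\<^sup>2 + (norm (w s))\<^sup>2"
      using sum_squares_bound[of "norm (v s)" "norm (w s)"] by simp
    also have "(norm (w s))\<^sup>2 \<le> (norm (grad_matrix u (y + s *\<^sub>R d)) * norm d)\<^sup>2"
      unfolding w_def by (intro power_mono norm_matrix_vector_le) simp
    finally show ?thesis
      by (simp add: \<phi>'_def q_def power2_norm_eq_inner power_mult_distrib algebra_simps)
  qed
  then have "\<phi> 1 - \<phi> 0 \<le> integral {0..1} q"
    by (rule has_integral_le[OF I Q])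
  then have "(norm (u y))\<^sup>2 \<le> integral {0..1} q"
    by (simp add: \<phi>_def v_def power2_norm_eq_inner)
  then have "ennreal ((norm (u y))\<^sup>2) \<le> ennreal (integral {0..1} q)" by (rule ennreal_leI)
  also have "\<dots> = (\<integral>\<^sup>+s. indicator {0..1} s * ennreal (q s) \<partial>lborel)"
    using nn_integral_has_integral_lebesgue'[OF _ Q] by (simp add: q_def mult.commute)
  finally show ?thesis unfolding q_def v_def .
qed

definition energy :: "(real^'n \<Rightarrow> real^'n) \<Rightarrow> real^'n \<Rightarrow> real" where
  "energy u x = (norm (u x))\<^sup>2 + (norm (grad_matrix u x))\<^sup>2"

lemma energy_borel [measurable]: "C1 u \<Longrightarrow> energy u \<in> borel_measurable borel"
  unfolding energy_def[abs_def]
  by (intro borel_measurable_continuous_onI continuous_intros C1_continuous grad_matrix_continuous)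

lemma C1_borel: "C1 u \<Longrightarrow> u \<in> borel_measurable borel"
  by (intro borel_measurable_continuous_onI C1_continuous)

text \<open>
  For \<open>y\<close> near \<open>y\<^sub>0\<close> in a face of \<open>P\<close>, the segment from \<open>y\<close> in the direction \<open>c - y\<^sub>0\<close> stays in \<open>P\<close>
  if \<open>c\<close> is an interior point, since \<open>y + s (c - y\<^sub>0) = (1 - s) y + s (c + (y - y\<^sub>0))\<close>.
\<close>

lemma trace_inequality_local:
  fixes P :: "(real^'n) set"
  assumes P: "convex P" "closed P" "P \<subseteq> {y. y \<bullet> \<nu> \<le> b}" and \<nu>: "norm \<nu> = 1"
    and c: "ball c \<rho> \<subseteq> P" "\<rho> > 0" and y0: "y0 \<in> P" "y0 \<bullet> \<nu> = b"
  shows "\<exists>C\<ge>0. \<forall>u. C1 u \<longrightarrow>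
    (\<integral>\<^sup>+z. indicator {0..1} (z \<bullet> \<nu> - b) * indicator (P \<inter> ball y0 \<rho>) (plane_proj \<nu> b z) *
        ennreal ((norm (u (plane_proj \<nu> b z)))\<^sup>2) \<partial>lborel)
      \<le> ennreal C * (\<integral>\<^sup>+x. indicator P x * ennreal (energy u x) \<partial>lborel)"
proof -
  define d where "d = c - y0"
  have "c + (\<rho>/2) *\<^sub>R \<nu> \<in> ball c \<rho>" using c(2) \<nu> by (simp add: dist_norm)
  then have "(c + (\<rho>/2) *\<^sub>R \<nu>) \<bullet> \<nu> \<le> b" using c(1) P(3) by auto
  moreover have "\<nu> \<bullet> \<nu> = 1" using \<nu> by (simp add: norm_eq_1)
  ultimately have "c \<bullet> \<nu> < b" using c(2) by (simp add: inner_add_left)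
  then have d: "d \<bullet> \<nu> \<noteq> 0" using y0(2) by (simp add: d_def inner_diff_left)
  have seg: "y + s *\<^sub>R d \<in> P" if "y \<in> P \<inter> ball y0 \<rho>" "s \<in> {0..1}" for y s
  proof -
    have "c + (y - y0) \<in> ball c \<rho>" using that(1) by (simp add: dist_norm norm_minus_commute)
    then have "(1 - s) *\<^sub>R y + s *\<^sub>R (c + (y - y0)) \<in> P"
      using that c(1) P(1) by (intro convexD) auto
    moreover have "(1 - s) *\<^sub>R y + s *\<^sub>R (c + (y - y0)) = y + s *\<^sub>R d"
      by (simp add: d_def algebra_simps)
    ultimately show ?thesis by simp
  qed
  define B where "B = max 2 ((norm d)\<^sup>2)"
  have B: "0 \<le> B" by (simp add: B_def)
  have [measurable]: "P \<in> sets borel" using P(2) by simp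
  have "(\<integral>\<^sup>+z. indicator {0..1} (z \<bullet> \<nu> - b) * indicator (P \<inter> ball y0 \<rho>) (plane_proj \<nu> b z) *
        ennreal ((norm (u (plane_proj \<nu> b z)))\<^sup>2) \<partial>lborel)
      \<le> ennreal (1 / \<bar>d \<bullet> \<nu>\<bar> * B) * (\<integral>\<^sup>+x. indicator P x * ennreal (energy u x) \<partial>lborel)"
    if u: "C1 u" for u
  proof -
    note [measurable] = energy_borel[OF u]
    define f where "f = (\<lambda>(x, r). indicator {0..1::real} r * (indicator P x * (ennreal B * ennreal (energy u x))))"
    have [measurable]: "f \<in> borel_measurable borel"
      unfolding f_def borel_prod[symmetric] by measurable
    have pt: "indicator {0..1} (z \<bullet> \<nu> - b) * indicator (P \<inter> ball y0 \<rho>) (plane_proj \<nu> b z) *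
        ennreal ((norm (u (plane_proj \<nu> b z)))\<^sup>2)
      \<le> (\<integral>\<^sup>+s. f (plane_proj \<nu> b z + s *\<^sub>R d, z \<bullet> \<nu> - b) \<partial>lborel)" for z
    proof (cases "z \<bullet> \<nu> - b \<in> {0..1} \<and> plane_proj \<nu> b z \<in> P \<inter> ball y0 \<rho>")
      case True
      let ?y = "plane_proj \<nu> b z"
      have "ennreal ((norm (u ?y))\<^sup>2) \<le> (\<integral>\<^sup>+s. indicator {0..1} s *
        ennreal (2 * (norm (u (?y + s *\<^sub>R d)))\<^sup>2 + (norm d)\<^sup>2 * (norm (grad_matrix u (?y + s *\<^sub>R d)))\<^sup>2) \<partial>lborel)"
        using u by (rule C1_norm_sqr_le_line_integral)
      also have "\<dots> \<le> (\<integral>\<^sup>+s. f (?y + s *\<^sub>R d, z \<bullet> \<nu> - b) \<partial>lborel)"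
      proof (rule nn_integral_mono)
        fix s :: real
        let ?x = "?y + s *\<^sub>R d"
        have "2 * (norm (u ?x))\<^sup>2 + (norm d)\<^sup>2 * (norm (grad_matrix u ?x))\<^sup>2 \<le> B * energy u ?x"
          unfolding energy_def distrib_left by (intro add_mono mult_right_mono) (auto simp: B_def)
        then have "ennreal (2 * (norm (u ?x))\<^sup>2 + (norm d)\<^sup>2 * (norm (grad_matrix u ?x))\<^sup>2)
            \<le> ennreal B * ennreal (energy u ?x)"
          unfolding ennreal_mult'[OF B, symmetric] by (rule ennreal_leI)
        then show "indicator {0..1} s * ennreal (2 * (norm (u ?x))\<^sup>2 + (norm d)\<^sup>2 * (norm (grad_matrix u ?x))\<^sup>2)
            \<le> f (?x, z \<bullet> \<nu> - b)"
          using True seg[of ?y s] by (simp add: f_def indicator_def)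
      qed
      finally show ?thesis using True by simp
    next
      case False
      then show ?thesis by (auto simp: indicator_def)
    qed
    have "(\<integral>\<^sup>+z. indicator {0..1} (z \<bullet> \<nu> - b) * indicator (P \<inter> ball y0 \<rho>) (plane_proj \<nu> b z) *
        ennreal ((norm (u (plane_proj \<nu> b z)))\<^sup>2) \<partial>lborel)
        \<le> (\<integral>\<^sup>+z. \<integral>\<^sup>+s. f (plane_proj \<nu> b z + s *\<^sub>R d, z \<bullet> \<nu> - b) \<partial>lborel \<partial>lborel)"
      by (intro nn_integral_mono pt)
    also have "\<dots> = ennreal (1 / \<bar>d \<bullet> \<nu>\<bar>) * (\<integral>\<^sup>+z. \<integral>\<^sup>+r. f (z, r) \<partial>lborel \<partial>lborel)"
      using d by (intro nn_integral_prism) auto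
    also have "(\<integral>\<^sup>+z. \<integral>\<^sup>+r. f (z, r) \<partial>lborel \<partial>lborel) =
        (\<integral>\<^sup>+x. ennreal B * (indicator P x * ennreal (energy u x)) \<partial>lborel)"
    proof (rule nn_integral_cong)
      fix x
      have "(\<integral>\<^sup>+r. f (x, r) \<partial>lborel) =
          (\<integral>\<^sup>+r. (indicator P x * (ennreal B * ennreal (energy u x))) * indicator {0..1} r \<partial>(lborel :: real measure))"
        by (simp add: f_def mult.commute)
      also have "\<dots> = (indicator P x * (ennreal B * ennreal (energy u x))) * emeasure lborel {0..1::real}"
        by (rule nn_integral_cmult_indicator) simp
      finally show "(\<integral>\<^sup>+r. f (x, r) \<partial>lborel) = ennreal B * (indicator P x * ennreal (energy u x))"
        by (simp add: mult_ac)
    qed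
    also have "\<dots> = ennreal B * (\<integral>\<^sup>+x. indicator P x * ennreal (energy u x) \<partial>lborel)"
      by (rule nn_integral_cmult) measurable
    finally show ?thesis
      unfolding ennreal_mult''[OF B] mult.assoc .
  qed
  moreover have "0 \<le> 1 / \<bar>d \<bullet> \<nu>\<bar> * B" using B by simp
  ultimately show ?thesis by blast
qed

lemma trace_inequality_face:
  fixes P :: "(real^'n) set"
  assumes P: "convex P" "compact P" "P \<subseteq> {y. y \<bullet> \<nu> \<le> b}" "interior P \<noteq> {}" and \<nu>: "norm \<nu> = 1"
  shows "\<exists>C\<ge>0. \<forall>u. C1 u \<longrightarrow>
    (\<integral>\<^sup>+z. indicator {0..1} (z \<bullet> \<nu> - b) * indicator P (plane_proj \<nu> b z) *
        ennreal ((norm (u (plane_proj \<nu> b z)))\<^sup>2) \<partial>lborel)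
      \<le> ennreal C * (\<integral>\<^sup>+x. indicator (interior P) x * ennreal (energy u x) \<partial>lborel)"
proof -
  obtain c \<rho> where c: "ball c \<rho> \<subseteq> P" "\<rho> > 0" using P(4) by (metis equals0I mem_interior)
  let ?F = "P \<inter> {y. y \<bullet> \<nu> = b}"
  have "closed {y. y \<bullet> \<nu> = b}" by (intro closed_Collect_eq continuous_intros)
  then have "compact ?F" using P(2) by (rule compact_Int_closed[rotated])
  moreover have "\<forall>y\<in>?F. open (ball y \<rho>)" by simp
  moreover have "?F \<subseteq> (\<Union>y\<in>?F. ball y \<rho>)" using c(2) by auto
  ultimately obtain Y where Y: "Y \<subseteq> ?F" "finite Y" "?F \<subseteq> (\<Union>y\<in>Y. ball y \<rho>)"
    using compactE_image[of ?F ?F "\<lambda>y. ball y \<rho>"] by metis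
  define J where "J u y = (\<integral>\<^sup>+z. indicator {0..1} (z \<bullet> \<nu> - b) * indicator (P \<inter> ball y \<rho>) (plane_proj \<nu> b z) *
        ennreal ((norm (u (plane_proj \<nu> b z)))\<^sup>2) \<partial>lborel)" for u :: "real^'n \<Rightarrow> real^'n" and y
  define E where "E u = (\<integral>\<^sup>+x. indicator P x * ennreal (energy u x) \<partial>lborel)" for u :: "real^'n \<Rightarrow> real^'n"
  have "\<forall>y\<in>Y. \<exists>C\<ge>0. \<forall>u. C1 u \<longrightarrow> J u y \<le> ennreal C * E u"
    unfolding J_def E_def using Y(1) c P(1,3) \<nu> compact_imp_closed[OF P(2)]
    by (intro ballI trace_inequality_local[where c = c]) auto
  then obtain C where C: "\<And>y. y \<in> Y \<Longrightarrow> 0 \<le> C y" "\<And>y u. y \<in> Y \<Longrightarrow> C1 u \<Longrightarrow> J u y \<le> ennreal (C y) * E u"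
    by metis
  have [measurable]: "P \<in> sets borel" using compact_imp_closed[OF P(2)] by simp
  show ?thesis
  proof (intro exI[of _ "sum C Y"] conjI allI impI)
    show "0 \<le> sum C Y" using C(1) by (rule sum_nonneg)
    fix u :: "real^'n \<Rightarrow> real^'n" assume u: "C1 u"
    note [measurable] = energy_borel[OF u] C1_borel[OF u]
    have [measurable]: "P \<inter> ball y \<rho> \<in> sets borel" for y by measurable
    have pt: "indicator {0..1} (z \<bullet> \<nu> - b) * indicator P (plane_proj \<nu> b z) * ennreal ((norm (u (plane_proj \<nu> b z)))\<^sup>2)
      \<le> (\<Sum>y\<in>Y. indicator {0..1} (z \<bullet> \<nu> - b) * indicator (P \<inter> ball y \<rho>) (plane_proj \<nu> b z) *
          ennreal ((norm (u (plane_proj \<nu> b z)))\<^sup>2))" for z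
    proof (cases "plane_proj \<nu> b z \<in> P")
      case True
      then obtain y where y: "y \<in> Y" "plane_proj \<nu> b z \<in> ball y \<rho>"
        using Y(3) plane_proj_mem[OF \<nu>] by blast
      have "indicator {0..1} (z \<bullet> \<nu> - b) * indicator P (plane_proj \<nu> b z) * ennreal ((norm (u (plane_proj \<nu> b z)))\<^sup>2)
        = indicator {0..1} (z \<bullet> \<nu> - b) * indicator (P \<inter> ball y \<rho>) (plane_proj \<nu> b z) *
          ennreal ((norm (u (plane_proj \<nu> b z)))\<^sup>2)"
        using y True by (simp add: indicator_def)
      also have "\<dots> \<le> (\<Sum>y\<in>Y. indicator {0..1} (z \<bullet> \<nu> - b) * indicator (P \<inter> ball y \<rho>) (plane_proj \<nu> b z) *
          ennreal ((norm (u (plane_proj \<nu> b z)))\<^sup>2))"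
        using Y(2) y(1) by (intro member_le_sum) auto
      finally show ?thesis .
    qed simp
    have "(\<integral>\<^sup>+z. indicator {0..1} (z \<bullet> \<nu> - b) * indicator P (plane_proj \<nu> b z) *
        ennreal ((norm (u (plane_proj \<nu> b z)))\<^sup>2) \<partial>lborel) \<le> (\<Sum>y\<in>Y. J u y)"
      unfolding J_def by (subst nn_integral_sum[symmetric]) (measurable, rule nn_integral_mono, rule pt)
    also have "\<dots> \<le> (\<Sum>y\<in>Y. ennreal (C y) * E u)" using C(2) u by (intro sum_mono)
    also have "\<dots> = ennreal (sum C Y) * E u"
      using C(1) by (simp add: sum_distrib_right[symmetric])
    also have "E u = (\<integral>\<^sup>+x. indicator (interior P) x * ennreal (energy u x) \<partial>lborel)"
    proof -
      have "negligible (frontier P)" using P(1) by (rule negligible_convex_frontier)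
      then have "AE x in lebesgue. x \<notin> frontier P"
        by (intro AE_not_in) (simp add: negligible_iff_null_sets)
      then have "AE x in lborel. x \<notin> frontier P"
        by (subst (asm) AE_completion_iff) auto
      then show ?thesis
        unfolding E_def using interior_subset[of P] compact_imp_closed[OF P(2)]
        by (intro nn_integral_cong_AE) (auto elim!: eventually_mono simp: indicator_def frontier_def)
    qed
    finally show "(\<integral>\<^sup>+z. indicator {0..1} (z \<bullet> \<nu> - b) * indicator P (plane_proj \<nu> b z) *
        ennreal ((norm (u (plane_proj \<nu> b z)))\<^sup>2) \<partial>lborel)
      \<le> ennreal (sum C Y) * (\<integral>\<^sup>+x. indicator (interior P) x * ennreal (energy u x) \<partial>lborel)" .
  qed
qed

lemma interior_Union_empty:
  assumes "finite \<T>" "\<And>P. P \<in> \<T> \<Longrightarrow> closed P" "\<And>P. P \<in> \<T> \<Longrightarrow> interior P = {}"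
  shows "interior (\<Union>\<T>) = {}"
  using assms
proof induction
  case (insert P \<T>)
  then have "interior (P \<union> \<Union>\<T>) = interior P"
    by (intro interior_closed_Un_empty_interior) auto
  then show ?case using insert by simp
qed simp

lemma polyhedral_element_full:
  assumes "polyhedral_element K"
  shows "\<exists>\<T>. finite \<T> \<and> (\<forall>P\<in>\<T>. polytope P \<and> interior P \<noteq> {}) \<and> K = interior (\<Union>\<T>)"
proof -
  obtain \<T> where T: "finite \<T>" "\<forall>P\<in>\<T>. polytope P" "K = interior (\<Union>\<T>)"
    using assms by (auto simp: polyhedral_element_def)
  let ?A = "{P \<in> \<T>. interior P \<noteq> {}}" and ?B = "{P \<in> \<T>. interior P = {}}"
  have "interior (\<Union>?A \<union> \<Union>?B) = interior (\<Union>?A)"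
    using T by (intro interior_closed_Un_empty_interior interior_Union_empty closed_Union)
      (auto intro: polytope_imp_closed)
  moreover have "\<Union>?A \<union> \<Union>?B = \<Union>\<T>" by auto
  ultimately have K: "K = interior (\<Union>?A)" using T(3) by simp
  show ?thesis
  proof (intro exI[of _ ?A] conjI K)
    show "finite ?A" using T(1) by simp
    show "\<forall>P\<in>?A. polytope P \<and> interior P \<noteq> {}" using T(2) by simp
  qed
qed

lemma facet_subset_face:
  assumes T: "finite \<T>" "\<And>P. P \<in> \<T> \<Longrightarrow> polytope P" "\<And>P. P \<in> \<T> \<Longrightarrow> interior P \<noteq> {}"
    and K: "K = interior (\<Union>\<T>)" and x: "x \<in> facet K \<nu> b"
  shows "\<exists>P\<in>\<T>. x \<in> P \<and> P \<subseteq> {y. y \<bullet> \<nu> \<le> b}"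
proof -
  obtain r where r: "r > 0" "K \<inter> ball x r = {y \<in> ball x r. y \<bullet> \<nu> < x \<bullet> \<nu>}"
    using facet_halfball[OF x] by blast
  note \<nu> = facetD(1)[OF x] and xb = facetD(2)[OF x]
  have \<nu>\<nu>: "\<nu> \<bullet> \<nu> = 1" using \<nu> by (simp add: norm_eq_1)
  have "closed (\<Union>\<T>)" using T(1,2) by (intro closed_Union) (auto intro: polytope_imp_closed)
  moreover have "x \<in> closure (\<Union>\<T>)"
    unfolding closure_approachable
  proof (intro allI impI)
    fix e :: real assume e: "0 < e"
    define t where "t = min e r / 2"
    have t: "0 < t" "t < e" "t < r" using e r(1) by (auto simp: t_def min_def)
    have "x - t *\<^sub>R \<nu> \<in> ball x r" using t \<nu> by (simp add: dist_norm)
    moreover have "(x - t *\<^sub>R \<nu>) \<bullet> \<nu> < x \<bullet> \<nu>" using t \<nu>\<nu> by (simp add: inner_diff_left)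
    ultimately have "x - t *\<^sub>R \<nu> \<in> K" using r(2) by blast
    then have "x - t *\<^sub>R \<nu> \<in> \<Union>\<T>" using K interior_subset by blast
    moreover have "dist (x - t *\<^sub>R \<nu>) x < e" using t \<nu> by (simp add: dist_norm)
    ultimately show "\<exists>y\<in>\<Union>\<T>. dist y x < e" by blast
  qed
  ultimately obtain P where P: "P \<in> \<T>" "x \<in> P" by auto
  have cP: "convex P" using T(2)[OF P(1)] by (rule polytope_imp_convex)
  have iK: "interior P \<subseteq> K" unfolding K using P(1) by (intro interior_mono) auto
  have "p \<bullet> \<nu> \<le> b" if p: "p \<in> interior P" for p
  proof (rule ccontr)
    assume "\<not> p \<bullet> \<nu> \<le> b"
    then have pb: "p \<bullet> \<nu> > b" by simp
    define e where "e = min 1 (r / (2 * (norm (x - p) + 1)))"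
    have pos: "0 < norm (x - p) + 1" using norm_ge_zero[of "x - p"] by linarith
    have e: "0 < e" "e \<le> 1" using r(1) pos by (auto simp: e_def)
    have "e * norm (x - p) \<le> (r / (2 * (norm (x - p) + 1))) * (norm (x - p) + 1)"
      using pos r(1) by (intro mult_mono) (auto simp: e_def)
    also have "\<dots> = r / 2" using pos by (simp add: field_simps)
    finally have er: "e * norm (x - p) < r" using r(1) by linarith
    let ?y = "x - e *\<^sub>R (x - p)"
    have "?y \<in> interior P"
      using mem_interior_closure_convex_shrink[OF cP p _ e] closure_subset P(2) by blast
    then have "?y \<in> K" using iK by blast
    moreover have "?y \<in> ball x r" using er e(1) by (simp add: dist_norm)
    ultimately have "?y \<bullet> \<nu> < x \<bullet> \<nu>" using r(2) by blast
    moreover have "?y \<bullet> \<nu> = x \<bullet> \<nu> + e * (p \<bullet> \<nu> - x \<bullet> \<nu>)"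
      by (simp add: inner_diff_left algebra_simps)
    ultimately have "e * (p \<bullet> \<nu> - x \<bullet> \<nu>) < 0" by simp
    then show False using e(1) pb xb by (simp add: mult_less_0_iff)
  qed
  then have "closure (interior P) \<subseteq> {y. y \<bullet> \<nu> \<le> b}"
    by (intro closure_minimal closed_Collect_le continuous_intros) auto
  then have "P \<subseteq> {y. y \<bullet> \<nu> \<le> b}"
    using convex_closure_interior[OF cP T(3)[OF P(1)]] closure_subset[of P] by auto
  with P show ?thesis by blast
qed

lemma trace_inequality:
  fixes K :: "(real^'n) set"
  assumes "polyhedral_element K"
  shows "\<exists>C\<ge>0. \<forall>u. C1 u \<longrightarrow> (\<integral>\<^sup>+x. ennreal ((norm (u x))\<^sup>2) \<partial>surface_measure K)
    \<le> ennreal C * (\<integral>\<^sup>+x. indicator K x * ennreal (energy u x) \<partial>lborel)"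
proof -
  obtain \<T> where T': "finite \<T>" "\<forall>P\<in>\<T>. polytope P \<and> interior P \<noteq> {}" and K: "K = interior (\<Union>\<T>)"
    using polyhedral_element_full[OF assms] by blast
  have T: "finite \<T>" "\<And>P. P \<in> \<T> \<Longrightarrow> polytope P" "\<And>P. P \<in> \<T> \<Longrightarrow> interior P \<noteq> {}"
    using T' by simp_all
  define E where "E u = (\<integral>\<^sup>+x. indicator K x * ennreal (energy u x) \<partial>lborel)" for u :: "real^'n \<Rightarrow> real^'n"
  have facet: "\<exists>C\<ge>0. \<forall>u. C1 u \<longrightarrow> (\<integral>\<^sup>+x. ennreal ((norm (u x))\<^sup>2) \<partial>facet_measure K \<nu> b) \<le> ennreal C * E u"
    if ne: "facet K \<nu> b \<noteq> {}" for \<nu> b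
  proof -
    have \<nu>: "norm \<nu> = 1" using ne facetD(1) by blast
    define \<S> where "\<S> = {P \<in> \<T>. P \<subseteq> {y. y \<bullet> \<nu> \<le> b}}"
    have \<S>: "P \<in> \<T>" "P \<subseteq> {y. y \<bullet> \<nu> \<le> b}" if "P \<in> \<S>" for P
      using that by (simp_all add: \<S>_def)
    have fin: "finite \<S>" using T(1) by (simp add: \<S>_def)
    define J where "J u P = (\<integral>\<^sup>+z. indicator {0..1} (z \<bullet> \<nu> - b) * indicator P (plane_proj \<nu> b z) *
        ennreal ((norm (u (plane_proj \<nu> b z)))\<^sup>2) \<partial>lborel)" for u :: "real^'n \<Rightarrow> real^'n" and P
    have "\<forall>P\<in>\<S>. \<exists>C\<ge>0. \<forall>u. C1 u \<longrightarrow> J u P \<le> ennreal C * E u"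
    proof
      fix P assume P: "P \<in> \<S>"
      obtain C where C: "C \<ge> 0" "\<And>u. C1 u \<Longrightarrow> J u P \<le>
          ennreal C * (\<integral>\<^sup>+x. indicator (interior P) x * ennreal (energy u x) \<partial>lborel)"
        using trace_inequality_face[of P \<nu> b] \<S>[OF P] T(2,3)[of P] \<nu> polytope_imp_convex polytope_imp_compact
        unfolding J_def by blast
      have "interior P \<subseteq> K" unfolding K using \<S>(1)[OF P] by (intro interior_mono) auto
      then have le: "(\<integral>\<^sup>+x. indicator (interior P) x * ennreal (energy u x) \<partial>lborel) \<le> E u" for u
        unfolding E_def by (intro nn_integral_mono) (auto simp: indicator_def)
      have "J u P \<le> ennreal C * E u" if "C1 u" for u
        by (rule order_trans[OF C(2)[OF that] mult_left_mono[OF le]]) simp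
      with C(1) show "\<exists>C\<ge>0. \<forall>u. C1 u \<longrightarrow> J u P \<le> ennreal C * E u" by blast
    qed
    then obtain C where C: "\<And>P. P \<in> \<S> \<Longrightarrow> 0 \<le> C P" "\<And>P u. P \<in> \<S> \<Longrightarrow> C1 u \<Longrightarrow> J u P \<le> ennreal (C P) * E u"
      by metis
    have Pb: "P \<in> sets borel" if "P \<in> \<S>" for P
      using polytope_imp_closed[OF T(2)[OF \<S>(1)[OF that]]] by simp
    show ?thesis
    proof (intro exI[of _ "sum C \<S>"] conjI allI impI)
      show "0 \<le> sum C \<S>" using C(1) by (rule sum_nonneg)
      fix u :: "real^'n \<Rightarrow> real^'n" assume u: "C1 u"
      note [measurable] = C1_borel[OF u]
      have pt: "facet_weight K \<nu> b z * ennreal ((norm (u (plane_proj \<nu> b z)))\<^sup>2)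
        \<le> (\<Sum>P\<in>\<S>. indicator {0..1} (z \<bullet> \<nu> - b) * indicator P (plane_proj \<nu> b z) *
            ennreal ((norm (u (plane_proj \<nu> b z)))\<^sup>2))" for z
      proof (cases "plane_proj \<nu> b z \<in> facet K \<nu> b")
        case True
        then obtain P where P: "P \<in> \<S>" "plane_proj \<nu> b z \<in> P"
          using facet_subset_face[OF T K] unfolding \<S>_def by blast
        have "facet_weight K \<nu> b z * ennreal ((norm (u (plane_proj \<nu> b z)))\<^sup>2)
          = indicator {0..1} (z \<bullet> \<nu> - b) * indicator P (plane_proj \<nu> b z) *
            ennreal ((norm (u (plane_proj \<nu> b z)))\<^sup>2)"
          using P(2) True by (simp add: facet_weight_def indicator_def)
        also have "\<dots> \<le> (\<Sum>P\<in>\<S>. indicator {0..1} (z \<bullet> \<nu> - b) * indicator P (plane_proj \<nu> b z) *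
            ennreal ((norm (u (plane_proj \<nu> b z)))\<^sup>2))"
          using fin P(1) by (intro member_le_sum) auto
        finally show ?thesis .
      qed (simp add: facet_weight_def)
      have "(\<integral>\<^sup>+x. ennreal ((norm (u x))\<^sup>2) \<partial>facet_measure K \<nu> b) =
          (\<integral>\<^sup>+z. facet_weight K \<nu> b z * ennreal ((norm (u (plane_proj \<nu> b z)))\<^sup>2) \<partial>lborel)"
        by (rule nn_integral_facet_measure) measurable
      also have "\<dots> \<le> (\<integral>\<^sup>+z. (\<Sum>P\<in>\<S>. indicator {0..1} (z \<bullet> \<nu> - b) * indicator P (plane_proj \<nu> b z) *
            ennreal ((norm (u (plane_proj \<nu> b z)))\<^sup>2)) \<partial>lborel)"
        by (intro nn_integral_mono pt)
      also have "\<dots> = (\<Sum>P\<in>\<S>. J u P)"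
        unfolding J_def by (rule nn_integral_sum) (use Pb in measurable)
      also have "\<dots> \<le> (\<Sum>P\<in>\<S>. ennreal (C P) * E u)" using C(2) u by (intro sum_mono)
      also have "\<dots> = ennreal (sum C \<S>) * E u"
        using C(1) by (simp add: sum_distrib_right[symmetric])
      finally show "(\<integral>\<^sup>+x. ennreal ((norm (u x))\<^sup>2) \<partial>facet_measure K \<nu> b) \<le> ennreal (sum C \<S>) * E u" .
    qed
  qed
  let ?I = "{(\<nu>, b). facet K \<nu> b \<noteq> {}}"
  have "\<forall>i\<in>?I. \<exists>C\<ge>0. \<forall>u. C1 u \<longrightarrow> (\<integral>\<^sup>+x. ennreal ((norm (u x))\<^sup>2) \<partial>facet_measure K (fst i) (snd i)) \<le> ennreal C * E u"
    using facet by auto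
  then obtain C where C: "\<And>i. i \<in> ?I \<Longrightarrow> 0 \<le> C i"
    "\<And>i u. i \<in> ?I \<Longrightarrow> C1 u \<Longrightarrow> (\<integral>\<^sup>+x. ennreal ((norm (u x))\<^sup>2) \<partial>facet_measure K (fst i) (snd i)) \<le> ennreal (C i) * E u"
    by metis
  show ?thesis
  proof (intro exI[of _ "sum C ?I"] conjI allI impI)
    show "0 \<le> sum C ?I" using C(1) by (rule sum_nonneg)
    fix u :: "real^'n \<Rightarrow> real^'n" assume u: "C1 u"
    note [measurable] = C1_borel[OF u]
    have "(\<integral>\<^sup>+x. ennreal ((norm (u x))\<^sup>2) \<partial>surface_measure K) =
        (\<Sum>i\<in>?I. \<integral>\<^sup>+x. ennreal ((norm (u x))\<^sup>2) \<partial>facet_measure K (fst i) (snd i))"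
      by (rule nn_integral_surface_measure) measurable
    also have "\<dots> \<le> (\<Sum>i\<in>?I. ennreal (C i) * E u)" using C(2) u by (intro sum_mono)
    also have "\<dots> = ennreal (sum C ?I) * E u"
      unfolding sum_distrib_right[symmetric] using sum_ennreal[of ?I C, OF C(1)] by (rule arg_cong)
    finally show "(\<integral>\<^sup>+x. ennreal ((norm (u x))\<^sup>2) \<partial>surface_measure K)
        \<le> ennreal (sum C ?I) * (\<integral>\<^sup>+x. indicator K x * ennreal (energy u x) \<partial>lborel)"
      unfolding E_def .
  qed
qed


section \<open>Existence of the trace operator\<close>

lemma polyhedral_element_open: "polyhedral_element K \<Longrightarrow> open K"
  unfolding polyhedral_element_def by auto

lemma polyhedral_element_bounded:
  assumes "polyhedral_element K"
  shows "bounded K"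
proof -
  obtain \<T> where T: "finite \<T>" "\<forall>P\<in>\<T>. polytope P" "K = interior (\<Union>\<T>)"
    using assms by (auto simp: polyhedral_element_def)
  have "bounded (\<Union>\<T>)" using T(1,2) by (intro bounded_Union) (auto intro: polytope_imp_bounded)
  then show ?thesis unfolding T(3) by (rule bounded_subset) (rule interior_subset)
qed

lemma L2_bounded_linear:
  assumes L: "bounded_linear L" and f: "f \<in> L2 \<mu>"
  shows "(\<lambda>x. L (f x)) \<in> L2 \<mu>"
proof -
  obtain B where B: "\<And>x. norm (L x) \<le> norm x * B" "B \<ge> 0"
    using bounded_linear.nonneg_bounded[OF L] by blast
  have [measurable]: "L \<in> borel_measurable borel"
    using linear_continuous_on[OF L] by (rule borel_measurable_continuous_onI)
  have m: "(\<lambda>x. L (f x)) \<in> borel_measurable \<mu>"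
    using L2D(1)[OF f] by measurable
  have "integrable \<mu> (\<lambda>x. (norm (L (f x)))\<^sup>2)"
  proof (rule Bochner_Integration.integrable_bound)
    show "integrable \<mu> (\<lambda>x. (norm (f x))\<^sup>2 * B\<^sup>2)" using L2D(2)[OF f] by simp
    have "(norm (L (f x)))\<^sup>2 \<le> (norm (f x))\<^sup>2 * B\<^sup>2" for x
      using power_mono[OF B(1), of "f x" 2] by (simp add: power_mult_distrib)
    then show "AE x in \<mu>. norm ((norm (L (f x)))\<^sup>2) \<le> norm ((norm (f x))\<^sup>2 * B\<^sup>2)"
      by (intro AE_I2) simp
  qed (use m in measurable)
  then show ?thesis using m by (simp add: L2_def)
qed

lemma L2_nth: "f \<in> L2 \<mu> \<Longrightarrow> (\<lambda>x. f x $ i) \<in> L2 \<mu>" for f :: "'a \<Rightarrow> ('b::euclidean_space)^'n"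
  using bounded_linear_vec_nth by (rule L2_bounded_linear)

lemma L2_Pair:
  assumes f: "f \<in> L2 \<mu>" and g: "g \<in> L2 \<mu>"
  shows "(\<lambda>x. (f x, g x)) \<in> L2 \<mu>"
proof -
  have "integrable \<mu> (\<lambda>x. (norm (f x))\<^sup>2 + (norm (g x))\<^sup>2)"
    using L2D(2)[OF f] L2D(2)[OF g] by simp
  moreover have "(\<lambda>x. (f x, g x)) \<in> borel_measurable \<mu>"
    using L2D(1)[OF f] L2D(1)[OF g] by (rule borel_measurable_Pair)
  ultimately show ?thesis by (simp add: L2_def norm_Pair)
qed

lemma l2_inner_Pair:
  assumes "f \<in> L2 \<mu>" "g \<in> L2 \<mu>" "f' \<in> L2 \<mu>" "g' \<in> L2 \<mu>"
  shows "l2_inner \<mu> (\<lambda>x. (f x, g x)) (\<lambda>x. (f' x, g' x)) = l2_inner \<mu> f f' + l2_inner \<mu> g g'"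
  unfolding l2_inner_def using assms by (simp add: L2_inner_integrable)

lemma L2_mult_integrable: "f \<in> L2 \<mu> \<Longrightarrow> g \<in> L2 \<mu> \<Longrightarrow> integrable \<mu> (\<lambda>x. f x * g x)"
  for f g :: "'a \<Rightarrow> real"
  using L2_inner_integrable[of f \<mu> g] by simp

lemma test_function_L2:
  assumes "open K" "bounded K" "test_function K \<phi>"
  shows "\<phi> \<in> L2 (lebesgue_on K)" "partial_deriv j \<phi> \<in> L2 (lebesgue_on K)"
proof -
  have "C1 \<phi>" using assms(3) by (simp add: test_function_def)
  then show "\<phi> \<in> L2 (lebesgue_on K)" "partial_deriv j \<phi> \<in> L2 (lebesgue_on K)"
    unfolding partial_deriv_def[abs_def]
    by (intro L2_continuous assms C1_continuous C1_continuous_derivative; assumption)+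
qed

lemma fundamental_lemma_L2:
  fixes f :: "real^'n \<Rightarrow> real"
  assumes K: "open K" "bounded K" and f: "f \<in> L2 (lebesgue_on K)"
    and z: "\<And>\<phi>. test_function K \<phi> \<Longrightarrow> (\<integral>x. f x * \<phi> x \<partial>lebesgue_on K) = 0"
  shows "AE x in lebesgue_on K. f x = 0"
proof (rule fundamental_lemma[OF K(1)])
  have "(\<lambda>x. 1) \<in> L2 (lebesgue_on K)" by (intro L2_continuous K continuous_intros)
  then show "integrable (lebesgue_on K) f" using L2_mult_integrable[OF f] by fastforce
qed (rule z)

lemma weak_gradD:
  assumes "weak_grad K v G"
  shows "v \<in> L2 (lebesgue_on K)" "G \<in> L2 (lebesgue_on K)"
  using assms by (simp_all add: weak_grad_def)

lemma weak_divD: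
  assumes "weak_div K \<tau> d"
  shows "\<tau> \<in> L2 (lebesgue_on K)" "d \<in> L2 (lebesgue_on K)"
  using assms by (simp_all add: weak_div_def)

context
  fixes K :: "(real^'n) set"
  assumes K: "open K" "bounded K"
begin

private lemmas test_L2 = test_function_L2[OF K]

private lemma weak_int:
  fixes u :: "real^'n \<Rightarrow> real^'n" and G :: "real^'n \<Rightarrow> real^'n^'n"
  assumes "test_function K \<phi>"
  shows "u \<in> L2 (lebesgue_on K) \<Longrightarrow> integrable (lebesgue_on K) (\<lambda>x. u x $ i * \<phi> x)"
    "u \<in> L2 (lebesgue_on K) \<Longrightarrow> integrable (lebesgue_on K) (\<lambda>x. u x $ i * partial_deriv j \<phi> x)"
    "G \<in> L2 (lebesgue_on K) \<Longrightarrow> integrable (lebesgue_on K) (\<lambda>x. G x $ i $ k * \<phi> x)"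
    "G \<in> L2 (lebesgue_on K) \<Longrightarrow> integrable (lebesgue_on K) (\<lambda>x. G x $ i $ k * partial_deriv j \<phi> x)"
  by (intro L2_mult_integrable L2_nth test_L2 assms; assumption)+

lemma weak_grad_add:
  assumes "weak_grad K u G" "weak_grad K v H"
  shows "weak_grad K (\<lambda>x. u x + v x) (\<lambda>x. G x + H x)"
  using assms by (auto simp: weak_grad_def distrib_right weak_int)

lemma weak_grad_scaleR:
  assumes "weak_grad K u G"
  shows "weak_grad K (\<lambda>x. c *\<^sub>R u x) (\<lambda>x. c *\<^sub>R G x)"
  using assms by (auto simp: weak_grad_def mult.assoc)

lemma weak_grad_cong_AE:
  assumes "weak_grad K u G" "v \<in> L2 (lebesgue_on K)" "AE x in lebesgue_on K. v x = u x"
    "H \<in> L2 (lebesgue_on K)" "AE x in lebesgue_on K. H x = G x"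
  shows "weak_grad K v H"
  unfolding weak_grad_def
proof (intro conjI allI impI assms(2,4))
  fix \<phi> :: "real^'n \<Rightarrow> real" and i j :: 'n assume \<phi>: "test_function K \<phi>"
  have "(\<integral>x. v x $ i * partial_deriv j \<phi> x \<partial>lebesgue_on K) = (\<integral>x. u x $ i * partial_deriv j \<phi> x \<partial>lebesgue_on K)"
    using assms(3) by (intro integral_cong_AE borel_measurable_integrable weak_int \<phi> assms(2) weak_gradD[OF assms(1)])
      (auto elim: eventually_mono)
  moreover have "(\<integral>x. H x $ i $ j * \<phi> x \<partial>lebesgue_on K) = (\<integral>x. G x $ i $ j * \<phi> x \<partial>lebesgue_on K)"
    using assms(5) by (intro integral_cong_AE borel_measurable_integrable weak_int \<phi> assms(4) weak_gradD[OF assms(1)])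
      (auto elim: eventually_mono)
  ultimately show "(\<integral>x. v x $ i * partial_deriv j \<phi> x \<partial>lebesgue_on K) = - (\<integral>x. H x $ i $ j * \<phi> x \<partial>lebesgue_on K)"
    using assms(1) \<phi> by (simp add: weak_grad_def)
qed

lemma weak_grad_unique:
  assumes "weak_grad K u G" "weak_grad K u H"
  shows "AE x in lebesgue_on K. G x = H x"
proof -
  have "AE x in lebesgue_on K. G x $ i $ j - H x $ i $ j = 0" for i j
  proof (rule fundamental_lemma_L2[OF K])
    note L = weak_gradD(2)[OF assms(1)] weak_gradD(2)[OF assms(2)]
    show "(\<lambda>x. G x $ i $ j - H x $ i $ j) \<in> L2 (lebesgue_on K)"
      by (intro L2_diff L2_nth L)
    fix \<phi> :: "real^'n \<Rightarrow> real" assume \<phi>: "test_function K \<phi>"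
    have "(\<integral>x. G x $ i $ j * \<phi> x \<partial>lebesgue_on K) = (\<integral>x. H x $ i $ j * \<phi> x \<partial>lebesgue_on K)"
      using assms \<phi> by (fastforce simp: weak_grad_def)
    then show "(\<integral>x. (G x $ i $ j - H x $ i $ j) * \<phi> x \<partial>lebesgue_on K) = 0"
      using weak_int(3)[OF \<phi> L(1), of i j] weak_int(3)[OF \<phi> L(2), of i j] by (simp add: left_diff_distrib)
  qed
  then have "AE x in lebesgue_on K. \<forall>i\<in>UNIV. \<forall>j\<in>UNIV. G x $ i $ j - H x $ i $ j = 0"
    by (intro AE_finite_allI finite) auto
  then show ?thesis by eventually_elim (simp add: vec_eq_iff)
qed

lemma weak_div_add:
  assumes "weak_div K \<sigma> c" "weak_div K \<tau> d"
  shows "weak_div K (\<lambda>x. \<sigma> x + \<tau> x) (\<lambda>x. c x + d x)"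
  using assms by (auto simp: weak_div_def distrib_right weak_int sum.distrib)

lemma weak_div_scaleR:
  assumes "weak_div K \<tau> d"
  shows "weak_div K (\<lambda>x. c *\<^sub>R \<tau> x) (\<lambda>x. c *\<^sub>R d x)"
  using assms by (auto simp: weak_div_def mult.assoc simp flip: sum_distrib_left)

lemma weak_div_cong_AE:
  assumes "weak_div K \<sigma> c" "\<tau> \<in> L2 (lebesgue_on K)" "AE x in lebesgue_on K. \<tau> x = \<sigma> x"
    "d \<in> L2 (lebesgue_on K)" "AE x in lebesgue_on K. d x = c x"
  shows "weak_div K \<tau> d"
  unfolding weak_div_def
proof (intro conjI allI impI assms(2,4))
  fix \<phi> :: "real^'n \<Rightarrow> real" and i :: 'n assume \<phi>: "test_function K \<phi>"
  have "(\<integral>x. (\<Sum>j\<in>UNIV. \<tau> x $ i $ j * partial_deriv j \<phi> x) \<partial>lebesgue_on K)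
      = (\<integral>x. (\<Sum>j\<in>UNIV. \<sigma> x $ i $ j * partial_deriv j \<phi> x) \<partial>lebesgue_on K)"
    using assms(3) by (intro integral_cong_AE borel_measurable_integrable Bochner_Integration.integrable_sum
        weak_int \<phi> assms(2) weak_divD[OF assms(1)]) (auto elim: eventually_mono)
  moreover have "(\<integral>x. d x $ i * \<phi> x \<partial>lebesgue_on K) = (\<integral>x. c x $ i * \<phi> x \<partial>lebesgue_on K)"
    using assms(5) by (intro integral_cong_AE borel_measurable_integrable weak_int \<phi> assms(4) weak_divD[OF assms(1)])
      (auto elim: eventually_mono)
  ultimately show "(\<integral>x. (\<Sum>j\<in>UNIV. \<tau> x $ i $ j * partial_deriv j \<phi> x) \<partial>lebesgue_on K)
      = - (\<integral>x. d x $ i * \<phi> x \<partial>lebesgue_on K)"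
    using assms(1) \<phi> by (simp add: weak_div_def)
qed

lemma weak_div_unique:
  assumes "weak_div K \<tau> c" "weak_div K \<tau> d"
  shows "AE x in lebesgue_on K. c x = d x"
proof -
  have "AE x in lebesgue_on K. c x $ i - d x $ i = 0" for i
  proof (rule fundamental_lemma_L2[OF K])
    note L = weak_divD(2)[OF assms(1)] weak_divD(2)[OF assms(2)]
    show "(\<lambda>x. c x $ i - d x $ i) \<in> L2 (lebesgue_on K)"
      by (intro L2_diff L2_nth L)
    fix \<phi> :: "real^'n \<Rightarrow> real" assume \<phi>: "test_function K \<phi>"
    have "(\<integral>x. c x $ i * \<phi> x \<partial>lebesgue_on K) = (\<integral>x. d x $ i * \<phi> x \<partial>lebesgue_on K)"
      using assms \<phi> by (fastforce simp: weak_div_def)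
    then show "(\<integral>x. (c x $ i - d x $ i) * \<phi> x \<partial>lebesgue_on K) = 0"
      using weak_int(1)[OF \<phi> L(1), of i] weak_int(1)[OF \<phi> L(2), of i] by (simp add: left_diff_distrib)
  qed
  then have "AE x in lebesgue_on K. \<forall>i\<in>UNIV. c x $ i - d x $ i = 0"
    by (intro AE_finite_allI finite) auto
  then show ?thesis by eventually_elim (simp add: vec_eq_iff)
qed

end

lemma grad_matrix_add:
  assumes "C1 u" "C1 v"
  shows "grad_matrix (\<lambda>x. u x + v x) = (\<lambda>x. grad_matrix u x + grad_matrix v x)"
  by (simp add: grad_matrix_def fun_eq_iff vec_eq_iff C1_frechet_derivative_add[OF assms])

lemma grad_matrix_scaleR:
  assumes "C1 u"
  shows "grad_matrix (\<lambda>x. c *\<^sub>R u x) = (\<lambda>x. c *\<^sub>R grad_matrix u x)"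
  by (simp add: grad_matrix_def fun_eq_iff vec_eq_iff
      C1_frechet_derivative_linear[OF bounded_linear_scaleR_right assms])

lemma energy_integral:
  assumes K: "open K" "bounded K" and u: "C1 u"
  shows "(\<integral>\<^sup>+x. indicator K x * ennreal (energy u x) \<partial>lborel) =
    ennreal ((l2_norm (lebesgue_on K) (\<lambda>x. (u x, grad_matrix u x)))\<^sup>2)"
proof -
  have L: "u \<in> L2 (lebesgue_on K)" "grad_matrix u \<in> L2 (lebesgue_on K)"
    using weak_gradD[OF weak_grad_C1[OF K u]] by auto
  have e: "energy u x = (u x, grad_matrix u x) \<bullet> (u x, grad_matrix u x)" for x
    by (simp add: energy_def power2_norm_eq_inner)
  have int: "integrable (lebesgue_on K) (energy u)"
    unfolding e[abs_def] by (intro L2_inner_integrable L2_Pair L)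
  have "(\<integral>\<^sup>+x. indicator K x * ennreal (energy u x) \<partial>lborel) = (\<integral>\<^sup>+x. indicator K x * ennreal (energy u x) \<partial>lebesgue)"
    by (simp add: nn_integral_completion)
  also have "\<dots> = (\<integral>\<^sup>+x. ennreal (energy u x) \<partial>lebesgue_on K)"
    using K(1) by (subst nn_integral_restrict_space) (auto simp: mult.commute)
  also have "\<dots> = ennreal (\<integral>x. energy u x \<partial>lebesgue_on K)"
    by (rule nn_integral_eq_integral[OF int]) (simp add: energy_def)
  also have "(\<integral>x. energy u x \<partial>lebesgue_on K) = (l2_norm (lebesgue_on K) (\<lambda>x. (u x, grad_matrix u x)))\<^sup>2"
    unfolding l2_norm_squared l2_inner_def e ..
  finally show ?thesis .
qed

lemma trace_operator_exists:
  fixes K :: "(real^'n) set"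
  assumes "polyhedral_element K"
  shows "\<exists>\<gamma>. is_trace_operator K \<gamma>"
proof -
  note K = polyhedral_element_open[OF assms] polyhedral_element_bounded[OF assms]
  let ?\<mu> = "lebesgue_on K" and ?\<nu> = "surface_measure K"
  define J where "J u = (\<lambda>x. (u x, grad_matrix u x))" for u :: "real^'n \<Rightarrow> real^'n"
  define X where "X = J ` {u. C1 u}"
  obtain C where C: "C \<ge> 0" "\<And>u. C1 u \<Longrightarrow> (\<integral>\<^sup>+x. ennreal ((norm (u x))\<^sup>2) \<partial>?\<nu>)
      \<le> ennreal C * (\<integral>\<^sup>+x. indicator K x * ennreal (energy u x) \<partial>lborel)"
    using trace_inequality[OF assms] by blast
  have JL: "J u \<in> L2 ?\<mu>" if "C1 u" for u
    unfolding J_def using weak_gradD[OF weak_grad_C1[OF K that]] by (intro L2_Pair)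
  have le: "(\<integral>\<^sup>+x. ennreal ((norm (u x))\<^sup>2) \<partial>?\<nu>) \<le> ennreal (C * (l2_norm ?\<mu> (J u))\<^sup>2)" if "C1 u" for u
    using C(2)[OF that] ennreal_mult'[OF C(1)] unfolding energy_integral[OF K that] J_def by simp
  have L: "u \<in> L2 ?\<nu>" if u: "C1 u" for u :: "real^'n \<Rightarrow> real^'n"
  proof -
    have m: "u \<in> borel_measurable ?\<nu>"
      using C1_borel[OF u] by (simp cong: measurable_cong_sets)
    have "integrable ?\<nu> (\<lambda>x. (norm (u x))\<^sup>2)"
    proof (rule integrableI_bounded)
      show "(\<integral>\<^sup>+x. ennreal (norm ((norm (u x))\<^sup>2)) \<partial>?\<nu>) < \<infinity>"
        using le[OF u] by (simp add: le_less_trans)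
    qed (use m in measurable)
    then show ?thesis using m by (simp add: L2_def)
  qed
  have bnd: "l2_norm ?\<nu> u \<le> sqrt C * l2_norm ?\<mu> (J u)" if u: "C1 u" for u
  proof -
    have "ennreal (\<integral>x. (norm (u x))\<^sup>2 \<partial>?\<nu>) = (\<integral>\<^sup>+x. ennreal ((norm (u x))\<^sup>2) \<partial>?\<nu>)"
      using L2D(2)[OF L[OF u]] by (intro nn_integral_eq_integral[symmetric]) auto
    then have "ennreal ((l2_norm ?\<nu> u)\<^sup>2) \<le> ennreal (C * (l2_norm ?\<mu> (J u))\<^sup>2)"
      using le[OF u] by (simp add: l2_norm_squared l2_inner_def power2_norm_eq_inner)
    then have "(l2_norm ?\<nu> u)\<^sup>2 \<le> C * (l2_norm ?\<mu> (J u))\<^sup>2"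
      using C(1) by (subst (asm) ennreal_le_iff) auto
    then have "sqrt ((l2_norm ?\<nu> u)\<^sup>2) \<le> sqrt (C * (l2_norm ?\<mu> (J u))\<^sup>2)"
      by (rule real_sqrt_le_mono)
    then show ?thesis by (simp add: real_sqrt_mult)
  qed
  have J_add: "(\<lambda>x. J u x + J v x) = J (\<lambda>x. u x + v x)" if "C1 u" "C1 v" for u v
    unfolding J_def by (simp add: grad_matrix_add[OF that])
  have J_scale: "(\<lambda>x. c *\<^sub>R J u x) = J (\<lambda>x. c *\<^sub>R u x)" if "C1 u" for u c
    unfolding J_def by (simp add: grad_matrix_scaleR[OF that])
  have J0: "J (\<lambda>x. 0) = (\<lambda>x. 0)"
    using J_scale[OF C1_const[of 0], of 0] by (simp add: zero_prod_def)
  have fstJ: "(\<lambda>x. fst (J u x)) = u" for u by (simp add: J_def)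
  have scaleC: "C1 (\<lambda>x. c *\<^sub>R u x)" if "C1 u" for u :: "real^'n \<Rightarrow> real^'n" and c
    using bounded_linear_scaleR_right that by (rule C1_linear)
  have XI: "J u \<in> X" if "C1 u" for u using that by (simp add: X_def)
  have XE: "\<exists>u. f = J u \<and> C1 u" if "f \<in> X" for f using that by (auto simp: X_def)
  have "\<exists>T'. (\<forall>f\<in>L2 ?\<mu>. T' f \<in> L2 ?\<nu> \<and> l2_norm ?\<nu> (T' f) \<le> sqrt C * l2_norm ?\<mu> f \<and>
      (\<forall>c. AE x in ?\<nu>. T' (\<lambda>x. c *\<^sub>R f x) x = c *\<^sub>R T' f x) \<and>
      (\<forall>g\<in>L2 ?\<mu>. AE x in ?\<nu>. T' (\<lambda>x. f x + g x) x = T' f x + T' g x)) \<and>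
    (\<forall>f\<in>X. AE x in ?\<nu>. T' f x = fst (f x))"
  proof (rule l2_bounded_extension)
    show "X \<subseteq> L2 ?\<mu>" using JL by (auto simp: X_def)
    show "(\<lambda>x. 0) \<in> X" using XI[OF C1_const[of 0]] by (simp only: J0)
    show "(\<lambda>x. f x + g x) \<in> X" if fg: "f \<in> X" "g \<in> X" for f g
    proof -
      obtain u v where "f = J u" "C1 u" "g = J v" "C1 v" using fg XE by metis
      then show ?thesis using XI[OF C1_add] J_add by simp
    qed
    show "(\<lambda>x. c *\<^sub>R f x) \<in> X" if f: "f \<in> X" for f c
    proof -
      obtain u where "f = J u" "C1 u" using XE[OF f] by blast
      then show ?thesis using XI[OF scaleC] J_scale by simp
    qed
    show "(\<lambda>x. fst (f x)) \<in> L2 ?\<nu>" if f: "f \<in> X" for f using XE[OF f] L fstJ by auto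
    show "l2_norm ?\<nu> (\<lambda>x. fst (f x)) \<le> sqrt C * l2_norm ?\<mu> f" if f: "f \<in> X" for f
      using XE[OF f] bnd fstJ by auto
  qed (use C(1) in simp_all)
  then obtain T' where "\<forall>f\<in>L2 ?\<mu>. T' f \<in> L2 ?\<nu> \<and> l2_norm ?\<nu> (T' f) \<le> sqrt C * l2_norm ?\<mu> f \<and>
      (\<forall>c. AE x in ?\<nu>. T' (\<lambda>x. c *\<^sub>R f x) x = c *\<^sub>R T' f x) \<and>
      (\<forall>g\<in>L2 ?\<mu>. AE x in ?\<nu>. T' (\<lambda>x. f x + g x) x = T' f x + T' g x)"
    and T'_X: "\<forall>f\<in>X. AE x in ?\<nu>. T' f x = fst (f x)"
    by (elim exE conjE)
  then have T': "T' f \<in> L2 ?\<nu>" "g \<in> L2 ?\<mu> \<Longrightarrow> AE x in ?\<nu>. T' (\<lambda>x. f x + g x) x = T' f x + T' g x"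
    "AE x in ?\<nu>. T' (\<lambda>x. c *\<^sub>R f x) x = c *\<^sub>R T' f x" "l2_norm ?\<nu> (T' f) \<le> sqrt C * l2_norm ?\<mu> f"
    if "f \<in> L2 ?\<mu>" for f g c
    using that by simp_all
  have T'_cong: "AE x in ?\<nu>. T' f x = T' g x"
    if fg: "f \<in> L2 ?\<mu>" "g \<in> L2 ?\<mu>" "AE x in ?\<mu>. f x = g x" for f g
  proof -
    have L1: "(\<lambda>x. (-1) *\<^sub>R g x) \<in> L2 ?\<mu>" using fg(2) by (rule L2_scaleR)
    let ?h = "\<lambda>x. f x + (-1) *\<^sub>R g x"
    have h: "?h \<in> L2 ?\<mu>" using fg(1) L1 by (rule L2_add)
    have "AE x in ?\<mu>. ?h x = 0" using fg(3) by eventually_elim simp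
    then have "l2_norm ?\<mu> ?h = 0" using h by (simp add: l2_norm_eq_0_iff)
    then have "l2_norm ?\<nu> (T' ?h) \<le> 0" using T'(4)[OF h] by simp
    then have "l2_norm ?\<nu> (T' ?h) = 0" using l2_norm_nonneg[of ?\<nu> "T' ?h"] by linarith
    then have "AE x in ?\<nu>. T' ?h x = 0" using T'(1)[OF h] by (simp add: l2_norm_eq_0_iff)
    with T'(2)[OF fg(1) L1] T'(3)[OF fg(2), of "-1"] show ?thesis
      by eventually_elim simp
  qed
  define G where "G u = (SOME G. weak_grad K u G)" for u
  have G: "weak_grad K u (G u)" if "u \<in> H1 K" for u
    using that someI_ex[of "weak_grad K u"] by (simp add: H1_def G_def)
  define \<gamma> where "\<gamma> u = T' (\<lambda>x. (u x, G u x))" for u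
  have pair: "(\<lambda>x. (u x, G u x)) \<in> L2 ?\<mu>" if "u \<in> H1 K" for u
    using weak_gradD[OF G[OF that]] by (rule L2_Pair)
  have \<gamma>: "AE x in ?\<nu>. \<gamma> u x = T' (\<lambda>x. (u x, H x)) x" if "weak_grad K u H" for u H
  proof -
    have u: "u \<in> H1 K" using that by (auto simp: H1_def)
    have "AE x in ?\<mu>. (u x, G u x) = (u x, H x)"
      using weak_grad_unique[OF K G[OF u] that] by eventually_elim simp
    then show ?thesis
      unfolding \<gamma>_def using weak_gradD[OF that] by (intro T'_cong pair[OF u] L2_Pair)
  qed
  have "is_trace_operator K \<gamma>"
    unfolding is_trace_operator_def
  proof (intro conjI ballI allI impI)
    show L: "\<gamma> u \<in> L2 ?\<nu>" if "u \<in> H1 K" for u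
      unfolding \<gamma>_def using pair[OF that] by (rule T'(1))
    fix u v assume u: "u \<in> H1 K" and v: "v \<in> H1 K"
    show "AE x in ?\<nu>. \<gamma> (\<lambda>y. u y + v y) x = \<gamma> u x + \<gamma> v x"
      using \<gamma>[OF weak_grad_add[OF K G[OF u] G[OF v]]] T'(2)[OF pair[OF u] pair[OF v]]
      by eventually_elim (simp add: \<gamma>_def)
  next
    fix c u assume u: "u \<in> H1 K"
    show "AE x in ?\<nu>. \<gamma> (\<lambda>y. c *\<^sub>R u y) x = c *\<^sub>R \<gamma> u x"
      using \<gamma>[OF weak_grad_scaleR[OF K G[OF u], of c]] T'(3)[OF pair[OF u], of c]
      by eventually_elim (simp add: \<gamma>_def)
  next
    show "\<exists>C. \<forall>u G. weak_grad K u G \<longrightarrow> l2_inner ?\<nu> (\<gamma> u) (\<gamma> u) \<le> C * (l2_inner ?\<mu> u u + l2_inner ?\<mu> G G)"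
    proof (intro exI[of _ C] allI impI)
      fix u H assume H: "weak_grad K u H"
      note LH = weak_gradD[OF H]
      have u: "u \<in> H1 K" using H by (auto simp: H1_def)
      have "l2_norm ?\<nu> (\<gamma> u) = l2_norm ?\<nu> (T' (\<lambda>x. (u x, H x)))"
        using \<gamma>[OF H] T'(1)[OF pair[OF u]] T'(1)[OF L2_Pair[OF LH]]
        by (intro l2_norm_cong_AE) (auto simp: \<gamma>_def)
      also have "\<dots> \<le> sqrt C * l2_norm ?\<mu> (\<lambda>x. (u x, H x))"
        by (intro T'(4) L2_Pair LH)
      finally have "(l2_norm ?\<nu> (\<gamma> u))\<^sup>2 \<le> (sqrt C * l2_norm ?\<mu> (\<lambda>x. (u x, H x)))\<^sup>2"
        by (intro power_mono) auto
      then show "l2_inner ?\<nu> (\<gamma> u) (\<gamma> u) \<le> C * (l2_inner ?\<mu> u u + l2_inner ?\<mu> H H)"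
        using C(1) by (simp add: l2_norm_squared power_mult_distrib l2_inner_Pair LH)
    qed
  next
    fix u :: "real^'n \<Rightarrow> real^'n" assume u: "C1 u"
    have "J u \<in> X" using u by (auto simp: X_def)
    from \<gamma>[OF weak_grad_C1[OF K u]] bspec[OF T'_X this]
    show "AE x in ?\<nu>. \<gamma> u x = u x"
      unfolding J_def by eventually_elim simp
  qed
  then show ?thesis by blast
qed


section \<open>Green's formula and spaces of traces\<close>

lemma l2_subspace_image:
  assumes S: "l2_subspace \<mu> S"
    and L: "\<And>f g. f \<in> S \<Longrightarrow> P f g \<Longrightarrow> g \<in> L2 \<nu>"
    and zero: "P (\<lambda>x. 0) (\<lambda>x. 0)"
    and add: "\<And>f g f' g'. f \<in> S \<Longrightarrow> f' \<in> S \<Longrightarrow> P f g \<Longrightarrow> P f' g' \<Longrightarrow> P (\<lambda>x. f x + f' x) (\<lambda>x. g x + g' x)"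
    and scale: "\<And>f g c. f \<in> S \<Longrightarrow> P f g \<Longrightarrow> P (\<lambda>x. c *\<^sub>R f x) (\<lambda>x. c *\<^sub>R g x)"
    and cong: "\<And>f g h. f \<in> S \<Longrightarrow> P f g \<Longrightarrow> h \<in> L2 \<nu> \<Longrightarrow> AE x in \<nu>. h x = g x \<Longrightarrow> P f h"
  shows "l2_subspace \<nu> {g. \<exists>f\<in>S. P f g}"
  unfolding l2_subspace_def
proof (intro conjI ballI allI impI)
  show "{g. \<exists>f\<in>S. P f g} \<subseteq> L2 \<nu>" using L by blast
  show "(\<lambda>x. 0) \<in> {g. \<exists>f\<in>S. P f g}" using zero l2_subspaceD(2)[OF S] by blast
  fix g assume "g \<in> {g. \<exists>f\<in>S. P f g}"
  then obtain f where f: "f \<in> S" "P f g" by blast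
  show "(\<lambda>x. c *\<^sub>R g x) \<in> {g. \<exists>f\<in>S. P f g}" for c
    using scale[OF f] l2_subspaceD(4)[OF S f(1)] by blast
  show "h \<in> {g. \<exists>f\<in>S. P f g}" if "h \<in> L2 \<nu>" "AE x in \<nu>. h x = g x" for h
    using cong[OF f that] f(1) by blast
  fix g' assume "g' \<in> {g. \<exists>f\<in>S. P f g}"
  then obtain f' where f': "f' \<in> S" "P f' g'" by blast
  show "(\<lambda>x. g x + g' x) \<in> {g. \<exists>f\<in>S. P f g}"
    using add[OF f(1) f'(1) f(2) f'(2)] l2_subspaceD(3)[OF S f(1) f'(1)] by blast
qed

lemma l2_subspace_Collect:
  assumes S: "l2_subspace \<mu> S"
    and zero: "P (\<lambda>x. 0)"
    and add: "\<And>f g. f \<in> S \<Longrightarrow> g \<in> S \<Longrightarrow> P f \<Longrightarrow> P g \<Longrightarrow> P (\<lambda>x. f x + g x)"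
    and scale: "\<And>f c. f \<in> S \<Longrightarrow> P f \<Longrightarrow> P (\<lambda>x. c *\<^sub>R f x)"
    and cong: "\<And>f h. f \<in> S \<Longrightarrow> h \<in> S \<Longrightarrow> P f \<Longrightarrow> AE x in \<mu>. h x = f x \<Longrightarrow> P h"
  shows "l2_subspace \<mu> {f \<in> S. P f}"
  unfolding l2_subspace_def
proof (intro conjI ballI allI impI)
  show "{f \<in> S. P f} \<subseteq> L2 \<mu>" using l2_subspaceD(1)[OF S] by blast
  show "(\<lambda>x. 0) \<in> {f \<in> S. P f}" using zero l2_subspaceD(2)[OF S] by simp
  fix f assume f: "f \<in> {f \<in> S. P f}"
  show "(\<lambda>x. c *\<^sub>R f x) \<in> {f \<in> S. P f}" for c
    using f scale l2_subspaceD(4)[OF S] by simp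
  show "h \<in> {f \<in> S. P f}" if "h \<in> L2 \<mu>" "AE x in \<mu>. h x = f x" for h
    using f that cong[of f h] l2_subspaceD(5)[OF S, of f h] by simp
  show "(\<lambda>x. f x + g x) \<in> {f \<in> S. P f}" if "g \<in> {f \<in> S. P f}" for g
    using f that add l2_subspaceD(3)[OF S] by simp
qed

lemma l2_subspace_orth_compl:
  assumes S: "l2_subspace \<mu> S" and T: "T \<subseteq> L2 \<mu>"
  shows "l2_subspace \<mu> (l2_orth_compl \<mu> S T)"
  unfolding l2_orth_compl_def
proof (rule l2_subspace_Collect[OF S])
  note L = l2_subspace_L2[OF S]
  show "\<forall>h\<in>T. l2_inner \<mu> (\<lambda>x. f x + g x) h = 0"
    if "f \<in> S" "g \<in> S" "\<forall>h\<in>T. l2_inner \<mu> f h = 0" "\<forall>h\<in>T. l2_inner \<mu> g h = 0" for f g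
    using that T by (auto simp: l2_inner_add_left L subsetD)
  show "\<forall>h\<in>T. l2_inner \<mu> g h = 0"
    if fg: "f \<in> S" "g \<in> S" "\<forall>h\<in>T. l2_inner \<mu> f h = 0" "AE x in \<mu>. g x = f x" for f g
  proof
    fix h assume "h \<in> T"
    then show "l2_inner \<mu> g h = 0"
      using fg(3) l2_inner_cong_AE[OF L[OF fg(2)] L[OF fg(1)] _ _ fg(4), of h h] T by auto
  qed
qed auto

lemma bounded_linear_transpose: "bounded_linear (transpose :: real^'n^'m \<Rightarrow> real^'m^'n)"
  unfolding linear_conv_bounded_linear[symmetric]
  by (rule linearI) (simp_all add: transpose_def vec_eq_iff)

lemma inner_transpose: "transpose A \<bullet> transpose B = A \<bullet> B" for A B :: "real^'n^'m"
  unfolding inner_vec_def transpose_def by (simp, rule sum.swap)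

context
  fixes K :: "(real^'n) set"
  assumes K: "polyhedral_element K"
begin

private lemmas K' = polyhedral_element_open[OF K] polyhedral_element_bounded[OF K]

lemma bdry_trace_is_trace_operator: "is_trace_operator K (bdry_trace K)"
  unfolding bdry_trace_def using trace_operator_exists[OF K] by (rule someI_ex)

lemma bdry_trace_L2: "u \<in> H1 K \<Longrightarrow> bdry_trace K u \<in> L2 (surface_measure K)"
  using bdry_trace_is_trace_operator by (simp add: is_trace_operator_def)

lemma bdry_trace_add:
  "u \<in> H1 K \<Longrightarrow> v \<in> H1 K \<Longrightarrow>
    AE x in surface_measure K. bdry_trace K (\<lambda>y. u y + v y) x = bdry_trace K u x + bdry_trace K v x"
  using bdry_trace_is_trace_operator by (simp add: is_trace_operator_def)

lemma bdry_trace_scaleR: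
  "u \<in> H1 K \<Longrightarrow> AE x in surface_measure K. bdry_trace K (\<lambda>y. c *\<^sub>R u y) x = c *\<^sub>R bdry_trace K u x"
  using bdry_trace_is_trace_operator by (simp add: is_trace_operator_def)

lemma bdry_trace_AE_zero:
  assumes u: "u \<in> H1 K" and z: "AE x in lebesgue_on K. u x = 0"
  shows "AE x in surface_measure K. bdry_trace K u x = 0"
proof -
  obtain G where G: "weak_grad K u G" using u by (auto simp: H1_def)
  have "weak_grad K (\<lambda>x. 0) (\<lambda>x. 0 :: real^'n^'n)" by (simp add: weak_grad_def)
  then have G0: "weak_grad K u (\<lambda>x. 0)"
    by (rule weak_grad_cong_AE[OF K' _ weak_gradD(1)[OF G] z L2_zero]) simp
  obtain C where C: "\<forall>v G. weak_grad K v G \<longrightarrow>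
      l2_inner (surface_measure K) (bdry_trace K v) (bdry_trace K v)
        \<le> C * (l2_inner (lebesgue_on K) v v + l2_inner (lebesgue_on K) G G)"
    using bdry_trace_is_trace_operator unfolding is_trace_operator_def by (elim conjE exE) (rule that)
  have "l2_inner (lebesgue_on K) u u = 0"
    using weak_gradD(1)[OF G] z by (simp add: l2_inner_self_eq_0_iff)
  then have "l2_inner (surface_measure K) (bdry_trace K u) (bdry_trace K u) \<le> 0"
    using C[rule_format, OF G0] by simp
  then have "l2_inner (surface_measure K) (bdry_trace K u) (bdry_trace K u) = 0"
    using l2_inner_self_nonneg[of "surface_measure K" "bdry_trace K u"] by linarith
  then show ?thesis using l2_inner_self_eq_0_iff[OF bdry_trace_L2[OF u]] by simp
qed

lemma H1_add: "u \<in> H1 K \<Longrightarrow> v \<in> H1 K \<Longrightarrow> (\<lambda>x. u x + v x) \<in> H1 K"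
  unfolding H1_def using weak_grad_add[OF K'] by blast

lemma H1_scaleR: "u \<in> H1 K \<Longrightarrow> (\<lambda>x. c *\<^sub>R u x) \<in> H1 K"
  unfolding H1_def using weak_grad_scaleR[OF K'] by blast

lemma H1_L2: "u \<in> H1 K \<Longrightarrow> u \<in> L2 (lebesgue_on K)"
  unfolding H1_def using weak_gradD(1) by blast

lemma H1_zero: "(\<lambda>x. 0) \<in> H1 K"
proof -
  have "weak_grad K (\<lambda>x. 0) (\<lambda>x. 0 :: real^'n^'n)" by (simp add: weak_grad_def)
  then show ?thesis by (auto simp: H1_def)
qed

lemma bdry_trace_zero: "AE x in surface_measure K. bdry_trace K (\<lambda>x. 0) x = 0"
  by (rule bdry_trace_AE_zero[OF H1_zero]) simp

lemma weak_sym_gradD: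
  assumes "weak_sym_grad K v e"
  shows "e \<in> L2 (lebesgue_on K)" "v \<in> H1 K"
  using assms unfolding weak_sym_grad_def H1_def by blast+

lemma weak_sym_grad_exists:
  assumes "v \<in> H1 K"
  shows "\<exists>e. weak_sym_grad K v e"
proof -
  obtain G where G: "weak_grad K v G" using assms by (auto simp: H1_def)
  have "bounded_linear (\<lambda>A :: real^'n^'n. (1/2) *\<^sub>R (A + transpose A))"
    by (intro bounded_linear_const_scaleR bounded_linear_add bounded_linear_ident bounded_linear_transpose)
  then have "(\<lambda>x. (1/2) *\<^sub>R (G x + transpose (G x))) \<in> L2 (lebesgue_on K)"
    using weak_gradD(2)[OF G] by (rule L2_bounded_linear)
  then show ?thesis using G unfolding weak_sym_grad_def by blast
qed

lemma weak_sym_grad_add: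
  assumes "weak_sym_grad K u e" "weak_sym_grad K v e'"
  shows "weak_sym_grad K (\<lambda>x. u x + v x) (\<lambda>x. e x + e' x)"
proof -
  obtain G H where G: "weak_grad K u G" "AE x in lebesgue_on K. e x = (1/2) *\<^sub>R (G x + transpose (G x))"
    and H: "weak_grad K v H" "AE x in lebesgue_on K. e' x = (1/2) *\<^sub>R (H x + transpose (H x))"
    using assms unfolding weak_sym_grad_def by blast
  have "AE x in lebesgue_on K. e x + e' x = (1/2) *\<^sub>R ((G x + H x) + transpose (G x + H x))"
    using G(2) H(2)
    by eventually_elim (simp add: linear_add[OF bounded_linear.linear[OF bounded_linear_transpose]] algebra_simps)
  then show ?thesis
    using weak_grad_add[OF K' G(1) H(1)] L2_add[OF assms[THEN weak_sym_gradD(1)]]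
    unfolding weak_sym_grad_def by blast
qed

lemma weak_sym_grad_scaleR:
  assumes "weak_sym_grad K u e"
  shows "weak_sym_grad K (\<lambda>x. c *\<^sub>R u x) (\<lambda>x. c *\<^sub>R e x)"
proof -
  obtain G where G: "weak_grad K u G" "AE x in lebesgue_on K. e x = (1/2) *\<^sub>R (G x + transpose (G x))"
    using assms unfolding weak_sym_grad_def by blast
  have "AE x in lebesgue_on K. c *\<^sub>R e x = (1/2) *\<^sub>R (c *\<^sub>R G x + transpose (c *\<^sub>R G x))"
    using G(2)
    by eventually_elim (simp add: linear_cmul[OF bounded_linear.linear[OF bounded_linear_transpose]] algebra_simps)
  then show ?thesis
    using weak_grad_scaleR[OF K' G(1)] L2_scaleR[OF weak_sym_gradD(1)[OF assms]]
    unfolding weak_sym_grad_def by blast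
qed

lemma weak_sym_grad_cong_AE:
  assumes "weak_sym_grad K u e" "v \<in> L2 (lebesgue_on K)" "AE x in lebesgue_on K. v x = u x"
    "e' \<in> L2 (lebesgue_on K)" "AE x in lebesgue_on K. e' x = e x"
  shows "weak_sym_grad K v e'"
proof -
  obtain G where G: "weak_grad K u G" "AE x in lebesgue_on K. e x = (1/2) *\<^sub>R (G x + transpose (G x))"
    using assms(1) unfolding weak_sym_grad_def by blast
  have "weak_grad K v G"
    by (rule weak_grad_cong_AE[OF K' G(1) assms(2,3) weak_gradD(2)[OF G(1)]]) simp
  moreover have "AE x in lebesgue_on K. e' x = (1/2) *\<^sub>R (G x + transpose (G x))"
    using assms(5) G(2) by eventually_elim simp
  ultimately show ?thesis using assms(4) unfolding weak_sym_grad_def by blast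
qed

lemma weak_sym_grad_zero: "weak_sym_grad K (\<lambda>x. 0) (\<lambda>x. 0)"
proof -
  obtain e where "weak_sym_grad K (\<lambda>x. 0) e" using weak_sym_grad_exists[OF H1_zero] by blast
  from weak_sym_grad_scaleR[OF this, of 0] show ?thesis by simp
qed

lemma weak_div_zero: "weak_div K (\<lambda>x. 0) (\<lambda>x. 0)"
  by (simp add: weak_div_def)

lemma normal_traceD:
  assumes "normal_trace K \<tau> g"
  shows "g \<in> L2 (surface_measure K)" "\<exists>d. weak_div K \<tau> d"
  using assms unfolding normal_trace_def by blast+

lemma normal_trace_zero: "normal_trace K (\<lambda>x. 0) (\<lambda>x. 0)"
  unfolding normal_trace_def using weak_div_zero by (auto intro!: exI[of _ "\<lambda>x. 0"])

lemma weak_grad_H1: "weak_grad K v G \<Longrightarrow> v \<in> H1 K"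
  by (auto simp: H1_def)

lemma normal_trace_add:
  assumes "normal_trace K \<sigma> g" "normal_trace K \<tau> h"
  shows "normal_trace K (\<lambda>x. \<sigma> x + \<tau> x) (\<lambda>x. g x + h x)"
proof -
  obtain c where c: "weak_div K \<sigma> c" "\<forall>v G. weak_grad K v G \<longrightarrow>
      l2_inner (surface_measure K) g (bdry_trace K v) = l2_inner (lebesgue_on K) \<sigma> G + l2_inner (lebesgue_on K) c v"
    using assms(1) unfolding normal_trace_def by blast
  obtain d where d: "weak_div K \<tau> d" "\<forall>v G. weak_grad K v G \<longrightarrow>
      l2_inner (surface_measure K) h (bdry_trace K v) = l2_inner (lebesgue_on K) \<tau> G + l2_inner (lebesgue_on K) d v"
    using assms(2) unfolding normal_trace_def by blast
  have "l2_inner (surface_measure K) (\<lambda>x. g x + h x) (bdry_trace K v) =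
      l2_inner (lebesgue_on K) (\<lambda>x. \<sigma> x + \<tau> x) G + l2_inner (lebesgue_on K) (\<lambda>x. c x + d x) v"
    if v: "weak_grad K v G" for v G
    using c(2)[rule_format, OF v] d(2)[rule_format, OF v] assms[THEN normal_traceD(1)] bdry_trace_L2[OF weak_grad_H1[OF v]]
      weak_divD[OF c(1)] weak_divD[OF d(1)] weak_gradD[OF v]
    by (simp add: l2_inner_add_left)
  then show ?thesis
    using weak_div_add[OF K' c(1) d(1)] L2_add[OF assms[THEN normal_traceD(1)]]
    unfolding normal_trace_def by blast
qed

lemma normal_trace_scaleR:
  assumes "normal_trace K \<tau> g"
  shows "normal_trace K (\<lambda>x. a *\<^sub>R \<tau> x) (\<lambda>x. a *\<^sub>R g x)"
proof -
  obtain d where d: "weak_div K \<tau> d" "\<forall>v G. weak_grad K v G \<longrightarrow>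
      l2_inner (surface_measure K) g (bdry_trace K v) = l2_inner (lebesgue_on K) \<tau> G + l2_inner (lebesgue_on K) d v"
    using assms unfolding normal_trace_def by blast
  have "l2_inner (surface_measure K) (\<lambda>x. a *\<^sub>R g x) (bdry_trace K v) =
      l2_inner (lebesgue_on K) (\<lambda>x. a *\<^sub>R \<tau> x) G + l2_inner (lebesgue_on K) (\<lambda>x. a *\<^sub>R d x) v"
    if v: "weak_grad K v G" for v G
    using d(2)[rule_format, OF v] by (simp add: distrib_left)
  then show ?thesis
    using weak_div_scaleR[OF K' d(1)] L2_scaleR[OF normal_traceD(1)[OF assms]]
    unfolding normal_trace_def by blast
qed

lemma normal_trace_cong_AE:
  assumes "normal_trace K \<sigma> g" "\<tau> \<in> L2 (lebesgue_on K)" "AE x in lebesgue_on K. \<tau> x = \<sigma> x"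
    "h \<in> L2 (surface_measure K)" "AE x in surface_measure K. h x = g x"
  shows "normal_trace K \<tau> h"
proof -
  obtain d where d: "weak_div K \<sigma> d" "\<forall>v G. weak_grad K v G \<longrightarrow>
      l2_inner (surface_measure K) g (bdry_trace K v) = l2_inner (lebesgue_on K) \<sigma> G + l2_inner (lebesgue_on K) d v"
    using assms(1) unfolding normal_trace_def by blast
  have "weak_div K \<tau> d"
    by (rule weak_div_cong_AE[OF K' d(1) assms(2,3) weak_divD(2)[OF d(1)]]) simp
  moreover have "l2_inner (surface_measure K) h (bdry_trace K v) =
      l2_inner (lebesgue_on K) \<tau> G + l2_inner (lebesgue_on K) d v"
    if v: "weak_grad K v G" for v G
  proof -
    have "l2_inner (surface_measure K) h (bdry_trace K v) = l2_inner (surface_measure K) g (bdry_trace K v)"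
      using bdry_trace_L2[OF weak_grad_H1[OF v]] by (intro l2_inner_cong_AE assms normal_traceD(1)[OF assms(1)]) auto
    moreover have "l2_inner (lebesgue_on K) \<tau> G = l2_inner (lebesgue_on K) \<sigma> G"
      using weak_gradD(2)[OF v] weak_divD(1)[OF d(1)] by (intro l2_inner_cong_AE assms) auto
    ultimately show ?thesis using d(2)[rule_format, OF v] by simp
  qed
  ultimately show ?thesis using assms(4) unfolding normal_trace_def by blast
qed

lemma Green_formula:
  assumes sym: "AE x in lebesgue_on K. transpose (\<tau> x) = \<tau> x"
    and g: "normal_trace K \<tau> g" and d: "weak_div K \<tau> d" and e: "weak_sym_grad K v e"
  shows "l2_inner (surface_measure K) g (bdry_trace K v) =
    l2_inner (lebesgue_on K) \<tau> e + l2_inner (lebesgue_on K) d v"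
proof -
  obtain G where G: "weak_grad K v G" "AE x in lebesgue_on K. e x = (1/2) *\<^sub>R (G x + transpose (G x))"
    using e unfolding weak_sym_grad_def by blast
  obtain c where c: "weak_div K \<tau> c" "l2_inner (surface_measure K) g (bdry_trace K v) =
      l2_inner (lebesgue_on K) \<tau> G + l2_inner (lebesgue_on K) c v"
    using g G(1) unfolding normal_trace_def by blast
  have "l2_inner (lebesgue_on K) c v = l2_inner (lebesgue_on K) d v"
    using weak_div_unique[OF K' c(1) d]
    by (intro l2_inner_cong_AE weak_divD(2)[OF c(1)] weak_divD(2)[OF d] weak_gradD(1)[OF G(1)]) auto
  moreover have "l2_inner (lebesgue_on K) \<tau> G = l2_inner (lebesgue_on K) \<tau> e"
    unfolding l2_inner_def
  proof (rule integral_cong_AE)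
    show "AE x in lebesgue_on K. \<tau> x \<bullet> G x = \<tau> x \<bullet> e x"
      using sym G(2)
    proof eventually_elim
      case (elim x)
      have "\<tau> x \<bullet> transpose (G x) = transpose (\<tau> x) \<bullet> transpose (G x)" using elim(1) by simp
      then have "\<tau> x \<bullet> transpose (G x) = \<tau> x \<bullet> G x" by (simp only: inner_transpose)
      then show ?case using elim(2) by (simp add: inner_add_right)
    qed
  qed (intro borel_measurable_integrable L2_inner_integrable weak_divD(1)[OF d] weak_gradD(2)[OF G(1)]
      weak_sym_gradD(1)[OF e])+
  ultimately show ?thesis using c(2) by simp
qed

lemma l2_subspace_divfree_normal_traces:
  assumes "l2_subspace (lebesgue_on K) S"
  shows "l2_subspace (surface_measure K) (divfree_normal_traces K S)"
  unfolding divfree_normal_traces_def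
proof (rule l2_subspace_image[OF assms], goal_cases)
  case (1 \<tau> g) then show ?case using normal_traceD(1) by blast
next
  case 2 show ?case using weak_div_zero normal_trace_zero by simp
next
  case (3 \<tau> g \<tau>' g')
  then show ?case using weak_div_add[OF K', of \<tau> "\<lambda>x. 0" \<tau>' "\<lambda>x. 0"] normal_trace_add by simp
next
  case (4 \<tau> g c)
  then show ?case using weak_div_scaleR[OF K', of \<tau> "\<lambda>x. 0" c] normal_trace_scaleR by simp
next
  case (5 \<tau> g h)
  then show ?case using normal_trace_cong_AE[of \<tau> g \<tau> h] weak_divD(1) by auto
qed

lemma l2_subspace_normal_traces:
  assumes "l2_subspace (lebesgue_on K) S"
  shows "l2_subspace (surface_measure K) {g. \<exists>\<tau>\<in>S. normal_trace K \<tau> g}"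
proof (rule l2_subspace_image[OF assms], goal_cases)
  case (1 \<tau> g) then show ?case using normal_traceD(1) by blast
next
  case 2 show ?case using normal_trace_zero by simp
next
  case (3 \<tau> g \<tau>' g') then show ?case using normal_trace_add by simp
next
  case (4 \<tau> g c) then show ?case using normal_trace_scaleR by simp
next
  case (5 \<tau> g h)
  then show ?case using normal_trace_cong_AE[of \<tau> g \<tau> h] l2_subspace_L2[OF assms] by auto
qed

lemma l2_subspace_bdry_traces:
  assumes V: "l2_subspace (lebesgue_on K) V" "V \<subseteq> H1 K"
    and zero: "P (\<lambda>x. 0)"
    and add: "\<And>u v. P u \<Longrightarrow> P v \<Longrightarrow> P (\<lambda>x. u x + v x)"
    and scale: "\<And>u c. P u \<Longrightarrow> P (\<lambda>x. c *\<^sub>R u x)"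
  shows "l2_subspace (surface_measure K) {g \<in> L2 (surface_measure K).
    \<exists>v\<in>V. P v \<and> (AE x in surface_measure K. g x = bdry_trace K v x)}"
proof -
  have "l2_subspace (surface_measure K) {g. \<exists>v\<in>V. g \<in> L2 (surface_measure K) \<and> P v \<and>
      (AE x in surface_measure K. g x = bdry_trace K v x)}"
  proof (rule l2_subspace_image[OF V(1)], goal_cases)
    case 2
    have "AE x in surface_measure K. 0 = bdry_trace K (\<lambda>x. 0) x"
      using bdry_trace_zero by eventually_elim simp
    then show ?case using zero by simp
  next
    case (3 u g v h)
    have g: "AE x in surface_measure K. g x = bdry_trace K u x"
      and h: "AE x in surface_measure K. h x = bdry_trace K v x" using 3 by simp_all
    have "u \<in> H1 K" "v \<in> H1 K" using 3 V(2) by auto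
    then have "AE x in surface_measure K. bdry_trace K (\<lambda>x. u x + v x) x = bdry_trace K u x + bdry_trace K v x"
      by (rule bdry_trace_add)
    with g h have "AE x in surface_measure K. g x + h x = bdry_trace K (\<lambda>x. u x + v x) x"
      by eventually_elim simp
    then show ?case using 3 add by auto
  next
    case (4 u g c)
    have g: "AE x in surface_measure K. g x = bdry_trace K u x" using 4 by simp
    have "u \<in> H1 K" using 4 V(2) by auto
    then have "AE x in surface_measure K. bdry_trace K (\<lambda>x. c *\<^sub>R u x) x = c *\<^sub>R bdry_trace K u x"
      by (rule bdry_trace_scaleR)
    with g have "AE x in surface_measure K. c *\<^sub>R g x = bdry_trace K (\<lambda>x. c *\<^sub>R u x) x"
      by eventually_elim simp
    then show ?case using 4 scale by auto
  next
    case (5 u g h)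
    have "AE x in surface_measure K. g x = bdry_trace K u x" using 5 by simp
    with 5(4) have "AE x in surface_measure K. h x = bdry_trace K u x"
      by eventually_elim simp
    then show ?case using 5 by simp
  qed simp
  moreover have "{g. \<exists>v\<in>V. g \<in> L2 (surface_measure K) \<and> P v \<and> (AE x in surface_measure K. g x = bdry_trace K v x)}
    = {g \<in> L2 (surface_measure K). \<exists>v\<in>V. P v \<and> (AE x in surface_measure K. g x = bdry_trace K v x)}"
    by blast
  ultimately show ?thesis by simp
qed

lemma l2_subspace_rigid_traces:
  assumes V: "l2_subspace (lebesgue_on K) V" "V \<subseteq> H1 K"
  shows "l2_subspace (surface_measure K) (rigid_traces K V)"
  unfolding rigid_traces_def
proof (rule l2_subspace_bdry_traces[where P = "\<lambda>v. weak_sym_grad K v (\<lambda>x. 0)", OF V weak_sym_grad_zero])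
  show "weak_sym_grad K (\<lambda>x. u x + v x) (\<lambda>x. 0)"
    if "weak_sym_grad K u (\<lambda>x. 0)" "weak_sym_grad K v (\<lambda>x. 0)" for u v
    using weak_sym_grad_add[OF that] by simp
  show "weak_sym_grad K (\<lambda>x. c *\<^sub>R u x) (\<lambda>x. 0)" if "weak_sym_grad K u (\<lambda>x. 0)" for u c
    using weak_sym_grad_scaleR[OF that, of c] by simp
qed

lemma l2_subspace_div_image:
  assumes S: "l2_subspace (lebesgue_on K) S"
  shows "l2_subspace (lebesgue_on K) (div_image K S)"
  unfolding div_image_def
proof (rule l2_subspace_image[OF S], goal_cases)
  case (1 \<tau> d) then show ?case using weak_divD(2) by blast
next
  case 2 show ?case by (rule weak_div_zero)
next
  case (3 \<tau> g \<tau>' g') then show ?case using weak_div_add[OF K'] by simp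
next
  case (4 \<tau> g c) then show ?case using weak_div_scaleR[OF K'] by simp
next
  case (5 \<tau> d c)
  then show ?case using weak_div_cong_AE[OF K', of \<tau> d \<tau> c] weak_divD(1) by auto
qed

lemma l2_subspace_sym_grad_image:
  assumes V: "l2_subspace (lebesgue_on K) V" "V \<subseteq> H1 K"
  shows "l2_subspace (lebesgue_on K) (sym_grad_image K V)"
  unfolding sym_grad_image_def
proof (rule l2_subspace_image[OF V(1)], goal_cases)
  case (1 v e) then show ?case using weak_sym_gradD(1) by blast
next
  case 2 show ?case by (rule weak_sym_grad_zero)
next
  case (3 u e v e') then show ?case using weak_sym_grad_add by simp
next
  case (4 u e c) then show ?case using weak_sym_grad_scaleR by simp
next
  case (5 v e e')
  then show ?case using weak_sym_grad_cong_AE[of v e v e'] H1_L2[of v] V(2) by auto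
qed

lemma tr_image_eq:
  "tr_image K S V = l2_sum (surface_measure K) {g. \<exists>\<tau>\<in>S. normal_trace K \<tau> g}
    {g \<in> L2 (surface_measure K). \<exists>v\<in>V. True \<and> (AE x in surface_measure K. g x = bdry_trace K v x)}"
  if "V \<subseteq> H1 K"
proof (rule equalityI; rule subsetI)
  fix g assume "g \<in> tr_image K S V"
  then obtain \<tau> v h where g: "\<tau> \<in> S" "v \<in> V" "g \<in> L2 (surface_measure K)" "normal_trace K \<tau> h"
    "AE x in surface_measure K. g x = h x + bdry_trace K v x"
    unfolding tr_image_def tr_def by blast
  have "v \<in> H1 K" using g(2) that by blast
  then show "g \<in> l2_sum (surface_measure K) {g. \<exists>\<tau>\<in>S. normal_trace K \<tau> g}
    {g \<in> L2 (surface_measure K). \<exists>v\<in>V. True \<and> (AE x in surface_measure K. g x = bdry_trace K v x)}"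
    using g bdry_trace_L2[of v] by (intro l2_sumI[of g _ h _ "bdry_trace K v"]) auto
next
  fix g assume "g \<in> l2_sum (surface_measure K) {g. \<exists>\<tau>\<in>S. normal_trace K \<tau> g}
    {g \<in> L2 (surface_measure K). \<exists>v\<in>V. True \<and> (AE x in surface_measure K. g x = bdry_trace K v x)}"
  then obtain \<tau> v h w where g: "g \<in> L2 (surface_measure K)" "\<tau> \<in> S" "normal_trace K \<tau> h" "v \<in> V"
    "AE x in surface_measure K. w x = bdry_trace K v x" "AE x in surface_measure K. g x = h x + w x"
    unfolding l2_sum_def by blast
  have "AE x in surface_measure K. g x = h x + bdry_trace K v x"
    using g(5,6) by eventually_elim simp
  then show "g \<in> tr_image K S V"
    using g unfolding tr_image_def tr_def by blast
qed

end


section \<open>The decomposition theorem\<close>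

context
  fixes K :: "(real^'n) set"
    and S :: "(real^'n \<Rightarrow> real^'n^'n) set"
    and V M :: "(real^'n \<Rightarrow> real^'n) set"
  assumes K: "polyhedral_element K"
    and S: "l2_findim_subspace (lebesgue_on K) S" "S \<subseteq> stress_space K"
    and V: "l2_findim_subspace (lebesgue_on K) V" "V \<subseteq> H1 K"
    and M: "l2_findim_subspace (surface_measure K) M"
    and trM: "tr_image K S V \<subseteq> M"
begin

private lemma subs:
  "l2_subspace (lebesgue_on K) S" "l2_subspace (lebesgue_on K) V" "l2_subspace (surface_measure K) M"
  using S V M by (simp_all add: l2_findim_subspace_def)

private lemmas S_L2 = l2_subspace_L2[OF subs(1)]
private lemmas V_L2 = l2_subspace_L2[OF subs(2)]
private lemmas M_L2 = l2_subspace_L2[OF subs(3)]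

private lemma V_H1: "v \<in> V \<Longrightarrow> v \<in> H1 K"
  using V(2) by blast

private lemma trace_L2: "v \<in> V \<Longrightarrow> bdry_trace K v \<in> L2 (surface_measure K)"
  using bdry_trace_L2[OF K V_H1] .

private lemma S_sym: "\<tau> \<in> S \<Longrightarrow> AE x in lebesgue_on K. transpose (\<tau> x) = \<tau> x"
  using S(2) unfolding stress_space_def Hdiv_sym_def by blast

private lemma S_normal_trace: "\<tau> \<in> S \<Longrightarrow> \<exists>g. normal_trace K \<tau> g"
  using S(2) unfolding stress_space_def by blast

private lemma S_div: "\<tau> \<in> S \<Longrightarrow> \<exists>d. weak_div K \<tau> d"
  using S(2) unfolding stress_space_def Hdiv_sym_def by blast

private lemma V_sym_grad: "v \<in> V \<Longrightarrow> \<exists>e. weak_sym_grad K v e"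
  using weak_sym_grad_exists[OF K V_H1] .

private lemma Green:
  "\<lbrakk>\<tau> \<in> S; normal_trace K \<tau> g; weak_div K \<tau> d; weak_sym_grad K v e\<rbrakk> \<Longrightarrow>
    l2_inner (surface_measure K) g (bdry_trace K v) =
      l2_inner (lebesgue_on K) \<tau> e + l2_inner (lebesgue_on K) d v"
  using Green_formula[OF K S_sym] .

private lemma normal_trace_M:
  assumes "\<tau> \<in> S" "normal_trace K \<tau> g"
  shows "g \<in> M"
proof -
  have "AE x in surface_measure K. g x = g x + bdry_trace K (\<lambda>x. 0) x"
    using bdry_trace_zero[OF K] by eventually_elim simp
  then have "tr K \<tau> (\<lambda>x. 0) g"
    unfolding tr_def using assms(2) normal_traceD(1)[OF K assms(2)] by blast
  then show ?thesis
    using trM assms(1) l2_subspaceD(2)[OF subs(2)] unfolding tr_image_def by blast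
qed

private lemma trace_M:
  assumes "v \<in> V"
  shows "bdry_trace K v \<in> M"
proof -
  have "tr K (\<lambda>x. 0) v (bdry_trace K v)"
    unfolding tr_def using trace_L2[OF assms] normal_trace_zero[OF K] by fastforce
  then show ?thesis
    using trM assms l2_subspaceD(2)[OF subs(1)] unfolding tr_image_def by blast
qed

private abbreviation (input) "A \<equiv> divfree_normal_traces K S"
private abbreviation (input) "B \<equiv> rigid_traces K V"

private lemma A_subspace: "l2_subspace (surface_measure K) A"
  using l2_subspace_divfree_normal_traces[OF K subs(1)] .

private lemma B_subspace: "l2_subspace (surface_measure K) B"
  using l2_subspace_rigid_traces[OF K subs(2) V(2)] .

private lemma A_subset_M: "A \<subseteq> M"
  unfolding divfree_normal_traces_def using normal_trace_M by blast

private lemma B_D: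
  assumes "g \<in> B"
  obtains v where "v \<in> V" "weak_sym_grad K v (\<lambda>x. 0)" "AE x in surface_measure K. g x = bdry_trace K v x"
    "g \<in> L2 (surface_measure K)"
  using assms unfolding rigid_traces_def by blast

private lemma B_subset_M: "B \<subseteq> M"
proof
  fix g assume "g \<in> B"
  then obtain v where "v \<in> V" "AE x in surface_measure K. g x = bdry_trace K v x" "g \<in> L2 (surface_measure K)"
    by (rule B_D)
  then show "g \<in> M" using l2_subspaceD(5)[OF subs(3) trace_M] by blast
qed

lemma divfree_rigid_orthogonal:
  assumes "f \<in> divfree_normal_traces K S" "g \<in> rigid_traces K V"
  shows "l2_inner (surface_measure K) f g = 0"
proof -
  obtain \<tau> where \<tau>: "\<tau> \<in> S" "weak_div K \<tau> (\<lambda>x. 0)" "normal_trace K \<tau> f"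
    using assms(1) unfolding divfree_normal_traces_def by blast
  obtain v where v: "v \<in> V" "weak_sym_grad K v (\<lambda>x. 0)"
    "AE x in surface_measure K. g x = bdry_trace K v x" "g \<in> L2 (surface_measure K)"
    using assms(2) by (rule B_D)
  note f = normal_traceD(1)[OF K \<tau>(3)]
  have "l2_inner (surface_measure K) f g = l2_inner (surface_measure K) f (bdry_trace K v)"
    using v(3) by (intro l2_inner_cong_AE f v(4) trace_L2[OF v(1)]) auto
  then show ?thesis using Green[OF \<tau>(1,3,2) v(2)] by simp
qed

lemma M_index_zero_iff:
  "M_index K S V M = 0 \<longleftrightarrow> l2_sum (surface_measure K) (divfree_normal_traces K S) (rigid_traces K V) = M"
proof -
  have "M_index K S V M = 0 \<longleftrightarrow> l2_dim (surface_measure K) M = l2_dim (surface_measure K) A + l2_dim (surface_measure K) B"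
    unfolding M_index_def by linarith
  then show ?thesis
    using l2_orthogonal_dim_iff[OF M A_subspace A_subset_M B_subspace B_subset_M divfree_rigid_orthogonal]
    by simp
qed

text \<open>
  If \<open>m \<in> M\<close> is orthogonal to both summands, then \<open>\<langle>\<tau> n, m\<rangle>\<close> depends only on \<open>\<nabla>\<cdot>\<tau>\<close>, so that it is
  \<open>(\<nabla>\<cdot>\<tau>, d)\<close> for some \<open>d \<in> \<nabla>\<cdot>\<Sigma>\<close>.  Expanding \<open>m - d = h + w\<close> by the decomposition gives \<open>h = 0\<close>, and
  \<open>z = d + w\<close> is a rigid motion with trace \<open>m\<close>.
\<close>

lemma M_decomposition_sum:
  assumes "admits_M_decomposition K S V M"
  shows "l2_sum (surface_measure K) (divfree_normal_traces K S) (rigid_traces K V) = M"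
proof (rule l2_subspace_eqI[OF M l2_subspace_l2_sum[OF A_subspace B_subspace]
      l2_sum_subset[OF subs(3) A_subset_M B_subset_M]])
  let ?\<mu> = "lebesgue_on K" and ?\<sigma> = "surface_measure K"
  fix m assume m: "m \<in> M" and orth: "\<And>h. h \<in> l2_sum ?\<sigma> A B \<Longrightarrow> l2_inner ?\<sigma> m h = 0"
  have orthA: "l2_inner ?\<sigma> g m = 0" if "g \<in> A" for g
    using orth[of g] l2_sum_left[OF A_subspace B_subspace] that by (auto simp: l2_inner_commute[of _ g m])
  have orthB: "l2_inner ?\<sigma> m g = 0" if "g \<in> B" for g
    using orth[of g] l2_sum_right[OF A_subspace B_subspace] that by auto
  note mL = M_L2[OF m]
  obtain S' V' where S': "l2_subspace ?\<mu> S'" "S' \<subseteq> S" and V': "l2_subspace ?\<mu> V'" "V' \<subseteq> V"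
    and SG: "sym_grad_image K V \<subseteq> S'" and DI: "div_image K S \<subseteq> V'"
    and tr: "tr_image K (l2_orth_compl ?\<mu> S S') (l2_orth_compl ?\<mu> V V') = M"
    using assms unfolding admits_M_decomposition_def Let_def by (elim conjE exE)
  have sg: "e \<in> S'" if "v \<in> V" "weak_sym_grad K v e" for v e
    using that SG unfolding sym_grad_image_def by blast
  have di: "d \<in> V'" if "\<tau> \<in> S" "weak_div K \<tau> d" for \<tau> d
    using that DI unfolding div_image_def by blast
  define R where "R d r \<longleftrightarrow> (\<exists>\<tau>\<in>S. weak_div K \<tau> d \<and> (\<exists>g. normal_trace K \<tau> g \<and> r = l2_inner ?\<sigma> g m))" for d r
  obtain d0 where d0: "d0 \<in> div_image K S" "\<And>d r. d \<in> div_image K S \<Longrightarrow> R d r \<Longrightarrow> r = l2_inner ?\<mu> d d0"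
  proof (rule l2_representation[OF V(1) l2_subspace_div_image[OF K subs(1)], of R])
    show "div_image K S \<subseteq> V" using DI V'(2) by blast
    show "\<exists>r. R d r" if "d \<in> div_image K S" for d
      using that S_normal_trace unfolding R_def div_image_def by blast
    show "R (\<lambda>x. d x + d' x) (r + r')" if RR: "R d r" "R d' r'" for d r d' r'
    proof -
      obtain \<tau> g where 1: "\<tau> \<in> S" "weak_div K \<tau> d" "normal_trace K \<tau> g" "r = l2_inner ?\<sigma> g m"
        using RR(1) unfolding R_def by blast
      obtain \<tau>' g' where 2: "\<tau>' \<in> S" "weak_div K \<tau>' d'" "normal_trace K \<tau>' g'" "r' = l2_inner ?\<sigma> g' m"
        using RR(2) unfolding R_def by blast
      have "r + r' = l2_inner ?\<sigma> (\<lambda>x. g x + g' x) m"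
        using l2_inner_add_left[OF normal_traceD(1)[OF K 1(3)] normal_traceD(1)[OF K 2(3)] mL] 1(4) 2(4) by simp
      then show ?thesis
        unfolding R_def
        using l2_subspaceD(3)[OF subs(1) 1(1) 2(1)] normal_trace_add[OF K 1(3) 2(3)]
          weak_div_add[OF polyhedral_element_open[OF K] polyhedral_element_bounded[OF K] 1(2) 2(2)] by blast
    qed
    show "R (\<lambda>x. c *\<^sub>R d x) (c * r)" if R: "R d r" for c d r
    proof -
      obtain \<tau> g where 1: "\<tau> \<in> S" "weak_div K \<tau> d" "normal_trace K \<tau> g" "r = l2_inner ?\<sigma> g m"
        using R unfolding R_def by blast
      have "c * r = l2_inner ?\<sigma> (\<lambda>x. c *\<^sub>R g x) m" using 1(4) by simp
      then show ?thesis
        unfolding R_def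
        using l2_subspaceD(4)[OF subs(1) 1(1)] normal_trace_scaleR[OF K 1(3)]
          weak_div_scaleR[OF polyhedral_element_open[OF K] polyhedral_element_bounded[OF K] 1(2)] by blast
    qed
    show "r = 0" if R: "R d r" and d: "AE x in ?\<mu>. d x = 0" for d r
    proof -
      obtain \<tau> g where 1: "\<tau> \<in> S" "weak_div K \<tau> d" "normal_trace K \<tau> g" "r = l2_inner ?\<sigma> g m"
        using R unfolding R_def by blast
      have "AE x in ?\<mu>. 0 = d x" using d by eventually_elim simp
      then have "weak_div K \<tau> (\<lambda>x. 0)"
        by (intro weak_div_cong_AE[OF polyhedral_element_open[OF K] polyhedral_element_bounded[OF K] 1(2)]
            weak_divD(1)[OF 1(2)]) auto
      then have "g \<in> A" using 1 unfolding divfree_normal_traces_def by blast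
      then show ?thesis using orthA 1(4) by simp
    qed
  qed blast
  have key: "l2_inner ?\<sigma> g m = l2_inner ?\<mu> d d0" if "\<tau> \<in> S" "normal_trace K \<tau> g" "weak_div K \<tau> d" for \<tau> g d
    using d0(2)[of d "l2_inner ?\<sigma> g m"] that unfolding R_def div_image_def by blast
  have d0V: "d0 \<in> V" using d0(1) DI V'(2) by blast
  note d0L = V_L2[OF d0V] trace_L2[OF d0V]
  have "(\<lambda>x. m x - bdry_trace K d0 x) \<in> M"
    using l2_subspace_diff[OF subs(3) m trace_M[OF d0V]] .
  then obtain \<tau> w h where \<tau>: "\<tau> \<in> l2_orth_compl ?\<mu> S S'" and w: "w \<in> l2_orth_compl ?\<mu> V V'"
    and h: "normal_trace K \<tau> h" and eq: "AE x in ?\<sigma>. m x - bdry_trace K d0 x = h x + bdry_trace K w x"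
    unfolding tr[symmetric] tr_image_def tr_def by blast
  have \<tau>S: "\<tau> \<in> S" and \<tau>0: "\<And>e. e \<in> S' \<Longrightarrow> l2_inner ?\<mu> \<tau> e = 0"
    using \<tau> by (auto simp: l2_orth_compl_def)
  have wV: "w \<in> V" and w0: "\<And>d. d \<in> V' \<Longrightarrow> l2_inner ?\<mu> d w = 0"
    using w by (auto simp: l2_orth_compl_def l2_inner_commute[of _ _ w])
  note hL = normal_traceD(1)[OF K h] and wL = V_L2[OF wV] trace_L2[OF wV]
  obtain d where d: "weak_div K \<tau> d" using S_div[OF \<tau>S] by blast
  obtain e0 where e0: "weak_sym_grad K d0 e0" using V_sym_grad[OF d0V] by blast
  obtain ew where ew: "weak_sym_grad K w ew" using V_sym_grad[OF wV] by blast
  have "l2_inner ?\<sigma> h (\<lambda>x. m x - bdry_trace K d0 x) = l2_inner ?\<mu> d d0 - (0 + l2_inner ?\<mu> d d0)"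
    using l2_inner_diff_right[OF mL d0L(2) hL] key[OF \<tau>S h d] Green[OF \<tau>S h d e0] \<tau>0[OF sg[OF d0V e0]] by simp
  moreover have "l2_inner ?\<sigma> h (\<lambda>x. m x - bdry_trace K d0 x) = l2_inner ?\<sigma> h (\<lambda>x. h x + bdry_trace K w x)"
    by (intro l2_inner_cong_AE hL L2_diff mL d0L L2_add wL eq AE_I2 refl)
  moreover have "l2_inner ?\<sigma> h (\<lambda>x. h x + bdry_trace K w x) = l2_inner ?\<sigma> h h + 0"
    using l2_inner_add_right[OF hL wL(2) hL] Green[OF \<tau>S h d ew] \<tau>0[OF sg[OF wV ew]] w0[OF di[OF \<tau>S d]] by simp
  ultimately have "l2_inner ?\<sigma> h h = 0" by simp
  then have h0: "AE x in ?\<sigma>. h x = 0" using l2_inner_self_eq_0_iff[OF hL] by simp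
  define z where "z = (\<lambda>x. d0 x + w x)"
  have zV: "z \<in> V" unfolding z_def using l2_subspaceD(3)[OF subs(2) d0V wV] .
  have mz: "AE x in ?\<sigma>. m x = bdry_trace K z x"
    using eq h0 bdry_trace_add[OF K V_H1[OF d0V] V_H1[OF wV]]
    by eventually_elim (simp add: z_def algebra_simps)
  obtain ez where ez: "weak_sym_grad K z ez" using V_sym_grad[OF zV] by blast
  have ezS: "ez \<in> S" using sg[OF zV ez] S'(2) by blast
  obtain g1 where g1: "normal_trace K ez g1" using S_normal_trace[OF ezS] by blast
  obtain d1 where d1: "weak_div K ez d1" using S_div[OF ezS] by blast
  note g1L = normal_traceD(1)[OF K g1]
  have "l2_inner ?\<sigma> g1 m = l2_inner ?\<sigma> g1 (bdry_trace K z)"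
    by (intro l2_inner_cong_AE g1L mL trace_L2[OF zV] mz AE_I2 refl)
  moreover have "l2_inner ?\<mu> d1 z = l2_inner ?\<mu> d1 d0"
    unfolding z_def using l2_inner_add_right[OF d0L(1) wL(1) weak_divD(2)[OF d1]] w0[OF di[OF ezS d1]] by simp
  ultimately have "l2_inner ?\<mu> ez ez = 0"
    using key[OF ezS g1 d1] Green[OF ezS g1 d1 ez] by simp
  then have ez0: "AE x in ?\<mu>. ez x = 0" using l2_inner_self_eq_0_iff[OF S_L2[OF ezS]] by simp
  have "AE x in ?\<mu>. 0 = ez x" using ez0 by eventually_elim simp
  then have "weak_sym_grad K z (\<lambda>x. 0)"
    by (intro weak_sym_grad_cong_AE[OF K ez V_L2[OF zV]]) auto
  then have "m \<in> B" unfolding rigid_traces_def using mL zV mz by blast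
  then have "l2_inner ?\<sigma> m m = 0" by (rule orthB)
  then show "AE x in ?\<sigma>. m x = 0" using l2_inner_self_eq_0_iff[OF mL] by simp
qed

text \<open>
  The subspaces are \<open>\<epsilon>(V)\<close> plus the divergence-free stresses with zero normal trace, and \<open>\<nabla>\<cdot>\<Sigma>\<close> plus
  the rigid motions with zero trace.  Injectivity follows from orthogonality of the two traces.  For
  surjectivity, let \<open>m \<in> M\<close> be orthogonal to the image.  Then \<open>\<langle>\<tau> n, m\<rangle> = (\<tau>, \<epsilon>(q))\<close> and
  \<open>\<langle>w, m\<rangle> = (w, \<nabla>\<cdot>\<rho>)\<close> for some \<open>q\<close> and \<open>\<rho>\<close>, whence \<open>m\<close> is both the trace of \<open>q\<close> plus a rigid motion
  and the normal trace of \<open>\<rho>\<close> plus a divergence-free stress.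
\<close>

lemma admits_M_decompositionI:
  assumes SG: "sym_grad_image K V \<subseteq> S" and DI: "div_image K S \<subseteq> V"
    and sum: "l2_sum (surface_measure K) (divfree_normal_traces K S) (rigid_traces K V) = M"
  shows "admits_M_decomposition K S V M"
proof -
  let ?\<mu> = "lebesgue_on K" and ?\<sigma> = "surface_measure K"
  note K' = polyhedral_element_open[OF K] polyhedral_element_bounded[OF K]
  let ?E = "sym_grad_image K V" and ?D = "div_image K S"
  define \<Phi> where "\<Phi> = {\<tau> \<in> S. weak_div K \<tau> (\<lambda>x. 0) \<and> normal_trace K \<tau> (\<lambda>x. 0)}"
  define Z where "Z = {v \<in> V. weak_sym_grad K v (\<lambda>x. 0) \<and> (AE x in ?\<sigma>. bdry_trace K v x = 0)}"
  note E = l2_subspace_sym_grad_image[OF K subs(2) V(2)] and D = l2_subspace_div_image[OF K subs(1)]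
  have \<Phi>: "l2_subspace ?\<mu> \<Phi>"
    unfolding \<Phi>_def
  proof (rule l2_subspace_Collect[OF subs(1)], goal_cases)
    case 1 show ?case using weak_div_zero[OF K] normal_trace_zero[OF K] by simp
  next
    case (2 \<sigma> \<tau>)
    then show ?case
      using weak_div_add[OF K', of \<sigma> "\<lambda>x. 0" \<tau> "\<lambda>x. 0"] normal_trace_add[OF K, of \<sigma> "\<lambda>x. 0" \<tau> "\<lambda>x. 0"] by simp
  next
    case (3 \<tau> c)
    then show ?case
      using weak_div_scaleR[OF K', of \<tau> "\<lambda>x. 0" c] normal_trace_scaleR[OF K, of \<tau> "\<lambda>x. 0" c] by simp
  next
    case (4 \<sigma> \<tau>)
    then show ?case
      using weak_div_cong_AE[OF K', of \<sigma> "\<lambda>x. 0" \<tau> "\<lambda>x. 0"]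
        normal_trace_cong_AE[OF K, of \<sigma> "\<lambda>x. 0" \<tau> "\<lambda>x. 0"] S_L2[of \<tau>] by simp
  qed
  have Z: "l2_subspace ?\<mu> Z"
    unfolding Z_def
  proof (rule l2_subspace_Collect[OF subs(2)], goal_cases)
    case 1 show ?case using weak_sym_grad_zero[OF K] bdry_trace_zero[OF K] by simp
  next
    case (2 u v)
    have "AE x in ?\<sigma>. bdry_trace K u x = 0" "AE x in ?\<sigma>. bdry_trace K v x = 0" using 2 by simp_all
    with bdry_trace_add[OF K V_H1[OF 2(1)] V_H1[OF 2(2)]]
    have "AE x in ?\<sigma>. bdry_trace K (\<lambda>x. u x + v x) x = 0" by eventually_elim simp
    then show ?case using 2 weak_sym_grad_add[OF K, of u "\<lambda>x. 0" v "\<lambda>x. 0"] by simp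
  next
    case (3 v c)
    have "AE x in ?\<sigma>. bdry_trace K v x = 0" using 3 by simp
    with bdry_trace_scaleR[OF K V_H1[OF 3(1)], of c]
    have "AE x in ?\<sigma>. bdry_trace K (\<lambda>x. c *\<^sub>R v x) x = 0" by eventually_elim simp
    then show ?case using 3 weak_sym_grad_scaleR[OF K, of v "\<lambda>x. 0" c] by simp
  next
    case (4 u v)
    let ?w = "\<lambda>x. v x + (-1) *\<^sub>R u x"
    have H: "(\<lambda>x. (-1) *\<^sub>R u x) \<in> H1 K" "?w \<in> H1 K"
      using H1_scaleR[OF K V_H1[OF 4(1)], of "-1"] H1_add[OF K V_H1[OF 4(2)]] by blast+
    have "AE x in ?\<mu>. ?w x = 0" using 4(4) by eventually_elim simp
    then have "AE x in ?\<sigma>. bdry_trace K ?w x = 0" by (rule bdry_trace_AE_zero[OF K H(2)])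
    moreover have "AE x in ?\<sigma>. bdry_trace K u x = 0" using 4 by simp
    ultimately have "AE x in ?\<sigma>. bdry_trace K v x = 0"
      using bdry_trace_add[OF K V_H1[OF 4(2)] H(1)] bdry_trace_scaleR[OF K V_H1[OF 4(1)], of "-1"]
      by eventually_elim simp
    then show ?case
      using 4 weak_sym_grad_cong_AE[OF K, of u "\<lambda>x. 0" v "\<lambda>x. 0"] V_L2[of v] by simp
  qed
  define S' where "S' = l2_sum ?\<mu> ?E \<Phi>"
  define V' where "V' = l2_sum ?\<mu> ?D Z"
  have S': "l2_subspace ?\<mu> S'" "S' \<subseteq> S" "?E \<subseteq> S'" "\<Phi> \<subseteq> S'"
    unfolding S'_def
    using l2_subspace_l2_sum[OF E \<Phi>] l2_sum_subset[OF subs(1) SG, of \<Phi>] l2_sum_left[OF E \<Phi>] l2_sum_right[OF E \<Phi>]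
    by (auto simp: \<Phi>_def)
  have V': "l2_subspace ?\<mu> V'" "V' \<subseteq> V" "?D \<subseteq> V'" "Z \<subseteq> V'"
    unfolding V'_def
    using l2_subspace_l2_sum[OF D Z] l2_sum_subset[OF subs(2) DI, of Z] l2_sum_left[OF D Z] l2_sum_right[OF D Z]
    by (auto simp: Z_def)
  define Sp where "Sp = l2_orth_compl ?\<mu> S S'"
  define Vp where "Vp = l2_orth_compl ?\<mu> V V'"
  have Sp: "l2_subspace ?\<mu> Sp" and Vp: "l2_subspace ?\<mu> Vp"
    unfolding Sp_def Vp_def
    using l2_subspace_orth_compl[OF subs(1) l2_subspaceD(1)[OF S'(1)]]
      l2_subspace_orth_compl[OF subs(2) l2_subspaceD(1)[OF V'(1)]] by auto
  have SpS: "\<tau> \<in> S" and Sp0: "e \<in> S' \<Longrightarrow> l2_inner ?\<mu> \<tau> e = 0" if "\<tau> \<in> Sp" for \<tau> e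
    using that by (auto simp: Sp_def l2_orth_compl_def)
  have VpV: "v \<in> V" and Vp0: "d \<in> V' \<Longrightarrow> l2_inner ?\<mu> d v = 0" if "v \<in> Vp" for v d
    using that by (auto simp: Vp_def l2_orth_compl_def l2_inner_commute[of _ _ v])
  have VpH1: "Vp \<subseteq> H1 K" using VpV V_H1 by blast
  have sg: "e \<in> ?E" if "v \<in> V" "weak_sym_grad K v e" for v e
    using that unfolding sym_grad_image_def by blast
  have di: "d \<in> ?D" if "\<tau> \<in> S" "weak_div K \<tau> d" for \<tau> d
    using that unfolding div_image_def by blast
  have sgS': "e \<in> S'" if "v \<in> V" "weak_sym_grad K v e" for v e
    using sg[OF that] S'(3) by blast
  have diV': "d \<in> V'" if "\<tau> \<in> S" "weak_div K \<tau> d" for \<tau> d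
    using di[OF that] V'(3) by blast
  have trR: "tr_image K Sp Vp \<subseteq> M"
    using trM SpS VpV unfolding tr_image_def by blast
  have R_eq: "tr_image K Sp Vp = l2_sum ?\<sigma> {g. \<exists>\<tau>\<in>Sp. normal_trace K \<tau> g}
      {g \<in> L2 ?\<sigma>. \<exists>v\<in>Vp. True \<and> (AE x in ?\<sigma>. g x = bdry_trace K v x)}"
    using tr_image_eq[OF K VpH1] .
  note NT = l2_subspace_normal_traces[OF K Sp]
  have BT: "l2_subspace ?\<sigma> {g \<in> L2 ?\<sigma>. \<exists>v\<in>Vp. True \<and> (AE x in ?\<sigma>. g x = bdry_trace K v x)}"
    by (rule l2_subspace_bdry_traces[where P = "\<lambda>v. True", OF K Vp VpH1]) auto
  have surj: "tr_image K Sp Vp = M"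
  proof (rule l2_subspace_eqI[OF M _ trR])
    show "l2_subspace ?\<sigma> (tr_image K Sp Vp)"
      unfolding R_eq using NT BT by (rule l2_subspace_l2_sum)
    fix m assume m: "m \<in> M" and orth: "\<And>h. h \<in> tr_image K Sp Vp \<Longrightarrow> l2_inner ?\<sigma> m h = 0"
    note mL = M_L2[OF m]
    have mN: "l2_inner ?\<sigma> g m = 0" if "\<tau> \<in> Sp" "normal_trace K \<tau> g" for \<tau> g
    proof -
      have "g \<in> tr_image K Sp Vp"
        unfolding R_eq using l2_sum_left[OF NT BT] that by blast
      then show ?thesis using orth by (simp add: l2_inner_commute[of _ g m])
    qed
    have mT: "l2_inner ?\<sigma> (bdry_trace K v) m = 0" if "v \<in> Vp" for v
    proof -
      have "bdry_trace K v \<in> tr_image K Sp Vp"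
        unfolding R_eq using l2_sum_right[OF NT BT] that trace_L2[OF VpV[OF that]] by blast
      then show ?thesis using orth by (simp add: l2_inner_commute[of _ "bdry_trace K v" m])
    qed
    define R1 where "R1 \<tau> r \<longleftrightarrow> \<tau> \<in> S \<and> (\<exists>g. normal_trace K \<tau> g \<and> r = l2_inner ?\<sigma> g m)" for \<tau> r
    obtain \<tau>0 where \<tau>0: "\<tau>0 \<in> S" "\<And>\<tau> r. \<tau> \<in> S \<Longrightarrow> R1 \<tau> r \<Longrightarrow> r = l2_inner ?\<mu> \<tau> \<tau>0"
    proof (rule l2_representation[OF S(1) subs(1) order_refl, of R1])
      show "\<exists>r. R1 \<tau> r" if "\<tau> \<in> S" for \<tau> using that S_normal_trace unfolding R1_def by blast
      show "R1 (\<lambda>x. \<tau> x + \<tau>' x) (r + r')" if R: "R1 \<tau> r" "R1 \<tau>' r'" for \<tau> r \<tau>' r'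
      proof -
        obtain g where g: "\<tau> \<in> S" "normal_trace K \<tau> g" "r = l2_inner ?\<sigma> g m" using R(1) unfolding R1_def by blast
        obtain g' where g': "\<tau>' \<in> S" "normal_trace K \<tau>' g'" "r' = l2_inner ?\<sigma> g' m" using R(2) unfolding R1_def by blast
        have "r + r' = l2_inner ?\<sigma> (\<lambda>x. g x + g' x) m"
          using l2_inner_add_left[OF normal_traceD(1)[OF K g(2)] normal_traceD(1)[OF K g'(2)] mL] g(3) g'(3) by simp
        then show ?thesis
          unfolding R1_def using l2_subspaceD(3)[OF subs(1) g(1) g'(1)] normal_trace_add[OF K g(2) g'(2)] by blast
      qed
      show "R1 (\<lambda>x. c *\<^sub>R \<tau> x) (c * r)" if R: "R1 \<tau> r" for c \<tau> r
      proof -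
        obtain g where g: "\<tau> \<in> S" "normal_trace K \<tau> g" "r = l2_inner ?\<sigma> g m" using R unfolding R1_def by blast
        have "c * r = l2_inner ?\<sigma> (\<lambda>x. c *\<^sub>R g x) m" using g(3) by simp
        then show ?thesis
          unfolding R1_def using l2_subspaceD(4)[OF subs(1) g(1)] normal_trace_scaleR[OF K g(2)] by blast
      qed
      show "r = 0" if R: "R1 \<tau> r" and z: "AE x in ?\<mu>. \<tau> x = 0" for \<tau> r
      proof -
        obtain g where g: "\<tau> \<in> S" "normal_trace K \<tau> g" "r = l2_inner ?\<sigma> g m" using R unfolding R1_def by blast
        have "\<tau> \<in> Sp"
          using l2_subspaceD(5)[OF Sp l2_subspaceD(2)[OF Sp] S_L2[OF g(1)] z] .
        then show ?thesis using mN g by simp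
      qed
    qed blast
    have keyS: "l2_inner ?\<sigma> g m = l2_inner ?\<mu> \<tau> \<tau>0" if "\<tau> \<in> S" "normal_trace K \<tau> g" for \<tau> g
      using \<tau>0(2)[of \<tau> "l2_inner ?\<sigma> g m"] that unfolding R1_def by blast
    note \<tau>0L = S_L2[OF \<tau>0(1)]
    have "\<tau>0 \<in> S'"
    proof -
      obtain p where p: "p \<in> S'" "\<And>h. h \<in> S' \<Longrightarrow> l2_inner ?\<mu> (\<lambda>x. \<tau>0 x - p x) h = 0"
        using l2_decompose[OF S(1) S'(1,2) \<tau>0L] by blast
      let ?q = "\<lambda>x. \<tau>0 x - p x"
      have pS: "p \<in> S" using p(1) S'(2) by blast
      have qS: "?q \<in> S" using l2_subspace_diff[OF subs(1) \<tau>0(1) pS] .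
      then have q: "?q \<in> Sp" using p(2) unfolding Sp_def l2_orth_compl_def by blast
      obtain g where g: "normal_trace K ?q g" using S_normal_trace[OF qS] by blast
      have "l2_inner ?\<mu> ?q ?q = l2_inner ?\<mu> ?q \<tau>0 - l2_inner ?\<mu> ?q p"
        by (rule l2_inner_diff_right[OF \<tau>0L S_L2[OF pS] S_L2[OF qS]])
      also have "\<dots> = 0" using keyS[OF qS g] mN[OF q g] p by simp
      finally have "AE x in ?\<mu>. ?q x = 0" using l2_inner_self_eq_0_iff[OF S_L2[OF qS]] by simp
      then show ?thesis using l2_subspaceD(5)[OF S'(1) p(1) \<tau>0L] by simp
    qed
    then obtain e \<phi> where e: "e \<in> ?E" and \<phi>: "\<phi> \<in> \<Phi>" and \<tau>0_eq: "AE x in ?\<mu>. \<tau>0 x = e x + \<phi> x"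
      unfolding S'_def l2_sum_def by blast
    obtain q where q: "q \<in> V" "weak_sym_grad K q e" using e unfolding sym_grad_image_def by blast
    note eL = weak_sym_gradD(1)[OF K q(2)]
    have \<phi>S: "\<phi> \<in> S" "weak_div K \<phi> (\<lambda>x. 0)" "normal_trace K \<phi> (\<lambda>x. 0)" using \<phi> unfolding \<Phi>_def by auto
    note \<phi>L = S_L2[OF \<phi>S(1)]
    have "l2_inner ?\<mu> \<phi> \<tau>0 = l2_inner ?\<mu> \<phi> (\<lambda>x. e x + \<phi> x)"
      by (intro l2_inner_cong_AE \<phi>L \<tau>0L L2_add eL \<tau>0_eq AE_I2 refl)
    also have "\<dots> = l2_inner ?\<mu> \<phi> e + l2_inner ?\<mu> \<phi> \<phi>" by (rule l2_inner_add_right[OF eL \<phi>L \<phi>L])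
    also have "l2_inner ?\<mu> \<phi> e = 0" using Green[OF \<phi>S(1,3,2) q(2)] by simp
    finally have "l2_inner ?\<mu> \<phi> \<phi> = 0" using keyS[OF \<phi>S(1,3)] by simp
    then have "AE x in ?\<mu>. \<phi> x = 0" using l2_inner_self_eq_0_iff[OF \<phi>L] by simp
    with \<tau>0_eq have \<tau>0e: "AE x in ?\<mu>. \<tau>0 x = e x" by eventually_elim simp
    have keyS': "l2_inner ?\<sigma> g m = l2_inner ?\<mu> \<tau> e" if "\<tau> \<in> S" "normal_trace K \<tau> g" for \<tau> g
      unfolding keyS[OF that] by (intro l2_inner_cong_AE S_L2[OF that(1)] \<tau>0L eL \<tau>0e AE_I2 refl)
    note qL = trace_L2[OF q(1)]
    have "(\<lambda>x. m x - bdry_trace K q x) \<in> l2_sum ?\<sigma> A B"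
      unfolding sum using l2_subspace_diff[OF subs(3) m trace_M[OF q(1)]] .
    then obtain a b where a: "a \<in> A" and b: "b \<in> B" and ab: "AE x in ?\<sigma>. m x - bdry_trace K q x = a x + b x"
      unfolding l2_sum_def by blast
    note aL = l2_subspace_L2[OF A_subspace a] and bL = l2_subspace_L2[OF B_subspace b]
    obtain \<alpha> where \<alpha>: "\<alpha> \<in> S" "weak_div K \<alpha> (\<lambda>x. 0)" "normal_trace K \<alpha> a"
      using a unfolding divfree_normal_traces_def by blast
    obtain r where r: "r \<in> V" "weak_sym_grad K r (\<lambda>x. 0)" "AE x in ?\<sigma>. b x = bdry_trace K r x"
      using b by (rule B_D)
    have "l2_inner ?\<sigma> a (\<lambda>x. a x + b x) = l2_inner ?\<sigma> a (\<lambda>x. m x - bdry_trace K q x)"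
      using ab by (intro l2_inner_cong_AE aL L2_add bL L2_diff mL qL) (auto elim: eventually_mono)
    also have "\<dots> = 0"
      using l2_inner_diff_right[OF mL qL aL] keyS'[OF \<alpha>(1,3)] Green[OF \<alpha>(1,3,2) q(2)] by simp
    finally have "l2_inner ?\<sigma> a a = 0"
      using l2_inner_add_right[OF aL bL aL] divfree_rigid_orthogonal[OF a b] by simp
    then have a0: "AE x in ?\<sigma>. a x = 0" using l2_inner_self_eq_0_iff[OF aL] by simp
    define z where "z = (\<lambda>x. q x + r x)"
    have zV: "z \<in> V" unfolding z_def using l2_subspaceD(3)[OF subs(2) q(1) r(1)] .
    have ze: "weak_sym_grad K z e" unfolding z_def using weak_sym_grad_add[OF K q(2) r(2)] by simp
    have mz: "AE x in ?\<sigma>. m x = bdry_trace K z x"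
      using ab a0 r(3) bdry_trace_add[OF K V_H1[OF q(1)] V_H1[OF r(1)]]
      by eventually_elim (simp add: z_def algebra_simps)
    have zdiv: "l2_inner ?\<mu> d z = 0" if \<tau>: "\<tau> \<in> S" "weak_div K \<tau> d" for \<tau> d
    proof -
      obtain g where g: "normal_trace K \<tau> g" using S_normal_trace[OF \<tau>(1)] by blast
      have "l2_inner ?\<sigma> g m = l2_inner ?\<sigma> g (bdry_trace K z)"
        by (intro l2_inner_cong_AE normal_traceD(1)[OF K g] mL trace_L2[OF zV] mz AE_I2 refl)
      then show ?thesis using keyS'[OF \<tau>(1) g] Green[OF \<tau>(1) g \<tau>(2) ze] by simp
    qed
    define R2 where "R2 v r \<longleftrightarrow> v \<in> V \<and> r = l2_inner ?\<sigma> (bdry_trace K v) m" for v r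
    obtain p0 where p0: "p0 \<in> V" "\<And>v r. v \<in> V \<Longrightarrow> R2 v r \<Longrightarrow> r = l2_inner ?\<mu> v p0"
    proof (rule l2_representation[OF V(1) subs(2) order_refl, of R2])
      show "\<exists>r. R2 v r" if "v \<in> V" for v using that unfolding R2_def by blast
      show "R2 (\<lambda>x. u x + v x) (r + s)" if R: "R2 u r" "R2 v s" for u r v s
      proof -
        have uv: "u \<in> V" "v \<in> V" using R unfolding R2_def by auto
        note uvV = l2_subspaceD(3)[OF subs(2) uv]
        have "l2_inner ?\<sigma> (bdry_trace K (\<lambda>x. u x + v x)) m = l2_inner ?\<sigma> (\<lambda>x. bdry_trace K u x + bdry_trace K v x) m"
          by (intro l2_inner_cong_AE trace_L2[OF uvV] L2_add uv[THEN trace_L2] mL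
              bdry_trace_add[OF K uv[THEN V_H1]] AE_I2 refl)
        then show ?thesis
          using R uvV l2_inner_add_left[OF uv[THEN trace_L2] mL] unfolding R2_def by simp
      qed
      show "R2 (\<lambda>x. c *\<^sub>R u x) (c * r)" if R: "R2 u r" for c u r
      proof -
        have u: "u \<in> V" using R unfolding R2_def by auto
        note cu = l2_subspaceD(4)[OF subs(2) u, of c]
        have "l2_inner ?\<sigma> (bdry_trace K (\<lambda>x. c *\<^sub>R u x)) m = l2_inner ?\<sigma> (\<lambda>x. c *\<^sub>R bdry_trace K u x) m"
          by (intro l2_inner_cong_AE trace_L2[OF cu] L2_scaleR trace_L2[OF u] mL
              bdry_trace_scaleR[OF K V_H1[OF u]] AE_I2 refl)
        then show ?thesis using R cu unfolding R2_def by simp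
      qed
      show "r = 0" if R: "R2 v r" and v0: "AE x in ?\<mu>. v x = 0" for v r
      proof -
        have v: "v \<in> V" using R unfolding R2_def by auto
        then show ?thesis
          using R l2_inner_AE_zero(1)[OF trace_L2[OF v] mL bdry_trace_AE_zero[OF K V_H1[OF v] v0]]
          unfolding R2_def by simp
      qed
    qed blast
    have keyV: "l2_inner ?\<sigma> (bdry_trace K v) m = l2_inner ?\<mu> v p0" if "v \<in> V" for v
      using p0(2)[OF that] that unfolding R2_def by blast
    note p0L = V_L2[OF p0(1)]
    have "p0 \<in> V'"
    proof -
      obtain p where p: "p \<in> V'" "\<And>h. h \<in> V' \<Longrightarrow> l2_inner ?\<mu> (\<lambda>x. p0 x - p x) h = 0"
        using l2_decompose[OF V(1) V'(1,2) p0L] by blast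
      let ?y = "\<lambda>x. p0 x - p x"
      have pV: "p \<in> V" using p(1) V'(2) by blast
      have yV: "?y \<in> V" using l2_subspace_diff[OF subs(2) p0(1) pV] .
      then have y: "?y \<in> Vp" using p(2) unfolding Vp_def l2_orth_compl_def by blast
      have "l2_inner ?\<mu> ?y ?y = l2_inner ?\<mu> ?y p0 - l2_inner ?\<mu> ?y p"
        by (rule l2_inner_diff_right[OF p0L V_L2[OF pV] V_L2[OF yV]])
      also have "\<dots> = 0" using keyV[OF yV] mT[OF y] p by simp
      finally have "AE x in ?\<mu>. ?y x = 0" using l2_inner_self_eq_0_iff[OF V_L2[OF yV]] by simp
      then show ?thesis using l2_subspaceD(5)[OF V'(1) p(1) p0L] by simp
    qed
    then obtain d \<zeta> where d: "d \<in> ?D" and \<zeta>: "\<zeta> \<in> Z" and p0_eq: "AE x in ?\<mu>. p0 x = d x + \<zeta> x"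
      unfolding V'_def l2_sum_def by blast
    obtain \<rho> where \<rho>: "\<rho> \<in> S" "weak_div K \<rho> d" using d unfolding div_image_def by blast
    obtain h\<rho> where h\<rho>: "normal_trace K \<rho> h\<rho>" using S_normal_trace[OF \<rho>(1)] by blast
    note dL = weak_divD(2)[OF \<rho>(2)] and h\<rho>L = normal_traceD(1)[OF K h\<rho>]
    have \<zeta>V: "\<zeta> \<in> V" "weak_sym_grad K \<zeta> (\<lambda>x. 0)" "AE x in ?\<sigma>. bdry_trace K \<zeta> x = 0"
      using \<zeta> unfolding Z_def by auto
    note \<zeta>L = V_L2[OF \<zeta>V(1)] and \<zeta>0 = l2_inner_AE_zero[OF trace_L2[OF \<zeta>V(1)] _ \<zeta>V(3)]
    have "l2_inner ?\<mu> \<zeta> p0 = l2_inner ?\<mu> \<zeta> (\<lambda>x. d x + \<zeta> x)"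
      by (intro l2_inner_cong_AE \<zeta>L p0L L2_add dL p0_eq AE_I2 refl)
    also have "\<dots> = l2_inner ?\<mu> d \<zeta> + l2_inner ?\<mu> \<zeta> \<zeta>"
      using l2_inner_add_right[OF dL \<zeta>L \<zeta>L] by (simp add: l2_inner_commute[of _ \<zeta> d])
    also have "l2_inner ?\<mu> d \<zeta> = 0" using Green[OF \<rho>(1) h\<rho> \<rho>(2) \<zeta>V(2)] \<zeta>0(2)[OF h\<rho>L] by simp
    finally have "l2_inner ?\<mu> \<zeta> \<zeta> = 0" using keyV[OF \<zeta>V(1)] \<zeta>0(1)[OF mL] by simp
    then have "AE x in ?\<mu>. \<zeta> x = 0" using l2_inner_self_eq_0_iff[OF \<zeta>L] by simp
    with p0_eq have p0d: "AE x in ?\<mu>. p0 x = d x" by eventually_elim simp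
    have keyV': "l2_inner ?\<sigma> m (bdry_trace K v) = l2_inner ?\<mu> d v" if v: "v \<in> V" for v
    proof -
      have "l2_inner ?\<mu> p0 v = l2_inner ?\<mu> d v"
        by (intro l2_inner_cong_AE p0L dL V_L2[OF v] p0d AE_I2 refl)
      then show ?thesis using keyV[OF v] by (simp add: l2_inner_commute)
    qed
    have "(\<lambda>x. m x - h\<rho> x) \<in> l2_sum ?\<sigma> A B"
      unfolding sum using l2_subspace_diff[OF subs(3) m normal_trace_M[OF \<rho>(1) h\<rho>]] .
    then obtain a' b' where a': "a' \<in> A" and b': "b' \<in> B" and ab': "AE x in ?\<sigma>. m x - h\<rho> x = a' x + b' x"
      unfolding l2_sum_def by blast
    note a'L = l2_subspace_L2[OF A_subspace a'] and b'L = l2_subspace_L2[OF B_subspace b']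
    obtain \<alpha>' where \<alpha>': "\<alpha>' \<in> S" "weak_div K \<alpha>' (\<lambda>x. 0)" "normal_trace K \<alpha>' a'"
      using a' unfolding divfree_normal_traces_def by blast
    obtain r' where r': "r' \<in> V" "weak_sym_grad K r' (\<lambda>x. 0)" "AE x in ?\<sigma>. b' x = bdry_trace K r' x"
      using b' by (rule B_D)
    have "l2_inner ?\<sigma> (\<lambda>x. a' x + b' x) b' = l2_inner ?\<sigma> (\<lambda>x. m x - h\<rho> x) (bdry_trace K r')"
      using ab' by (intro l2_inner_cong_AE L2_add a'L b'L L2_diff mL h\<rho>L trace_L2[OF r'(1)] r'(3)) (auto elim: eventually_mono)
    also have "\<dots> = 0"
      using l2_inner_diff_left[OF mL h\<rho>L trace_L2[OF r'(1)]] keyV'[OF r'(1)] Green[OF \<rho>(1) h\<rho> \<rho>(2) r'(2)] by simp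
    finally have "l2_inner ?\<sigma> b' b' = 0"
      using l2_inner_add_left[OF a'L b'L b'L] divfree_rigid_orthogonal[OF a' b'] by simp
    then have b'0: "AE x in ?\<sigma>. b' x = 0" using l2_inner_self_eq_0_iff[OF b'L] by simp
    define \<theta> where "\<theta> = (\<lambda>x. \<rho> x + \<alpha>' x)"
    have \<theta>S: "\<theta> \<in> S" unfolding \<theta>_def using l2_subspaceD(3)[OF subs(1) \<rho>(1) \<alpha>'(1)] .
    have \<theta>d: "weak_div K \<theta> d" unfolding \<theta>_def using weak_div_add[OF K' \<rho>(2) \<alpha>'(2)] by simp
    have "AE x in ?\<sigma>. m x = h\<rho> x + a' x"
      using ab' b'0 by eventually_elim (simp add: algebra_simps)
    then have \<theta>m: "normal_trace K \<theta> m"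
      unfolding \<theta>_def
      by (intro normal_trace_cong_AE[OF K normal_trace_add[OF K h\<rho> \<alpha>'(3)]] mL S_L2[OF \<theta>S[unfolded \<theta>_def]]) auto
    have "l2_inner ?\<mu> \<theta> e = 0"
      using keyV'[OF q(1)] Green[OF \<theta>S \<theta>m \<theta>d q(2)] by simp
    then have "l2_inner ?\<sigma> m (bdry_trace K z) = 0"
      using Green[OF \<theta>S \<theta>m \<theta>d ze] zdiv[OF \<rho>] by simp
    moreover have "l2_inner ?\<sigma> m m = l2_inner ?\<sigma> m (bdry_trace K z)"
      by (intro l2_inner_cong_AE mL trace_L2[OF zV] mz AE_I2 refl)
    ultimately show "AE x in ?\<sigma>. m x = 0" using l2_inner_self_eq_0_iff[OF mL] by simp
  qed
  have inj: "(AE x in ?\<mu>. \<tau> x = \<tau>' x) \<and> (AE x in ?\<mu>. v x = v' x)"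
    if \<tau>: "\<tau> \<in> Sp" "\<tau>' \<in> Sp" and v: "v \<in> Vp" "v' \<in> Vp" and g: "tr K \<tau> v g" "tr K \<tau>' v' g" for \<tau> \<tau>' v v' g
  proof -
    obtain h where h: "normal_trace K \<tau> h" "AE x in ?\<sigma>. g x = h x + bdry_trace K v x"
      using g(1) unfolding tr_def by blast
    obtain h' where h': "normal_trace K \<tau>' h'" "AE x in ?\<sigma>. g x = h' x + bdry_trace K v' x"
      using g(2) unfolding tr_def by blast
    define T where "T = (\<lambda>x. \<tau> x + (-1) *\<^sub>R \<tau>' x)"
    define H where "H = (\<lambda>x. h x + (-1) *\<^sub>R h' x)"
    define w where "w = (\<lambda>x. v x + (-1) *\<^sub>R v' x)"
    have T: "T \<in> Sp" unfolding T_def by (intro l2_subspaceD(3,4)[OF Sp] \<tau>)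
    have w: "w \<in> Vp" unfolding w_def by (intro l2_subspaceD(3,4)[OF Vp] v)
    have H: "normal_trace K T H" unfolding T_def H_def
      by (intro normal_trace_add[OF K h(1)] normal_trace_scaleR[OF K h'(1)])
    note TS = SpS[OF T] and wV = VpV[OF w] and HL = normal_traceD(1)[OF K H]
    note wL = trace_L2[OF wV]
    have v'V: "(\<lambda>x. (-1) *\<^sub>R v' x) \<in> V" by (intro l2_subspaceD(4)[OF subs(2)] VpV v)
    have Hw: "AE x in ?\<sigma>. H x + bdry_trace K w x = 0"
      using h(2) h'(2) bdry_trace_add[OF K V_H1[OF VpV[OF v(1)]] V_H1[OF v'V], folded w_def]
        bdry_trace_scaleR[OF K V_H1[OF VpV[OF v(2)]], of "-1"]
    proof eventually_elim
      case (elim x)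
      have "H x + bdry_trace K w x = (h x + bdry_trace K v x) - (h' x + bdry_trace K v' x)"
        unfolding elim(3,4) H_def by (simp add: algebra_simps)
      then show ?case using elim(1,2) by simp
    qed
    obtain d where d: "weak_div K T d" using S_div[OF TS] by blast
    obtain e where e: "weak_sym_grad K w e" using V_sym_grad[OF wV] by blast
    have "l2_inner ?\<sigma> H (bdry_trace K w) = 0"
      using Green[OF TS H d e] Sp0[OF T sgS'[OF wV e]] Vp0[OF w diV'[OF TS d]] by simp
    moreover have "l2_inner ?\<sigma> H (\<lambda>x. H x + bdry_trace K w x) = 0"
      by (rule l2_inner_AE_zero(2)[OF L2_add[OF HL wL] HL Hw])
    ultimately have "l2_inner ?\<sigma> H H = 0" using l2_inner_add_right[OF HL wL HL] by simp
    then have H0: "AE x in ?\<sigma>. H x = 0" using l2_inner_self_eq_0_iff[OF HL] by simp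
    then have w0: "AE x in ?\<sigma>. bdry_trace K w x = 0" using Hw by eventually_elim simp
    have "AE x in ?\<sigma>. 0 = H x" using H0 by eventually_elim simp
    then have T0: "normal_trace K T (\<lambda>x. 0)"
      by (intro normal_trace_cong_AE[OF K H S_L2[OF TS]]) auto
    have dV: "d \<in> V" using di[OF TS d] DI by blast
    obtain ed where ed: "weak_sym_grad K d ed" using V_sym_grad[OF dV] by blast
    have "l2_inner ?\<mu> d d = 0"
      using Green[OF TS T0 d ed] Sp0[OF T sgS'[OF dV ed]] by simp
    then have d0: "AE x in ?\<mu>. d x = 0" using l2_inner_self_eq_0_iff[OF V_L2[OF dV]] by simp
    have "AE x in ?\<mu>. 0 = d x" using d0 by eventually_elim simp
    then have "weak_div K T (\<lambda>x. 0)"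
      by (intro weak_div_cong_AE[OF K' d S_L2[OF TS]]) auto
    then have "T \<in> S'" using T0 TS S'(4) unfolding \<Phi>_def by blast
    then have "l2_inner ?\<mu> T T = 0" by (rule Sp0[OF T])
    then have T_0: "AE x in ?\<mu>. T x = 0" using l2_inner_self_eq_0_iff[OF S_L2[OF TS]] by simp
    have eS: "e \<in> S" using sg[OF wV e] SG by blast
    obtain g1 where g1: "normal_trace K e g1" using S_normal_trace[OF eS] by blast
    obtain d1 where d1: "weak_div K e d1" using S_div[OF eS] by blast
    have "l2_inner ?\<mu> e e = 0"
      using Green[OF eS g1 d1 e] l2_inner_AE_zero(2)[OF wL normal_traceD(1)[OF K g1] w0] Vp0[OF w diV'[OF eS d1]] by simp
    then have e0: "AE x in ?\<mu>. e x = 0" using l2_inner_self_eq_0_iff[OF S_L2[OF eS]] by simp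
    have "AE x in ?\<mu>. 0 = e x" using e0 by eventually_elim simp
    then have "weak_sym_grad K w (\<lambda>x. 0)"
      by (intro weak_sym_grad_cong_AE[OF K e V_L2[OF wV]]) auto
    then have "w \<in> V'" using w0 wV V'(4) unfolding Z_def by blast
    then have "l2_inner ?\<mu> w w = 0" by (rule Vp0[OF w])
    then have w_0: "AE x in ?\<mu>. w x = 0" using l2_inner_self_eq_0_iff[OF V_L2[OF wV]] by simp
    have "AE x in ?\<mu>. \<tau> x = \<tau>' x" using T_0 by eventually_elim (simp add: T_def)
    moreover have "AE x in ?\<mu>. v x = v' x" using w_0 by eventually_elim (simp add: w_def)
    ultimately show ?thesis by simp
  qed
  show ?thesis
    unfolding admits_M_decomposition_def Let_def
    using trM S'(1-3) V'(1-3) surj inj unfolding Sp_def Vp_def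
    by (intro conjI exI[of _ S'] exI[of _ V'] ballI allI impI) (assumption | blast)+
qed

end

theorem theorem3p2:
  fixes K :: "(real^'n) set"
    and S :: "(real^'n \<Rightarrow> real^'n^'n) set"
    and V M :: "(real^'n \<Rightarrow> real^'n) set"
  assumes "CARD('n) = 2 \<or> CARD('n) = 3"
    and "polyhedral_element K"
    and "l2_findim_subspace (lebesgue_on K) S" and "S \<subseteq> stress_space K"
    and "l2_findim_subspace (lebesgue_on K) V" and "V \<subseteq> H1 K"
    and "l2_findim_subspace (surface_measure K) M"
  shows "(admits_M_decomposition K S V M \<longleftrightarrow>
            tr_image K S V \<subseteq> M \<and>
            (sym_grad_image K V \<subseteq> S \<and> div_image K S \<subseteq> V) \<and>
            M_index K S V M = 0) \<and>
         (admits_M_decomposition K S V M \<longrightarrow>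
            l2_orthogonal_direct_sum (surface_measure K) M
              (divfree_normal_traces K S) (rigid_traces K V))"
proof (intro conjI iffI impI)
  assume adm: "admits_M_decomposition K S V M"
  show trM: "tr_image K S V \<subseteq> M" using adm unfolding admits_M_decomposition_def by blast
  show "sym_grad_image K V \<subseteq> S" "div_image K S \<subseteq> V"
    using adm unfolding admits_M_decomposition_def by blast+
  note hyps = assms(2-7) trM
  note sum = M_decomposition_sum[OF hyps adm]
  show "M_index K S V M = 0" using M_index_zero_iff[OF hyps] sum by blast
  show "l2_orthogonal_direct_sum (surface_measure K) M (divfree_normal_traces K S) (rigid_traces K V)"
    unfolding l2_orthogonal_direct_sum_def
  proof (intro conjI ballI)
    show "M = l2_sum (surface_measure K) (divfree_normal_traces K S) (rigid_traces K V)"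
      using sum by (rule sym)
    show orth: "l2_inner (surface_measure K) f g = 0"
      if "f \<in> divfree_normal_traces K S" "g \<in> rigid_traces K V" for f g
      using divfree_rigid_orthogonal[OF hyps that] .
    show "AE x in surface_measure K. f x = 0" if f: "f \<in> divfree_normal_traces K S \<inter> rigid_traces K V" for f
    proof -
      have "f \<in> L2 (surface_measure K)" using f unfolding rigid_traces_def by blast
      then show ?thesis using orth[of f f] f l2_inner_self_eq_0_iff by blast
    qed
  qed
next
  assume "tr_image K S V \<subseteq> M \<and> (sym_grad_image K V \<subseteq> S \<and> div_image K S \<subseteq> V) \<and> M_index K S V M = 0"
  then have h: "tr_image K S V \<subseteq> M" "sym_grad_image K V \<subseteq> S" "div_image K S \<subseteq> V" "M_index K S V M = 0"
    by auto
  note hyps = assms(2-7) h(1)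
  have "l2_sum (surface_measure K) (divfree_normal_traces K S) (rigid_traces K V) = M"
    using M_index_zero_iff[OF hyps] h(4) by blast
  then show "admits_M_decomposition K S V M"
    by (rule admits_M_decompositionI[OF hyps h(2,3)])
qed

end
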